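(* Let $\mathcal{X}$ be a 0-cell in a 2-category $\mathcal{A}$ with finite products such that the exponential $\mathcal{X}^{\mathcal{X}}$ exists. Then the 2-categories $\mathbf{Mon}_l(\mathcal{A})_{/_l\mathcal{X}^{\mathcal{X}}}$ and $\mathbf{Act}_l\mathbf{Mon}_l(\mathcal{A},\mathcal{X})$ are naturally isomorphic. Under this correspondence strong representations (i.e. strong monoidal 1-cells into $\mathcal{X}^{\mathcal{X}}$) are sent to strong actions.
   Context: Limits and exponentials are strict: $\mathcal{X}^{\mathcal{X}}$ is a 0-cell with isomorphisms of categories $\mathcal{A}(\mathcal{E}\times\mathcal{X},\mathcal{X})\cong\mathcal{A}(\mathcal{E},\mathcal{X}^{\mathcal{X}})$, 2-natural in $\mathcal{E}$. It is a strict monoidal object with tensor the composition 1-cell (exponentially adjoint to $ev\circ(1\times ev):\mathcal{X}^{\mathcal{X}}\times\mathcal{X}^{\mathcal{X}}\times\mathcal{X}\to\mathcal{X}$) and unit the name of $1_{\mathcal{X}}$. Formulas with variables are read with variables denoting product projections. $\mathbf{Mon}_l(\mathcal{A})$: 0-cells are monoidal objects $(\mathcal{C},\otimes,I,\alpha,\lambda,\rho)$, with invertible 2-cells $\alpha_{A,B,C}:A\otimes(B\otimes C)\to(A\otimes B)\otimes C$, $\lambda_A:I\otimes A\to A$, $\rho_A:A\otimes I\to A$ satisfying the usual pentagon and triangle axioms; 1-cells are lax monoidal 1-cells $(F,\phi,\bar\phi)$, with $\phi:F(A)\otimes'F(B)\to F(A\otimes B)$ and $\bar\phi:I'\to F(I)$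 satisfying the usual axioms (strong if $\phi,\bar\phi$ are invertible); 2-cells are monoidal transformations. Lax slice $\mathcal{B}_{/_l\mathcal{M}}$ of a 2-category $\mathcal{B}$ over a 0-cell $\mathcal{M}$: 0-cells are 1-cells $b:B\to\mathcal{M}$; a 1-cell $(F,\theta):(B,b)\to(C,c)$ is a 1-cell $F:B\to C$ with a 2-cell $\theta:cF\to b$; a 2-cell $\tau:(F,\theta)\to(F',\theta')$ is a 2-cell $\tau:F\to F'$ with $\theta'\circ c(\tau)=\theta$. $\mathbf{Act}_l\mathbf{Mon}_l(\mathcal{A},\mathcal{X})$: a 0-cell is a monoidal object $(\mathcal{C},\otimes,I,\alpha,\lambda,\rho)$ with a 1-cell $\star:\mathcal{C}\times\mathcal{X}\to\mathcal{X}$ and 2-cells $\psi:A\star(B\star X)\to(A\otimes B)\star X$, $\bar\psi:X\to I\star X$ such that $(\alpha_{A,B,C}\star1)\circ\psi_{A,B\otimes C,X}\circ(1_A\star\psi_{B,C,X})=\psi_{A\otimes B,C,X}\circ\psi_{A,B,C\star X}$, $(\lambda_A\star1)\circ\psi_{I,A,X}\circ\bar\psi_{A\star X}=1_{A\star X}$, $(\rho_A\star1)\circ\psi_{A,I,X}\circ(1_A\star\bar\psi_X)=1_{A\star X}$. The action is strong if $\psi$ and $\bar\psi$ are invertible. A 1-cell $(F,\phi,\xi):(\mathcal{C},\star,\psi)\to(\mathcal{C}',\star',\psi')$ is a lax monoidal 1-cell $(F,\phi):\mathcal{C}\to\mathcal{C}'$ with a 2-cell $\xi:F(A)\star'X\to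 A\star X$ such that $\xi_{A\otimes B,X}\circ(\phi_{A,B}\star'1)\circ\psi'_{F(A),F(B),X}=\psi_{A,B,X}\circ\xi_{A,B\star X}\circ(1_{F(A)}\star'\xi_{B,X})$ and $\xi_{I,X}\circ(\bar\phi\star'1)\circ\bar\psi'_X=\bar\psi_X$. A 2-cell $\tau:(F,\phi,\xi)\to(F',\phi',\xi')$ is a monoidal transformation $\tau:(F,\phi)\to(F',\phi')$ with $\xi'\circ(\tau\star'1_X)=\xi$. *)

theory Defs
  imports Main
begin

section \<open>Strict 2-categories and 2-functors\<close>

record ('o, 'a, 'c) two_cat =
  cells0 :: "'o set"
  cells1 :: "'a set"
  cells2 :: "'c set"
  src :: "'a \<Rightarrow> 'o"
  trg :: "'a \<Rightarrow> 'o"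
  Dom :: "'c \<Rightarrow> 'a"
  Cod :: "'c \<Rightarrow> 'a"
  idn1 :: "'o \<Rightarrow> 'a" ("id1\<index>")
  idn2 :: "'a \<Rightarrow> 'c" ("id2\<index>")
  comp1 :: "'a \<Rightarrow> 'a \<Rightarrow> 'a" (infixr "\<cdot>\<index>" 75)
  vcomp :: "'c \<Rightarrow> 'c \<Rightarrow> 'c" (infixr "\<bullet>\<index>" 60)
  hcomp :: "'c \<Rightarrow> 'c \<Rightarrow> 'c" (infixr "\<ast>\<index>" 70)

text \<open>All compositions are written in applicative order: \<open>g \<cdot> f\<close> is \<open>f\<close> followed by \<open>g\<close>,
  and likewise for the vertical composition \<open>\<bullet>\<close> and the horizontal composition \<open>\<ast>\<close>.\<close>

definition hom1 :: "('o, 'a, 'c, 'm) two_cat_scheme \<Rightarrow> 'o \<Rightarrow> 'o \<Rightarrow> 'a set" where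
  "hom1 A x y = {f \<in> cells1 A. src A f = x \<and> trg A f = y}"

definition hom2 :: "('o, 'a, 'c, 'm) two_cat_scheme \<Rightarrow> 'a \<Rightarrow> 'a \<Rightarrow> 'c set" where
  "hom2 A f g = {t \<in> cells2 A. Dom A t = f \<and> Cod A t = g}"

text \<open>The set of arrows of the hom-category at \<open>x\<close> and \<open>y\<close>.\<close>

definition homcat :: "('o, 'a, 'c, 'm) two_cat_scheme \<Rightarrow> 'o \<Rightarrow> 'o \<Rightarrow> 'c set" where
  "homcat A x y = {t \<in> cells2 A. Dom A t \<in> hom1 A x y \<and> Cod A t \<in> hom1 A x y}"

locale two_category =
  fixes A :: "('o, 'a, 'c, 'm) two_cat_scheme" (structure)
  assumes src_cell: "f \<in> cells1 A \<Longrightarrow> src A f \<in> cells0 A"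
    and trg_cell: "f \<in> cells1 A \<Longrightarrow> trg A f \<in> cells0 A"
    and Dom_cell: "t \<in> cells2 A \<Longrightarrow> Dom A t \<in> cells1 A"
    and Cod_cell: "t \<in> cells2 A \<Longrightarrow> Cod A t \<in> cells1 A"
    and src_Dom: "t \<in> cells2 A \<Longrightarrow> src A (Dom A t) = src A (Cod A t)"
    and trg_Dom: "t \<in> cells2 A \<Longrightarrow> trg A (Dom A t) = trg A (Cod A t)"
    and id1_hom: "x \<in> cells0 A \<Longrightarrow> id1 x \<in> hom1 A x x"
    and comp1_hom: "\<lbrakk>f \<in> hom1 A x y; g \<in> hom1 A y z\<rbrakk> \<Longrightarrow> g \<cdot> f \<in> hom1 A x z"
    and comp1_id1_right: "f \<in> hom1 A x y \<Longrightarrow> f \<cdot> id1 x = f"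
    and comp1_id1_left: "f \<in> hom1 A x y \<Longrightarrow> id1 y \<cdot> f = f"
    and comp1_assoc:
      "\<lbrakk>f \<in> hom1 A w x; g \<in> hom1 A x y; h \<in> hom1 A y z\<rbrakk> \<Longrightarrow> (h \<cdot> g) \<cdot> f = h \<cdot> (g \<cdot> f)"
    and id2_hom: "f \<in> cells1 A \<Longrightarrow> id2 f \<in> hom2 A f f"
    and vcomp_hom: "\<lbrakk>s \<in> hom2 A f g; t \<in> hom2 A g h\<rbrakk> \<Longrightarrow> t \<bullet> s \<in> hom2 A f h"
    and vcomp_id2_right: "t \<in> hom2 A f g \<Longrightarrow> t \<bullet> id2 f = t"
    and vcomp_id2_left: "t \<in> hom2 A f g \<Longrightarrow> id2 g \<bullet> t = t"
    and vcomp_assoc: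
      "\<lbrakk>r \<in> hom2 A f g; s \<in> hom2 A g h; t \<in> hom2 A h k\<rbrakk> \<Longrightarrow> (t \<bullet> s) \<bullet> r = t \<bullet> (s \<bullet> r)"
    and hcomp_hom:
      "\<lbrakk>s \<in> hom2 A f f'; t \<in> hom2 A g g'; f \<in> hom1 A x y; g \<in> hom1 A y z\<rbrakk>
       \<Longrightarrow> t \<ast> s \<in> hom2 A (g \<cdot> f) (g' \<cdot> f')"
    and hcomp_id_right: "t \<in> homcat A x y \<Longrightarrow> t \<ast> id2 (id1 x) = t"
    and hcomp_id_left: "t \<in> homcat A x y \<Longrightarrow> id2 (id1 y) \<ast> t = t"
    and hcomp_assoc:
      "\<lbrakk>r \<in> homcat A w x; s \<in> homcat A x y; t \<in> homcat A y z\<rbrakk> \<Longrightarrow> (t \<ast> s) \<ast> r = t \<ast> (s \<ast> r)"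
    and hcomp_id2: "\<lbrakk>f \<in> hom1 A x y; g \<in> hom1 A y z\<rbrakk> \<Longrightarrow> id2 g \<ast> id2 f = id2 (g \<cdot> f)"
    and interchange:
      "\<lbrakk>s \<in> hom2 A f f'; s' \<in> hom2 A f' f''; t \<in> hom2 A g g'; t' \<in> hom2 A g' g'';
        f \<in> hom1 A x y; g \<in> hom1 A y z\<rbrakk>
       \<Longrightarrow> (t' \<bullet> t) \<ast> (s' \<bullet> s) = (t' \<ast> s') \<bullet> (t \<ast> s)"

definition invertible2 :: "('o, 'a, 'c, 'm) two_cat_scheme \<Rightarrow> 'c \<Rightarrow> bool" where
  "invertible2 A t \<longleftrightarrow> t \<in> cells2 A \<and>
     (\<exists>s \<in> hom2 A (Cod A t) (Dom A t).
        vcomp A s t = idn2 A (Dom A t) \<and> vcomp A t s = idn2 A (Cod A t))"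

definition whisker_right ::
  "('o, 'a, 'c, 'm) two_cat_scheme \<Rightarrow> 'c \<Rightarrow> 'a \<Rightarrow> 'c" (infixl "\<lhd>\<index>" 72) where
  "whisker_right A t f = hcomp A t (idn2 A f)"

definition whisker_left ::
  "('o, 'a, 'c, 'm) two_cat_scheme \<Rightarrow> 'a \<Rightarrow> 'c \<Rightarrow> 'c" (infixr "\<rhd>\<index>" 71) where
  "whisker_left A g s = hcomp A (idn2 A g) s"

record ('o, 'a, 'c, 'p, 'b, 'd) two_fun =
  map0 :: "'o \<Rightarrow> 'p"
  map1 :: "'a \<Rightarrow> 'b"
  map2 :: "'c \<Rightarrow> 'd"

locale two_functor = B: two_category B + C: two_category C
  for B :: "('o, 'a, 'c, 'm) two_cat_scheme" and C :: "('p, 'b, 'd, 'n) two_cat_scheme" +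
  fixes F :: "('o, 'a, 'c, 'p, 'b, 'd) two_fun"
  assumes map0_cell: "x \<in> cells0 B \<Longrightarrow> map0 F x \<in> cells0 C"
    and map1_hom: "f \<in> hom1 B x y \<Longrightarrow> map1 F f \<in> hom1 C (map0 F x) (map0 F y)"
    and map2_hom: "t \<in> hom2 B f g \<Longrightarrow> map2 F t \<in> hom2 C (map1 F f) (map1 F g)"
    and map1_id1: "x \<in> cells0 B \<Longrightarrow> map1 F (idn1 B x) = idn1 C (map0 F x)"
    and map1_comp1: "\<lbrakk>f \<in> hom1 B x y; g \<in> hom1 B y z\<rbrakk>
       \<Longrightarrow> map1 F (comp1 B g f) = comp1 C (map1 F g) (map1 F f)"
    and map2_id2: "f \<in> cells1 B \<Longrightarrow> map2 F (idn2 B f) = idn2 C (map1 F f)"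
    and map2_vcomp: "\<lbrakk>s \<in> hom2 B f g; t \<in> hom2 B g h\<rbrakk>
       \<Longrightarrow> map2 F (vcomp B t s) = vcomp C (map2 F t) (map2 F s)"
    and map2_hcomp: "\<lbrakk>s \<in> homcat B x y; t \<in> homcat B y z\<rbrakk>
       \<Longrightarrow> map2 F (hcomp B t s) = hcomp C (map2 F t) (map2 F s)"

locale two_category_isomorphism = two_functor +
  assumes bij0: "bij_betw (map0 F) (cells0 B) (cells0 C)"
    and bij1: "bij_betw (map1 F) (cells1 B) (cells1 C)"
    and bij2: "bij_betw (map2 F) (cells2 B) (cells2 C)"

text \<open>The equation \<open>Q \<circ> F = P\<close> of 2-functors on \<open>B\<close>.\<close>

definition commutes_over ::
  "('o, 'a, 'c, 'm) two_cat_scheme \<Rightarrow> ('o, 'a, 'c, 'p, 'b, 'd) two_fun \<Rightarrow>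
   ('o, 'a, 'c, 'q, 'e, 'f) two_fun \<Rightarrow> ('p, 'b, 'd, 'q, 'e, 'f) two_fun \<Rightarrow> bool" where
  "commutes_over B F P Q \<longleftrightarrow>
     (\<forall>x \<in> cells0 B. map0 Q (map0 F x) = map0 P x) \<and>
     (\<forall>f \<in> cells1 B. map1 Q (map1 F f) = map1 P f) \<and>
     (\<forall>t \<in> cells2 B. map2 Q (map2 F t) = map2 P t)"

section \<open>Strict finite products and exponentials\<close>

record ('o, 'a, 'c) fp_two_cat = "('o, 'a, 'c) two_cat" +
  terminal :: "'o" ("\<one>\<index>")
  prd :: "'o \<Rightarrow> 'o \<Rightarrow> 'o" (infixr "\<^bold>\<times>\<index>" 80)
  pr1 :: "'o \<Rightarrow> 'o \<Rightarrow> 'a"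
  pr2 :: "'o \<Rightarrow> 'o \<Rightarrow> 'a"

text \<open>The universal properties are 2-dimensional and strict: the functor from the hom-category at
  \<open>e\<close>, \<open>x \<^bold>\<times> y\<close> to the product of the hom-categories at \<open>e\<close>, \<open>x\<close> and \<open>e\<close>, \<open>y\<close> that composes with
  the projections is bijective on objects and on arrows.\<close>

locale fp_two_category = two_category A for A :: "('o, 'a, 'c) fp_two_cat" (structure) +
  assumes terminal_cell: "\<one> \<in> cells0 A"
    and terminal_univ1: "e \<in> cells0 A \<Longrightarrow> \<exists>!f. f \<in> hom1 A e \<one>"
    and terminal_univ2: "e \<in> cells0 A \<Longrightarrow> \<exists>!t. t \<in> homcat A e \<one>"
    and prd_cell: "\<lbrakk>x \<in> cells0 A; y \<in> cells0 A\<rbrakk> \<Longrightarrow> x \<^bold>\<times> y \<in> cells0 A"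
    and pr1_hom: "\<lbrakk>x \<in> cells0 A; y \<in> cells0 A\<rbrakk> \<Longrightarrow> pr1 A x y \<in> hom1 A (x \<^bold>\<times> y) x"
    and pr2_hom: "\<lbrakk>x \<in> cells0 A; y \<in> cells0 A\<rbrakk> \<Longrightarrow> pr2 A x y \<in> hom1 A (x \<^bold>\<times> y) y"
    and prd_univ1: "\<lbrakk>f \<in> hom1 A e x; g \<in> hom1 A e y\<rbrakk>
       \<Longrightarrow> \<exists>!h. h \<in> hom1 A e (x \<^bold>\<times> y) \<and> pr1 A x y \<cdot> h = f \<and> pr2 A x y \<cdot> h = g"
    and prd_univ2: "\<lbrakk>s \<in> homcat A e x; t \<in> homcat A e y\<rbrakk>
       \<Longrightarrow> \<exists>!u. u \<in> homcat A e (x \<^bold>\<times> y) \<and> pr1 A x y \<rhd> u = s \<and> pr2 A x y \<rhd> u = t"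

definition bang :: "('o, 'a, 'c) fp_two_cat \<Rightarrow> 'o \<Rightarrow> 'a" where
  "bang A e = (THE f. f \<in> hom1 A e (terminal A))"

definition pair1 ::
  "('o, 'a, 'c) fp_two_cat \<Rightarrow> 'a \<Rightarrow> 'a \<Rightarrow> 'a" ("\<langle>_,/ _\<rangle>\<index>") where
  "pair1 A f g =
     (THE h. h \<in> hom1 A (src A f) (prd A (trg A f) (trg A g)) \<and>
        comp1 A (pr1 A (trg A f) (trg A g)) h = f \<and> comp1 A (pr2 A (trg A f) (trg A g)) h = g)"

definition pair2 ::
  "('o, 'a, 'c) fp_two_cat \<Rightarrow> 'c \<Rightarrow> 'c \<Rightarrow> 'c" ("\<llangle>_,/ _\<rrangle>\<index>") where
  "pair2 A s t = (let x = trg A (Dom A s); y = trg A (Dom A t) in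
     THE u. u \<in> homcat A (src A (Dom A s)) (prd A x y) \<and>
        whisker_left A (pr1 A x y) u = s \<and> whisker_left A (pr2 A x y) u = t)"

text \<open>The 1-cell \<open>u \<times> 1\<close> and the 2-cell \<open>b \<times> 1\<close>, from \<open>e' \<^bold>\<times> x\<close> to \<open>e \<^bold>\<times> x\<close>, for \<open>u\<close> and \<open>b\<close> from
  \<open>e'\<close> to \<open>e\<close>.\<close>

definition times1 :: "('o, 'a, 'c) fp_two_cat \<Rightarrow> 'a \<Rightarrow> 'o \<Rightarrow> 'a" where
  "times1 A u x = pair1 A (comp1 A u (pr1 A (src A u) x)) (pr2 A (src A u) x)"

definition times2 :: "('o, 'a, 'c) fp_two_cat \<Rightarrow> 'c \<Rightarrow> 'o \<Rightarrow> 'c" where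
  "times2 A b x = (let e' = src A (Dom A b) in
     pair2 A (whisker_right A b (pr1 A e' x)) (idn2 A (pr2 A e' x)))"

text \<open>\<open>p\<close> is the exponential of \<open>y\<close> by \<open>x\<close>: the maps \<open>cur1 e\<close> and \<open>cur2 e\<close> are the object and arrow
  parts of an isomorphism from the hom-category at \<open>e \<^bold>\<times> x\<close>, \<open>y\<close> to the hom-category at \<open>e\<close>, \<open>p\<close>,
  and these are 2-natural in \<open>e\<close>.\<close>

locale exponential =
  fixes A :: "('o, 'a, 'c) fp_two_cat" (structure)
    and x y p :: 'o
    and cur1 :: "'o \<Rightarrow> 'a \<Rightarrow> 'a"
    and cur2 :: "'o \<Rightarrow> 'c \<Rightarrow> 'c"
  assumes exp_cell: "p \<in> cells0 A"
    and cur1_bij: "e \<in> cells0 A \<Longrightarrow> bij_betw (cur1 e) (hom1 A (e \<^bold>\<times> x) y) (hom1 A e p)"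
    and cur2_bij: "e \<in> cells0 A \<Longrightarrow> bij_betw (cur2 e) (homcat A (e \<^bold>\<times> x) y) (homcat A e p)"
    and cur2_hom: "\<lbrakk>e \<in> cells0 A; h \<in> hom1 A (e \<^bold>\<times> x) y; t \<in> hom2 A h h'\<rbrakk>
       \<Longrightarrow> cur2 e t \<in> hom2 A (cur1 e h) (cur1 e h')"
    and cur2_id2: "\<lbrakk>e \<in> cells0 A; h \<in> hom1 A (e \<^bold>\<times> x) y\<rbrakk> \<Longrightarrow> cur2 e (id2 h) = id2 (cur1 e h)"
    and cur2_vcomp:
      "\<lbrakk>e \<in> cells0 A; h \<in> hom1 A (e \<^bold>\<times> x) y; s \<in> hom2 A h h'; t \<in> hom2 A h' h''\<rbrakk>
       \<Longrightarrow> cur2 e (t \<bullet> s) = cur2 e t \<bullet> cur2 e s"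
    and cur1_natural: "\<lbrakk>u \<in> hom1 A e' e; h \<in> hom1 A (e \<^bold>\<times> x) y\<rbrakk>
       \<Longrightarrow> cur1 e' (h \<cdot> times1 A u x) = cur1 e h \<cdot> u"
    and cur2_natural: "\<lbrakk>u \<in> hom1 A e' e; t \<in> homcat A (e \<^bold>\<times> x) y\<rbrakk>
       \<Longrightarrow> cur2 e' (t \<lhd> times1 A u x) = cur2 e t \<lhd> u"
    and cur2_natural2: "\<lbrakk>b \<in> homcat A e' e; h \<in> hom1 A (e \<^bold>\<times> x) y\<rbrakk>
       \<Longrightarrow> cur2 e' (h \<rhd> times2 A b x) = cur1 e h \<rhd> b"

definition evaluation ::
  "('o, 'a, 'c) fp_two_cat \<Rightarrow> 'o \<Rightarrow> 'o \<Rightarrow> 'o \<Rightarrow> ('o \<Rightarrow> 'a \<Rightarrow> 'a) \<Rightarrow> 'a" where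
  "evaluation A x y p cur1 = (THE e. e \<in> hom1 A (prd A p x) y \<and> cur1 p e = idn1 A p)"

section \<open>Monoidal objects and lax monoidal 1-cells\<close>

text \<open>The 1- and 2-cells of all 2-categories built below consist of a source, a target and a body.
  The source and target carry structure that the body does not determine.\<close>

datatype ('s, 'b) cell = Cell (csrc: 's) (ctrg: 's) (body: 'b)

datatype ('o, 'a, 'c) monobj =
  MonObj (car: 'o) (ten: 'a) (unt: 'a) (alph: 'c) (lam: 'c) (rho: 'c)

text \<open>The body of a lax monoidal 1-cell \<open>(F, \<phi>, \<phi>-bar)\<close>.\<close>

datatype ('a, 'c) lax_data = LaxData (und: 'a) (mlt: 'c) (ult: 'c)

type_synonym ('o, 'a, 'c) mon1 = "(('o, 'a, 'c) monobj, ('a, 'c) lax_data) cell"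
type_synonym ('o, 'a, 'c) mon2 = "(('o, 'a, 'c) mon1, 'c) cell"

text \<open>Formulas with variables are interpreted at generalised elements. For a 1-cell \<open>T\<close> out of a
  binary product, \<open>ap1 T a b\<close> is \<open>T(a, b)\<close> and \<open>ap2 T s t\<close> is the 2-cell \<open>T(s, t)\<close>. A 2-cell \<open>\<alpha>\<close>
  between 1-cells out of a threefold product (bracketed to the right) has the component
  \<open>at3 \<alpha> a b c\<close> at \<open>a\<close>, \<open>b\<close>, \<open>c\<close>.\<close>

context
  fixes A :: "('o, 'a, 'c) fp_two_cat" (structure)
begin

definition ap1 :: "'a \<Rightarrow> 'a \<Rightarrow> 'a \<Rightarrow> 'a" where
  "ap1 T a b = T \<cdot> \<langle>a, b\<rangle>"

definition ap2 :: "'a \<Rightarrow> 'c \<Rightarrow> 'c \<Rightarrow> 'c" where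
  "ap2 T s t = T \<rhd> \<llangle>s, t\<rrangle>"

definition at2 :: "'c \<Rightarrow> 'a \<Rightarrow> 'a \<Rightarrow> 'c" where
  "at2 \<phi> a b = \<phi> \<lhd> \<langle>a, b\<rangle>"

definition at3 :: "'c \<Rightarrow> 'a \<Rightarrow> 'a \<Rightarrow> 'a \<Rightarrow> 'c" where
  "at3 \<alpha> a b c = \<alpha> \<lhd> \<langle>a, \<langle>b, c\<rangle>\<rangle>"

text \<open>The generalised element at \<open>e\<close> of the 0-cell \<open>trg A i\<close> that is constant at the global element \<open>i\<close>.\<close>

definition const1 :: "'a \<Rightarrow> 'o \<Rightarrow> 'a" where
  "const1 i e = i \<cdot> bang A e"

text \<open>The variables (product projections) on \<open>x \<^bold>\<times> y\<close>, \<open>x \<^bold>\<times> y \<^bold>\<times> z\<close> and \<open>x \<^bold>\<times> y \<^bold>\<times> z \<^bold>\<times> w\<close>.\<close>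

definition vars2 :: "'o \<Rightarrow> 'o \<Rightarrow> 'a \<times> 'a" where
  "vars2 x y = (pr1 A x y, pr2 A x y)"

definition vars3 :: "'o \<Rightarrow> 'o \<Rightarrow> 'o \<Rightarrow> 'a \<times> 'a \<times> 'a" where
  "vars3 x y z = (pr1 A x (y \<^bold>\<times> z), pr1 A y z \<cdot> pr2 A x (y \<^bold>\<times> z), pr2 A y z \<cdot> pr2 A x (y \<^bold>\<times> z))"

definition vars4 :: "'o \<Rightarrow> 'o \<Rightarrow> 'o \<Rightarrow> 'o \<Rightarrow> 'a \<times> 'a \<times> 'a \<times> 'a" where
  "vars4 x y z w =
     (let q = pr2 A x (y \<^bold>\<times> z \<^bold>\<times> w); (b, c, d) = vars3 y z w
      in (pr1 A x (y \<^bold>\<times> z \<^bold>\<times> w), b \<cdot> q, c \<cdot> q, d \<cdot> q))"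

definition monoidal_object :: "('o, 'a, 'c) monobj \<Rightarrow> bool" where
  "monoidal_object M \<longleftrightarrow>
    (let C = car M; T = ten M; I = unt M; \<alpha> = alph M; l = lam M; \<rho> = rho M;
         o1 = ap1 T; o2 = ap2 T in
      C \<in> cells0 A \<and> T \<in> hom1 A (C \<^bold>\<times> C) C \<and> I \<in> hom1 A \<one> C \<and>
      (let (a, b, c) = vars3 C C C in \<alpha> \<in> hom2 A (o1 a (o1 b c)) (o1 (o1 a b) c)) \<and>
      l \<in> hom2 A (o1 (const1 I C) (id1 C)) (id1 C) \<and>
      \<rho> \<in> hom2 A (o1 (id1 C) (const1 I C)) (id1 C) \<and>
      invertible2 A \<alpha> \<and> invertible2 A l \<and> invertible2 A \<rho> \<and>
      (let (a, b, c, d) = vars4 C C C C in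
        at3 \<alpha> (o1 a b) c d \<bullet> at3 \<alpha> a b (o1 c d) =
        o2 (at3 \<alpha> a b c) (id2 d) \<bullet> at3 \<alpha> a (o1 b c) d \<bullet> o2 (id2 a) (at3 \<alpha> b c d)) \<and>
      (let (a, b) = vars2 C C in
        o2 (\<rho> \<lhd> a) (id2 b) \<bullet> at3 \<alpha> a (const1 I (C \<^bold>\<times> C)) b = o2 (id2 a) (l \<lhd> b)))"

definition lax_monoidal ::
  "('o, 'a, 'c) monobj \<Rightarrow> ('o, 'a, 'c) monobj \<Rightarrow> ('a, 'c) lax_data \<Rightarrow> bool" where
  "lax_monoidal M N L \<longleftrightarrow>
    (let C = car M; I = unt M; C' = car N; I' = unt N; F = und L; \<phi> = mlt L; \<phi>0 = ult L;
         o1 = ap1 (ten M); n1 = ap1 (ten N); n2 = ap2 (ten N) in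
      F \<in> hom1 A C C' \<and>
      (let (a, b) = vars2 C C in \<phi> \<in> hom2 A (n1 (F \<cdot> a) (F \<cdot> b)) (F \<cdot> o1 a b)) \<and>
      \<phi>0 \<in> hom2 A I' (F \<cdot> I) \<and>
      (let (a, b, c) = vars3 C C C in
        (F \<rhd> at3 (alph M) a b c) \<bullet> at2 \<phi> a (o1 b c) \<bullet> n2 (id2 (F \<cdot> a)) (at2 \<phi> b c) =
        at2 \<phi> (o1 a b) c \<bullet> n2 (at2 \<phi> a b) (id2 (F \<cdot> c)) \<bullet> at3 (alph N) (F \<cdot> a) (F \<cdot> b) (F \<cdot> c)) \<and>
      (F \<rhd> lam M) \<bullet> at2 \<phi> (const1 I C) (id1 C) \<bullet> n2 (\<phi>0 \<lhd> bang A C) (id2 F) = lam N \<lhd> F \<and>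
      (F \<rhd> rho M) \<bullet> at2 \<phi> (id1 C) (const1 I C) \<bullet> n2 (id2 F) (\<phi>0 \<lhd> bang A C) = rho N \<lhd> F)"

definition mon1_cell :: "('o, 'a, 'c) mon1 \<Rightarrow> bool" where
  "mon1_cell f \<longleftrightarrow>
     monoidal_object (csrc f) \<and> monoidal_object (ctrg f) \<and> lax_monoidal (csrc f) (ctrg f) (body f)"

definition strong_monoidal :: "('o, 'a, 'c) mon1 \<Rightarrow> bool" where
  "strong_monoidal f \<longleftrightarrow>
     mon1_cell f \<and> invertible2 A (mlt (body f)) \<and> invertible2 A (ult (body f))"

definition monoidal_transformation ::
  "('o, 'a, 'c) mon1 \<Rightarrow> ('o, 'a, 'c) mon1 \<Rightarrow> 'c \<Rightarrow> bool" where
  "monoidal_transformation f g \<tau> \<longleftrightarrow>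
    (let M = csrc f; N = ctrg f; F = body f; G = body g in
      \<tau> \<in> hom2 A (und F) (und G) \<and>
      (let (a, b) = vars2 (car M) (car M) in
        (\<tau> \<lhd> ap1 (ten M) a b) \<bullet> mlt F = mlt G \<bullet> ap2 (ten N) (\<tau> \<lhd> a) (\<tau> \<lhd> b)) \<and>
      (\<tau> \<lhd> unt M) \<bullet> ult F = ult G)"

definition mon2_cell :: "('o, 'a, 'c) mon2 \<Rightarrow> bool" where
  "mon2_cell t \<longleftrightarrow>
     mon1_cell (csrc t) \<and> mon1_cell (ctrg t) \<and>
     csrc (csrc t) = csrc (ctrg t) \<and> ctrg (csrc t) = ctrg (ctrg t) \<and>
     monoidal_transformation (csrc t) (ctrg t) (body t)"

definition mon_id1 :: "('o, 'a, 'c) monobj \<Rightarrow> ('o, 'a, 'c) mon1" where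
  "mon_id1 M = Cell M M (LaxData (id1 (car M)) (id2 (ten M)) (id2 (unt M)))"

definition mon_comp1 :: "('o, 'a, 'c) mon1 \<Rightarrow> ('o, 'a, 'c) mon1 \<Rightarrow> ('o, 'a, 'c) mon1" where
  "mon_comp1 g f =
    (let F = und (body f); G = und (body g); (a, b) = vars2 (car (csrc f)) (car (csrc f)) in
      Cell (csrc f) (ctrg g)
        (LaxData (G \<cdot> F)
          ((G \<rhd> mlt (body f)) \<bullet> at2 (mlt (body g)) (F \<cdot> a) (F \<cdot> b))
          ((G \<rhd> ult (body f)) \<bullet> ult (body g))))"

definition Mon_l :: "(('o, 'a, 'c) monobj, ('o, 'a, 'c) mon1, ('o, 'a, 'c) mon2) two_cat" where
  "Mon_l = \<lparr>
     cells0 = {M. monoidal_object M},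
     cells1 = {f. mon1_cell f},
     cells2 = {t. mon2_cell t},
     src = csrc, trg = ctrg, Dom = csrc, Cod = ctrg,
     idn1 = mon_id1,
     idn2 = (\<lambda>f. Cell f f (id2 (und (body f)))),
     comp1 = mon_comp1,
     vcomp = (\<lambda>t s. Cell (csrc s) (ctrg t) (body t \<bullet> body s)),
     hcomp = (\<lambda>t s. Cell (mon_comp1 (csrc t) (csrc s)) (mon_comp1 (ctrg t) (ctrg s))
                         (body t \<ast> body s)) \<rparr>"

end

section \<open>Lax slices\<close>

text \<open>A 1-cell from \<open>b\<close> to \<open>c\<close> has body \<open>(F, \<theta>)\<close> with \<open>\<theta>\<close> from \<open>c \<cdot> F\<close> to \<open>b\<close>.\<close>

type_synonym ('a, 'c) slice1 = "('a, 'a \<times> 'c) cell"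
type_synonym ('a, 'c) slice2 = "(('a, 'c) slice1, 'c) cell"

context
  fixes B :: "('o, 'a, 'c, 'm) two_cat_scheme" (structure)
begin

definition slice0_cell :: "'o \<Rightarrow> 'a \<Rightarrow> bool" where
  "slice0_cell m b \<longleftrightarrow> b \<in> cells1 B \<and> trg B b = m"

definition slice1_cell :: "'o \<Rightarrow> ('a, 'c) slice1 \<Rightarrow> bool" where
  "slice1_cell m f \<longleftrightarrow>
    (let b = csrc f; c = ctrg f; (F, \<theta>) = body f in
      slice0_cell m b \<and> slice0_cell m c \<and>
      F \<in> hom1 B (src B b) (src B c) \<and> \<theta> \<in> hom2 B (c \<cdot> F) b)"

definition slice2_cell :: "'o \<Rightarrow> ('a, 'c) slice2 \<Rightarrow> bool" where
  "slice2_cell m t \<longleftrightarrow>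
    (let f = csrc t; f' = ctrg t; (F, \<theta>) = body f; (F', \<theta>') = body f'; \<tau> = body t in
      slice1_cell m f \<and> slice1_cell m f' \<and> csrc f = csrc f' \<and> ctrg f = ctrg f' \<and>
      \<tau> \<in> hom2 B F F' \<and> \<theta>' \<bullet> (ctrg f \<rhd> \<tau>) = \<theta>)"

definition slice_comp1 :: "('a, 'c) slice1 \<Rightarrow> ('a, 'c) slice1 \<Rightarrow> ('a, 'c) slice1" where
  "slice_comp1 g f =
    (let (F, \<theta>) = body f; (G, \<kappa>) = body g in
      Cell (csrc f) (ctrg g) (G \<cdot> F, \<theta> \<bullet> (\<kappa> \<lhd> F)))"

definition lax_slice :: "'o \<Rightarrow> ('a, ('a, 'c) slice1, ('a, 'c) slice2) two_cat" where
  "lax_slice m = \<lparr>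
     cells0 = {b. slice0_cell m b},
     cells1 = {f. slice1_cell m f},
     cells2 = {t. slice2_cell m t},
     src = csrc, trg = ctrg, Dom = csrc, Cod = ctrg,
     idn1 = (\<lambda>b. Cell b b (id1 (src B b), id2 b)),
     idn2 = (\<lambda>f. Cell f f (id2 (fst (body f)))),
     comp1 = slice_comp1,
     vcomp = (\<lambda>t s. Cell (csrc s) (ctrg t) (body t \<bullet> body s)),
     hcomp = (\<lambda>t s. Cell (slice_comp1 (csrc t) (csrc s)) (slice_comp1 (ctrg t) (ctrg s))
                         (body t \<ast> body s)) \<rparr>"

definition slice_forget :: "('a, ('a, 'c) slice1, ('a, 'c) slice2, 'o, 'a, 'c) two_fun" where
  "slice_forget = \<lparr> map0 = src B, map1 = (\<lambda>f. fst (body f)), map2 = body \<rparr>"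

end

section \<open>Actions of monoidal objects\<close>

text \<open>An object \<open>ActObj M S \<psi> \<psi>0\<close> is a monoidal object \<open>M\<close> acting on \<open>X\<close> by \<open>S\<close>. The body of a 1-cell
  is a lax monoidal 1-cell together with \<open>\<xi>\<close>, that of a 2-cell is a monoidal transformation.\<close>

datatype ('o, 'a, 'c) actobj =
  ActObj (amon: "('o, 'a, 'c) monobj") (act: 'a) (amlt: 'c) (ault: 'c)

type_synonym ('o, 'a, 'c) act1 = "(('o, 'a, 'c) actobj, ('o, 'a, 'c) mon1 \<times> 'c) cell"
type_synonym ('o, 'a, 'c) act2 = "(('o, 'a, 'c) act1, ('o, 'a, 'c) mon2) cell"

context
  fixes A :: "('o, 'a, 'c) fp_two_cat" (structure)
    and X :: 'o
begin

definition action_object :: "('o, 'a, 'c) actobj \<Rightarrow> bool" where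
  "action_object P \<longleftrightarrow>
    (let M = amon P; C = car M; I = unt M; S = act P; \<psi> = amlt P; \<psi>0 = ault P;
         o1 = ap1 A (ten M); s1 = ap1 A S; s2 = ap2 A S in
      monoidal_object A M \<and>
      S \<in> hom1 A (C \<^bold>\<times> X) X \<and>
      (let (a, b, x) = vars3 A C C X in \<psi> \<in> hom2 A (s1 a (s1 b x)) (s1 (o1 a b) x)) \<and>
      \<psi>0 \<in> hom2 A (id1 X) (s1 (const1 A I X) (id1 X)) \<and>
      (let (a, b, c, x) = vars4 A C C C X in
        s2 (at3 A (alph M) a b c) (id2 x) \<bullet> at3 A \<psi> a (o1 b c) x \<bullet> s2 (id2 a) (at3 A \<psi> b c x) =
        at3 A \<psi> (o1 a b) c x \<bullet> at3 A \<psi> a b (s1 c x)) \<and>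
      (let (a, x) = vars2 A C X; i = const1 A I (C \<^bold>\<times> X) in
        s2 (lam M \<lhd> a) (id2 x) \<bullet> at3 A \<psi> i a x \<bullet> (\<psi>0 \<lhd> s1 a x) = id2 (s1 a x) \<and>
        s2 (rho M \<lhd> a) (id2 x) \<bullet> at3 A \<psi> a i x \<bullet> s2 (id2 a) (\<psi>0 \<lhd> x) = id2 (s1 a x)))"

definition strong_action :: "('o, 'a, 'c) actobj \<Rightarrow> bool" where
  "strong_action P \<longleftrightarrow> action_object P \<and> invertible2 A (amlt P) \<and> invertible2 A (ault P)"

definition act1_cell :: "('o, 'a, 'c) act1 \<Rightarrow> bool" where
  "act1_cell f \<longleftrightarrow>
    (let P = csrc f; P' = ctrg f; (L, \<xi>) = body f; M = amon P; C = car M; I = unt M;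
         F = und (body L); \<phi> = mlt (body L); \<phi>0 = ult (body L);
         o1 = ap1 A (ten M); s1 = ap1 A (act P); t1 = ap1 A (act P'); t2 = ap2 A (act P') in
      action_object P \<and> action_object P' \<and>
      mon1_cell A L \<and> csrc L = amon P \<and> ctrg L = amon P' \<and>
      (let (a, x) = vars2 A C X in \<xi> \<in> hom2 A (t1 (F \<cdot> a) x) (s1 a x)) \<and>
      (let (a, b, x) = vars3 A C C X in
        at2 A \<xi> (o1 a b) x \<bullet> t2 (at2 A \<phi> a b) (id2 x) \<bullet> at3 A (amlt P') (F \<cdot> a) (F \<cdot> b) x =
        at3 A (amlt P) a b x \<bullet> at2 A \<xi> a (s1 b x) \<bullet> t2 (id2 (F \<cdot> a)) (at2 A \<xi> b x)) \<and>
      at2 A \<xi> (const1 A I X) (id1 X) \<bullet> t2 (\<phi>0 \<lhd> bang A X) (id2 (id1 X)) \<bullet> ault P' = ault P)"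

definition act2_cell :: "('o, 'a, 'c) act2 \<Rightarrow> bool" where
  "act2_cell t \<longleftrightarrow>
    (let f = csrc t; f' = ctrg t; (L, \<xi>) = body f; (L', \<xi>') = body f'; \<tau> = body t;
         (a, x) = vars2 A (car (amon (csrc f))) X in
      act1_cell f \<and> act1_cell f' \<and> csrc f = csrc f' \<and> ctrg f = ctrg f' \<and>
      mon2_cell A \<tau> \<and> csrc \<tau> = L \<and> ctrg \<tau> = L' \<and>
      \<xi>' \<bullet> ap2 A (act (ctrg f)) (body \<tau> \<lhd> a) (id2 x) = \<xi>)"

text \<open>The composite of \<open>\<xi>\<close> and \<open>\<zeta>\<close> at \<open>a\<close>, \<open>x\<close> is \<open>\<zeta>\<close> at \<open>F(a)\<close>, \<open>x\<close> followed by \<open>\<xi>\<close> at \<open>a\<close>, \<open>x\<close>.\<close>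

definition act_comp1 :: "('o, 'a, 'c) act1 \<Rightarrow> ('o, 'a, 'c) act1 \<Rightarrow> ('o, 'a, 'c) act1" where
  "act_comp1 g f =
    (let (L, \<xi>) = body f; (K, \<zeta>) = body g; (a, x) = vars2 A (car (amon (csrc f))) X in
      Cell (csrc f) (ctrg g) (mon_comp1 A K L, \<xi> \<bullet> at2 A \<zeta> (und (body L) \<cdot> a) x))"

definition ActMon_l :: "(('o, 'a, 'c) actobj, ('o, 'a, 'c) act1, ('o, 'a, 'c) act2) two_cat" where
  "ActMon_l = \<lparr>
     cells0 = {P. action_object P},
     cells1 = {f. act1_cell f},
     cells2 = {t. act2_cell t},
     src = csrc, trg = ctrg, Dom = csrc, Cod = ctrg,
     idn1 = (\<lambda>P. Cell P P (mon_id1 A (amon P), id2 (act P))),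
     idn2 = (\<lambda>f. Cell f f (id2\<^bsub>Mon_l A\<^esub> (fst (body f)))),
     comp1 = act_comp1,
     vcomp = (\<lambda>t s. Cell (csrc s) (ctrg t) (body t \<bullet>\<^bsub>Mon_l A\<^esub> body s)),
     hcomp = (\<lambda>t s. Cell (act_comp1 (csrc t) (csrc s)) (act_comp1 (ctrg t) (ctrg s))
                         (body t \<ast>\<^bsub>Mon_l A\<^esub> body s)) \<rparr>"

definition act_forget ::
  "(('o, 'a, 'c) actobj, ('o, 'a, 'c) act1, ('o, 'a, 'c) act2,
    ('o, 'a, 'c) monobj, ('o, 'a, 'c) mon1, ('o, 'a, 'c) mon2) two_fun" where
  "act_forget = \<lparr> map0 = amon, map1 = (\<lambda>f. fst (body f)), map2 = body \<rparr>"

end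

section \<open>The monoidal object of endomorphisms and the comparison 2-functor\<close>

context
  fixes A :: "('o, 'a, 'c) fp_two_cat" (structure)
    and X XX :: 'o
    and cur1 :: "'o \<Rightarrow> 'a \<Rightarrow> 'a"
begin

text \<open>\<open>app g x\<close> is the evaluation \<open>ev(g, x)\<close> of generalised elements \<open>g\<close> of \<open>XX\<close> and \<open>x\<close> of \<open>X\<close>,
  and \<open>app2\<close> is its counterpart for 2-cells.\<close>

abbreviation app :: "'a \<Rightarrow> 'a \<Rightarrow> 'a" where
  "app \<equiv> ap1 A (evaluation A X X XX cur1)"

abbreviation app2 :: "'c \<Rightarrow> 'c \<Rightarrow> 'c" where
  "app2 \<equiv> ap2 A (evaluation A X X XX cur1)"

text \<open>The composition 1-cell is adjoint to \<open>(g, h, x) \<mapsto> g(h(x))\<close>. Its source \<open>(XX \<^bold>\<times> XX) \<^bold>\<times> X\<close> is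
  bracketed to the left here.\<close>

definition endo_tensor :: 'a where
  "endo_tensor =
    (let q = pr1 A (XX \<^bold>\<times> XX) X; x = pr2 A (XX \<^bold>\<times> XX) X in
      cur1 (XX \<^bold>\<times> XX) (app (pr1 A XX XX \<cdot> q) (app (pr2 A XX XX \<cdot> q) x)))"

definition endo_unit :: 'a where
  "endo_unit = cur1 \<one> (pr2 A \<one> X)"

definition endo_mon :: "('o, 'a, 'c) monobj" where
  "endo_mon =
    MonObj XX endo_tensor endo_unit
      (let (a, b, c) = vars3 A XX XX XX; m = ap1 A endo_tensor in id2 (m a (m b c)))
      (id2 (id1 XX)) (id2 (id1 XX))"

text \<open>The exponential transposition: a representation \<open>F : C \<rightarrow> XX\<close> is sent to the action
  \<open>a \<star> x = F(a)(x)\<close>, and a 2-cell \<open>\<theta> : c \<cdot> F \<rightarrow> b\<close> to \<open>\<xi>\<close> with components \<open>\<theta>(a)(x)\<close>.\<close>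

definition transpose0 :: "('o, 'a, 'c) mon1 \<Rightarrow> ('o, 'a, 'c) actobj" where
  "transpose0 r =
    (let M = csrc r; C = car M; F = und (body r) in
      ActObj M
        (let (a, x) = vars2 A C X in app (F \<cdot> a) x)
        (let (a, b, x) = vars3 A C C X in app2 (at2 A (mlt (body r)) a b) (id2 x))
        (app2 (ult (body r) \<lhd> bang A X) (id2 (id1 X))))"

definition transpose1 ::
  "(('o, 'a, 'c) mon1, ('o, 'a, 'c) mon2) slice1 \<Rightarrow> ('o, 'a, 'c) act1" where
  "transpose1 f =
    (let (L, \<theta>) = body f; (a, x) = vars2 A (car (csrc L)) X in
      Cell (transpose0 (csrc f)) (transpose0 (ctrg f)) (L, app2 (body \<theta> \<lhd> a) (id2 x)))"

definition transpose2 ::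
  "(('o, 'a, 'c) mon1, ('o, 'a, 'c) mon2) slice2 \<Rightarrow> ('o, 'a, 'c) act2" where
  "transpose2 t = Cell (transpose1 (csrc t)) (transpose1 (ctrg t)) (body t)"

definition transposition ::
  "(('o, 'a, 'c) mon1, (('o, 'a, 'c) mon1, ('o, 'a, 'c) mon2) slice1,
    (('o, 'a, 'c) mon1, ('o, 'a, 'c) mon2) slice2,
    ('o, 'a, 'c) actobj, ('o, 'a, 'c) act1, ('o, 'a, 'c) act2) two_fun" where
  "transposition = \<lparr> map0 = transpose0, map1 = transpose1, map2 = transpose2 \<rparr>"

end

end

theory Submission
  imports Defs
begin

text \<open>A 1-cell \<open>F : C \<rightarrow> X\<^sup>X\<close> is the same thing as a 1-cell \<open>a \<star> x = F(a)(x)\<close> from \<open>C \<^bold>\<times> X\<close> to \<open>X\<close>, and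
  the same holds for 2-cells. The tensor of \<open>X\<^sup>X\<close> is composition, \<open>(g \<otimes> h)(x) = g(h(x))\<close>, and its
  coherence 2-cells are identities. Hence a multiplication \<open>F(a) \<otimes> F(b) \<rightarrow> F(a \<otimes> b)\<close>, evaluated at
  \<open>x\<close>, has exactly the type of \<open>\<psi> : a \<star> (b \<star> x) \<rightarrow> (a \<otimes> b) \<star> x\<close>, and each axiom of a lax monoidal
  1-cell into \<open>X\<^sup>X\<close>, evaluated at \<open>x\<close>, is term by term an axiom of an action
  (\<open>lax_assoc_iff_act_assoc\<close> and its two companions for the units). Since evaluation at the generic
  \<open>x\<close> is injective (\<open>app_inject\<close>, \<open>app2_inject\<close>) and every 2-cell of the right type is an evaluation
  (\<open>obtain_curried2\<close>), transposition is bijective on 0-cells. A 2-cell \<open>\<theta> : c F \<rightarrow> b\<close> of the slice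
  corresponds in the same way to \<open>\<xi>\<close>: monoidality of \<open>\<theta>\<close>, evaluated at \<open>x\<close>, is the compatibility of
  \<open>\<xi>\<close> with the multiplications, because \<open>\<theta>\<^sub>a \<otimes> \<theta>\<^sub>b\<close> evaluates to the component of \<open>\<xi>\<close> at
  \<open>a\<close> and \<open>b \<star> x\<close> after the action of \<open>F(a)\<close> on the component at \<open>b\<close> and \<open>x\<close> (\<open>app_rhs\<close>, \<open>act1_cell_transposed1_iff\<close>).

  All equations between 2-cells are proved at generalised elements: an equation stated for product
  projections implies the one for arbitrary \<open>a\<close>, \<open>b\<close>, \<open>c\<close> with a common source by whiskering with
  the tuple \<open>\<langle>a, \<langle>b, c\<rangle>\<rangle>\<close>, and is in turn an instance of it. At such elements a tensor is a functor of two
  variables on a hom-category, and a structure 2-cell is a natural family.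

  Lax monoidal 1-cells compose, and monoidal transformations compose horizontally, by pasting their
  axioms with naturality squares; with this \<open>Mon_l\<close> is a 2-category, and so is the lax slice of any
  2-category. The 2-category axioms for actions are then obtained by transport: a map that is
  bijective on cells of each dimension and preserves all operations carries the axioms along
  (\<open>two_category_isomorphismI\<close>).\<close>

section \<open>Calculus of 2-cells\<close>

text \<open>The 0-cells at which a 2-cell begins and ends. They have names of their own because
  these ends alone decide which whiskerings of \<open>t\<close> are defined, while the 1-cell \<open>Dom A t\<close> may be a
  long composite.\<close>

definition src2 :: "('o, 'a, 'c, 'm) two_cat_scheme \<Rightarrow> 'c \<Rightarrow> 'o" where
  "src2 A t = src A (Dom A t)"

definition trg2 :: "('o, 'a, 'c, 'm) two_cat_scheme \<Rightarrow> 'c \<Rightarrow> 'o" where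
  "trg2 A t = trg A (Dom A t)"

context two_category
begin

text \<open>The axioms are restated so that sources and targets are computed from the cells and do not
  occur as separate parameters. As rewrite rules they push whiskerings inwards, past
  vertical composites, pairs and other whiskerings.\<close>

lemma hom1_iff: "f \<in> hom1 A x y \<longleftrightarrow> f \<in> cells1 A \<and> src A f = x \<and> trg A f = y"
  by (simp add: hom1_def)

lemma hom2_iff: "t \<in> hom2 A f g \<longleftrightarrow> t \<in> cells2 A \<and> Dom A t = f \<and> Cod A t = g"
  by (simp add: hom2_def)

lemma homcat_iff:
  "t \<in> homcat A x y \<longleftrightarrow> t \<in> cells2 A \<and> src2 A t = x \<and> trg2 A t = y"
  using Dom_cell Cod_cell src_Dom trg_Dom by (auto simp: homcat_def hom1_def src2_def trg2_def)

lemma src_Dom_Cod [simp]: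
  "src A (Dom A t) = src2 A t" "t \<in> cells2 A \<Longrightarrow> src A (Cod A t) = src2 A t"
  by (simp_all add: src_Dom src2_def)

lemma trg_Dom_Cod [simp]:
  "trg A (Dom A t) = trg2 A t" "t \<in> cells2 A \<Longrightarrow> trg A (Cod A t) = trg2 A t"
  by (simp_all add: trg_Dom trg2_def)

lemma src2_cell [simp]:
  "t \<in> cells2 A \<Longrightarrow> src2 A t \<in> cells0 A" "t \<in> cells2 A \<Longrightarrow> trg2 A t \<in> cells0 A"
  by (simp_all add: src2_def trg2_def src_cell trg_cell Dom_cell del: src_Dom_Cod trg_Dom_Cod)

declare src_cell [simp] trg_cell [simp] Dom_cell [simp] Cod_cell [simp]

lemma id1_cell [simp]:
  assumes "x \<in> cells0 A"
  shows "id1 x \<in> cells1 A" "src A (id1 x) = x" "trg A (id1 x) = x"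
  using id1_hom[OF assms] by (auto simp: hom1_iff)

lemma comp1_cell [simp]:
  assumes "f \<in> cells1 A" "g \<in> cells1 A" "src A g = trg A f"
  shows "g \<cdot> f \<in> cells1 A" "src A (g \<cdot> f) = src A f" "trg A (g \<cdot> f) = trg A g"
  using comp1_hom[of f "src A f" "trg A f" g "trg A g"] assms by (auto simp: hom1_iff)

lemma comp1_right_id [simp]: "f \<in> cells1 A \<Longrightarrow> x = src A f \<Longrightarrow> f \<cdot> id1 x = f"
  by (simp add: comp1_id1_right hom1_iff)

lemma comp1_left_id [simp]: "f \<in> cells1 A \<Longrightarrow> x = trg A f \<Longrightarrow> id1 x \<cdot> f = f"
  by (simp add: comp1_id1_left hom1_iff)

lemma comp1_assoc' [simp]:
  "\<lbrakk>f \<in> cells1 A; g \<in> cells1 A; h \<in> cells1 A; src A g = trg A f; src A h = trg A g\<rbrakk>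
   \<Longrightarrow> (h \<cdot> g) \<cdot> f = h \<cdot> g \<cdot> f"
  by (rule comp1_assoc) (auto simp: hom1_iff)

lemma id2_cell [simp]:
  assumes "f \<in> cells1 A"
  shows "id2 f \<in> cells2 A" "Dom A (id2 f) = f" "Cod A (id2 f) = f"
  using id2_hom[OF assms] by (auto simp: hom2_iff)

lemma src2_id2 [simp]:
  assumes "f \<in> cells1 A"
  shows "src2 A (id2 f) = src A f" "trg2 A (id2 f) = trg A f"
  unfolding src2_def trg2_def using assms by (simp_all del: src_Dom_Cod(1) trg_Dom_Cod(1))

lemma vcomp_cell [simp]:
  assumes "s \<in> cells2 A" "t \<in> cells2 A" "Dom A t = Cod A s"
  shows "t \<bullet> s \<in> cells2 A" "Dom A (t \<bullet> s) = Dom A s" "Cod A (t \<bullet> s) = Cod A t"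
  using vcomp_hom[of s "Dom A s" "Cod A s" t "Cod A t"] assms by (auto simp: hom2_iff)

lemma src2_vcomp [simp]:
  assumes "s \<in> cells2 A" "t \<in> cells2 A" "Dom A t = Cod A s"
  shows "src2 A (t \<bullet> s) = src2 A s" "trg2 A (t \<bullet> s) = trg2 A t"
proof -
  show "src2 A (t \<bullet> s) = src2 A s"
    unfolding src2_def using assms by (simp del: src_Dom_Cod(1))
  have "trg2 A (t \<bullet> s) = trg A (Cod A (t \<bullet> s))" using assms by (subst trg_Dom_Cod(2)) auto
  also have "\<dots> = trg2 A t" using assms by simp
  finally show "trg2 A (t \<bullet> s) = trg2 A t" .
qed

lemma vcomp_right_id [simp]: "t \<in> cells2 A \<Longrightarrow> f = Dom A t \<Longrightarrow> t \<bullet> id2 f = t"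
  by (simp add: vcomp_id2_right hom2_iff)

lemma vcomp_left_id [simp]: "t \<in> cells2 A \<Longrightarrow> f = Cod A t \<Longrightarrow> id2 f \<bullet> t = t"
  by (simp add: vcomp_id2_left hom2_iff)

lemma vcomp_assoc' [simp]:
  "\<lbrakk>r \<in> cells2 A; s \<in> cells2 A; t \<in> cells2 A; Dom A s = Cod A r; Dom A t = Cod A s\<rbrakk>
   \<Longrightarrow> (t \<bullet> s) \<bullet> r = t \<bullet> s \<bullet> r"
  by (rule vcomp_assoc) (auto simp: hom2_iff)

lemma src2_composable:
  assumes "s \<in> cells2 A" "t \<in> cells2 A" "Dom A t = Cod A s"
  shows "src2 A t = src2 A s" "trg2 A t = trg2 A s"
  using assms src_Dom_Cod trg_Dom_Cod by metis+

lemma hcomp_cell [simp]: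
  assumes "s \<in> cells2 A" "t \<in> cells2 A" "src2 A t = trg2 A s"
  shows "t \<ast> s \<in> cells2 A" "Dom A (t \<ast> s) = Dom A t \<cdot> Dom A s"
    "Cod A (t \<ast> s) = Cod A t \<cdot> Cod A s"
  using hcomp_hom[of s "Dom A s" "Cod A s" t "Dom A t" "Cod A t" "src2 A s"
      "trg2 A s" "trg2 A t"] assms
  by (auto simp: hom1_iff hom2_iff)

lemma src2_hcomp [simp]:
  assumes "s \<in> cells2 A" "t \<in> cells2 A" "src2 A t = trg2 A s"
  shows "src2 A (t \<ast> s) = src2 A s" "trg2 A (t \<ast> s) = trg2 A t"
  unfolding src2_def[of _ "t \<ast> s"] trg2_def[of _ "t \<ast> s"] using assms by simp_all

lemma hcomp_assoc' :
  "\<lbrakk>r \<in> cells2 A; s \<in> cells2 A; t \<in> cells2 A; src2 A s = trg2 A r;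
    src2 A t = trg2 A s\<rbrakk> \<Longrightarrow> (t \<ast> s) \<ast> r = t \<ast> s \<ast> r"
  by (rule hcomp_assoc) (auto simp: homcat_iff)

lemma interchange':
  "\<lbrakk>s \<in> cells2 A; s' \<in> cells2 A; t \<in> cells2 A; t' \<in> cells2 A; Dom A s' = Cod A s;
    Dom A t' = Cod A t; src2 A t = trg2 A s\<rbrakk>
   \<Longrightarrow> (t' \<bullet> t) \<ast> (s' \<bullet> s) = (t' \<ast> s') \<bullet> (t \<ast> s)"
  by (rule interchange) (auto simp: hom1_iff hom2_iff)

lemma whisker_right_cell [simp]:
  assumes "t \<in> cells2 A" "f \<in> cells1 A" "src2 A t = trg A f"
  shows "t \<lhd> f \<in> cells2 A" "Dom A (t \<lhd> f) = Dom A t \<cdot> f" "Cod A (t \<lhd> f) = Cod A t \<cdot> f"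
  using assms by (auto simp: whisker_right_def)

lemma src2_whisker_right [simp]:
  assumes "t \<in> cells2 A" "f \<in> cells1 A" "src2 A t = trg A f"
  shows "src2 A (t \<lhd> f) = src A f" "trg2 A (t \<lhd> f) = trg2 A t"
  unfolding src2_def[of _ "t \<lhd> f"] trg2_def[of _ "t \<lhd> f"] using assms by simp_all

lemma whisker_left_cell [simp]:
  assumes "s \<in> cells2 A" "g \<in> cells1 A" "src A g = trg2 A s"
  shows "g \<rhd> s \<in> cells2 A" "Dom A (g \<rhd> s) = g \<cdot> Dom A s" "Cod A (g \<rhd> s) = g \<cdot> Cod A s"
  using assms by (auto simp: whisker_left_def)

lemma src2_whisker_left [simp]:
  assumes "s \<in> cells2 A" "g \<in> cells1 A" "src A g = trg2 A s"
  shows "src2 A (g \<rhd> s) = src2 A s" "trg2 A (g \<rhd> s) = trg A g"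
  unfolding src2_def[of _ "g \<rhd> s"] trg2_def[of _ "g \<rhd> s"] using assms by simp_all

lemma hcomp_id2':
  "\<lbrakk>f \<in> cells1 A; g \<in> cells1 A; src A g = trg A f\<rbrakk> \<Longrightarrow> id2 g \<ast> id2 f = id2 (g \<cdot> f)"
  by (rule hcomp_id2) (auto simp: hom1_iff)

lemma whisker_right_id1 [simp]: "t \<in> cells2 A \<Longrightarrow> x = src2 A t \<Longrightarrow> t \<lhd> id1 x = t"
  by (simp add: whisker_right_def hcomp_id_right homcat_iff)

lemma whisker_left_id1 [simp]: "t \<in> cells2 A \<Longrightarrow> x = trg2 A t \<Longrightarrow> id1 x \<rhd> t = t"
  by (simp add: whisker_left_def hcomp_id_left homcat_iff)

lemma whisker_right_id2 [simp]:
  "\<lbrakk>f \<in> cells1 A; g \<in> cells1 A; src A g = trg A f\<rbrakk> \<Longrightarrow> id2 g \<lhd> f = id2 (g \<cdot> f)"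
  by (simp add: whisker_right_def hcomp_id2')

lemma whisker_left_id2 [simp]:
  "\<lbrakk>f \<in> cells1 A; g \<in> cells1 A; src A g = trg A f\<rbrakk> \<Longrightarrow> g \<rhd> id2 f = id2 (g \<cdot> f)"
  by (simp add: whisker_left_def hcomp_id2')

lemma whisker_right_comp [simp]:
  "\<lbrakk>t \<in> cells2 A; f \<in> cells1 A; g \<in> cells1 A; src2 A t = trg A f; src A f = trg A g\<rbrakk>
   \<Longrightarrow> t \<lhd> f \<lhd> g = t \<lhd> (f \<cdot> g)"
  by (simp add: whisker_right_def hcomp_assoc' hcomp_id2')

lemma whisker_left_comp [simp]:
  "\<lbrakk>s \<in> cells2 A; f \<in> cells1 A; g \<in> cells1 A; src A f = trg2 A s; src A g = trg A f\<rbrakk>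
   \<Longrightarrow> (g \<cdot> f) \<rhd> s = g \<rhd> f \<rhd> s"
  by (simp add: whisker_left_def hcomp_assoc' flip: hcomp_id2')

lemma whisker_left_right [simp]:
  "\<lbrakk>s \<in> cells2 A; f \<in> cells1 A; g \<in> cells1 A; src2 A s = trg A f; src A g = trg2 A s\<rbrakk>
   \<Longrightarrow> (g \<rhd> s) \<lhd> f = g \<rhd> (s \<lhd> f)"
  by (simp add: whisker_right_def whisker_left_def hcomp_assoc')

lemma whisker_right_vcomp [simp]:
  assumes "s \<in> cells2 A" "t \<in> cells2 A" "f \<in> cells1 A" "Dom A t = Cod A s"
    "src2 A s = trg A f"
  shows "(t \<bullet> s) \<lhd> f = (t \<lhd> f) \<bullet> (s \<lhd> f)"
  using interchange'[of "id2 f" "id2 f" s t] assms src2_composable[OF assms(1,2,4)] by (simp add: whisker_right_def)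

lemma whisker_left_vcomp [simp]:
  assumes "s \<in> cells2 A" "t \<in> cells2 A" "g \<in> cells1 A" "Dom A t = Cod A s"
    "src A g = trg2 A s"
  shows "g \<rhd> (t \<bullet> s) = (g \<rhd> t) \<bullet> (g \<rhd> s)"
  using interchange'[of s t "id2 g" "id2 g"] assms src2_composable[OF assms(1,2,4)] by (simp add: whisker_left_def)

lemma whisker_right_vcomp3:
  assumes "r \<in> cells2 A" "s \<in> cells2 A" "t \<in> cells2 A" "Dom A t = Cod A s" "Dom A s = Cod A r"
    "f \<in> cells1 A" "src2 A r = trg A f"
  shows "(t \<bullet> s \<bullet> r) \<lhd> f = (t \<lhd> f) \<bullet> (s \<lhd> f) \<bullet> (r \<lhd> f)"
  using assms src2_composable[of s t] src2_composable[of r s] by simp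

lemma whisker_left_vcomp3:
  assumes "r \<in> cells2 A" "s \<in> cells2 A" "t \<in> cells2 A" "Dom A t = Cod A s" "Dom A s = Cod A r"
    "f \<in> cells1 A" "src A f = trg2 A r"
  shows "f \<rhd> (t \<bullet> s \<bullet> r) = (f \<rhd> t) \<bullet> (f \<rhd> s) \<bullet> (f \<rhd> r)"
  using assms src2_composable[of s t] src2_composable[of r s] by simp

lemma whisker_left_eq3:
  assumes "t \<bullet> s \<bullet> r = t' \<bullet> s' \<bullet> r'"
    and "r \<in> cells2 A" "s \<in> cells2 A" "t \<in> cells2 A" "Dom A t = Cod A s" "Dom A s = Cod A r"
    and "r' \<in> cells2 A" "s' \<in> cells2 A" "t' \<in> cells2 A" "Dom A t' = Cod A s'" "Dom A s' = Cod A r'"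
    and "f \<in> cells1 A" "src A f = trg2 A r" "src A f = trg2 A r'"
  shows "(f \<rhd> t) \<bullet> (f \<rhd> s) \<bullet> (f \<rhd> r) = (f \<rhd> t') \<bullet> (f \<rhd> s') \<bullet> (f \<rhd> r')"
proof -
  have "(f \<rhd> t) \<bullet> (f \<rhd> s) \<bullet> (f \<rhd> r) = f \<rhd> (t \<bullet> s \<bullet> r)"
    using assms(2-) src2_composable[of s t] src2_composable[of r s] by simp
  also have "\<dots> = f \<rhd> (t' \<bullet> s' \<bullet> r')" unfolding assms(1) ..
  also have "\<dots> = (f \<rhd> t') \<bullet> (f \<rhd> s') \<bullet> (f \<rhd> r')"
    using assms(2-) src2_composable[of s' t'] src2_composable[of r' s'] by simp
  finally show ?thesis .
qed

lemma hcomp_whisker: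
  assumes "s \<in> cells2 A" "t \<in> cells2 A" "src2 A t = trg2 A s"
  shows "t \<ast> s = (t \<lhd> Cod A s) \<bullet> (Dom A t \<rhd> s)"
  using interchange'[of s "id2 (Cod A s)" "id2 (Dom A t)" t] assms
  by (simp add: whisker_right_def whisker_left_def)

lemma hcomp_whisker':
  assumes "s \<in> cells2 A" "t \<in> cells2 A" "src2 A t = trg2 A s"
  shows "t \<ast> s = (Cod A t \<rhd> s) \<bullet> (t \<lhd> Dom A s)"
  using interchange'[of "id2 (Dom A s)" s t "id2 (Cod A t)"] assms
  by (simp add: whisker_right_def whisker_left_def)

text \<open>Both sides are the horizontal composite \<open>t \<ast> s\<close>. Read with \<open>t \<lhd> f\<close> as the component of \<open>t\<close> at
  the generalised element \<open>f\<close>, this is the naturality square of \<open>t\<close> at \<open>s\<close>.\<close>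

lemma whisker_exchange:
  assumes "s \<in> cells2 A" "t \<in> cells2 A" "src2 A t = trg2 A s"
  shows "(t \<lhd> Cod A s) \<bullet> (Dom A t \<rhd> s) = (Cod A t \<rhd> s) \<bullet> (t \<lhd> Dom A s)"
  using hcomp_whisker[OF assms] hcomp_whisker'[OF assms] by simp

lemma invertible2E:
  assumes "invertible2 A t"
  obtains s where "t \<in> cells2 A" "s \<in> cells2 A" "Dom A s = Cod A t" "Cod A s = Dom A t"
    "src2 A s = src2 A t" "trg2 A s = trg2 A t" "s \<bullet> t = id2 (Dom A t)" "t \<bullet> s = id2 (Cod A t)"
proof -
  from assms obtain s where "t \<in> cells2 A" "s \<in> cells2 A" "Dom A s = Cod A t" "Cod A s = Dom A t"
    "s \<bullet> t = id2 (Dom A t)" "t \<bullet> s = id2 (Cod A t)"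
    by (auto simp: invertible2_def hom2_iff)
  then show ?thesis
    using that[of s] src2_composable[of t s] by simp
qed

lemma invertible2I:
  assumes "t \<in> cells2 A" "s \<in> cells2 A" "Dom A s = Cod A t" "Cod A s = Dom A t"
    "s \<bullet> t = id2 (Dom A t)" "t \<bullet> s = id2 (Cod A t)"
  shows "invertible2 A t"
  using assms by (auto simp: invertible2_def hom2_iff)

lemma invertible2_whisker_right:
  assumes "invertible2 A t" "f \<in> cells1 A" "src2 A t = trg A f"
  shows "invertible2 A (t \<lhd> f)"
proof -
  from assms(1) obtain s where s: "t \<in> cells2 A" "s \<in> cells2 A" "Dom A s = Cod A t"
    "Cod A s = Dom A t" "src2 A s = src2 A t" "trg2 A s = trg2 A t"
    and inv: "s \<bullet> t = id2 (Dom A t)" "t \<bullet> s = id2 (Cod A t)"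
    by (rule invertible2E)
  have "(s \<lhd> f) \<bullet> (t \<lhd> f) = id2 (Dom A t) \<lhd> f" "(t \<lhd> f) \<bullet> (s \<lhd> f) = id2 (Cod A t) \<lhd> f"
    using s assms(2,3) by (simp_all flip: inv)
  then show ?thesis
    by (intro invertible2I[of _ "s \<lhd> f"]) (use s assms(2,3) in simp_all)
qed

lemma invertible2_whisker_left:
  assumes "invertible2 A t" "g \<in> cells1 A" "src A g = trg2 A t"
  shows "invertible2 A (g \<rhd> t)"
proof -
  from assms(1) obtain s where s: "t \<in> cells2 A" "s \<in> cells2 A" "Dom A s = Cod A t"
    "Cod A s = Dom A t" "src2 A s = src2 A t" "trg2 A s = trg2 A t"
    and inv: "s \<bullet> t = id2 (Dom A t)" "t \<bullet> s = id2 (Cod A t)"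
    by (rule invertible2E)
  have "(g \<rhd> s) \<bullet> (g \<rhd> t) = g \<rhd> id2 (Dom A t)" "(g \<rhd> t) \<bullet> (g \<rhd> s) = g \<rhd> id2 (Cod A t)"
    using s assms(2,3) by (simp_all flip: inv)
  then show ?thesis
    by (intro invertible2I[of _ "g \<rhd> s"]) (use s assms(2,3) in simp_all)
qed

lemma invertible2_id2: "f \<in> cells1 A \<Longrightarrow> invertible2 A (id2 f)"
  unfolding invertible2_def by (auto simp: hom2_iff intro!: bexI[of _ "id2 f"])

end

text \<open>Here composability is expressed by equations between sources and targets, which is the form in
  which it is available for cells that carry their source and target.\<close>

lemma two_categoryI:
  fixes A :: "('o, 'a, 'c, 'm) two_cat_scheme" (structure)
  assumes st: "\<And>f. f \<in> cells1 A \<Longrightarrow> src A f \<in> cells0 A \<and> trg A f \<in> cells0 A"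
    and DC: "\<And>t. t \<in> cells2 A \<Longrightarrow> Dom A t \<in> cells1 A \<and> Cod A t \<in> cells1 A \<and>
      src A (Cod A t) = src A (Dom A t) \<and> trg A (Cod A t) = trg A (Dom A t)"
    and id1: "\<And>x. x \<in> cells0 A \<Longrightarrow> id1 x \<in> cells1 A \<and> src A (id1 x) = x \<and> trg A (id1 x) = x"
    and comp1: "\<And>f g. \<lbrakk>f \<in> cells1 A; g \<in> cells1 A; src A g = trg A f\<rbrakk>
      \<Longrightarrow> g \<cdot> f \<in> cells1 A \<and> src A (g \<cdot> f) = src A f \<and> trg A (g \<cdot> f) = trg A g"
    and unit1: "\<And>f. f \<in> cells1 A \<Longrightarrow> f \<cdot> id1 (src A f) = f \<and> id1 (trg A f) \<cdot> f = f"
    and assoc1: "\<And>f g h. \<lbrakk>f \<in> cells1 A; g \<in> cells1 A; h \<in> cells1 A; src A g = trg A f; src A h = trg A g\<rbrakk>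
      \<Longrightarrow> (h \<cdot> g) \<cdot> f = h \<cdot> (g \<cdot> f)"
    and id2: "\<And>f. f \<in> cells1 A \<Longrightarrow> id2 f \<in> cells2 A \<and> Dom A (id2 f) = f \<and> Cod A (id2 f) = f"
    and vcomp: "\<And>s t. \<lbrakk>s \<in> cells2 A; t \<in> cells2 A; Dom A t = Cod A s\<rbrakk>
      \<Longrightarrow> t \<bullet> s \<in> cells2 A \<and> Dom A (t \<bullet> s) = Dom A s \<and> Cod A (t \<bullet> s) = Cod A t"
    and unit2: "\<And>t. t \<in> cells2 A \<Longrightarrow> t \<bullet> id2 (Dom A t) = t \<and> id2 (Cod A t) \<bullet> t = t"
    and assoc2: "\<And>r s t. \<lbrakk>r \<in> cells2 A; s \<in> cells2 A; t \<in> cells2 A; Dom A s = Cod A r; Dom A t = Cod A s\<rbrakk>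
      \<Longrightarrow> (t \<bullet> s) \<bullet> r = t \<bullet> (s \<bullet> r)"
    and hcomp: "\<And>s t. \<lbrakk>s \<in> cells2 A; t \<in> cells2 A; src A (Dom A t) = trg A (Dom A s)\<rbrakk>
      \<Longrightarrow> t \<ast> s \<in> cells2 A \<and> Dom A (t \<ast> s) = Dom A t \<cdot> Dom A s \<and> Cod A (t \<ast> s) = Cod A t \<cdot> Cod A s"
    and unith: "\<And>t. t \<in> cells2 A \<Longrightarrow> t \<ast> id2 (id1 (src A (Dom A t))) = t \<and> id2 (id1 (trg A (Dom A t))) \<ast> t = t"
    and assoch: "\<And>r s t. \<lbrakk>r \<in> cells2 A; s \<in> cells2 A; t \<in> cells2 A; src A (Dom A s) = trg A (Dom A r);
        src A (Dom A t) = trg A (Dom A s)\<rbrakk> \<Longrightarrow> (t \<ast> s) \<ast> r = t \<ast> (s \<ast> r)"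
    and hcomp_id2: "\<And>f g. \<lbrakk>f \<in> cells1 A; g \<in> cells1 A; src A g = trg A f\<rbrakk> \<Longrightarrow> id2 g \<ast> id2 f = id2 (g \<cdot> f)"
    and inter: "\<And>s s' t t'. \<lbrakk>s \<in> cells2 A; s' \<in> cells2 A; t \<in> cells2 A; t' \<in> cells2 A; Dom A s' = Cod A s;
        Dom A t' = Cod A t; src A (Dom A t) = trg A (Dom A s)\<rbrakk>
      \<Longrightarrow> (t' \<bullet> t) \<ast> (s' \<bullet> s) = (t' \<ast> s') \<bullet> (t \<ast> s)"
  shows "two_category A"
proof
qed (auto simp: hom1_def hom2_def homcat_def st DC id1 comp1 unit1 assoc1 id2 vcomp unit2 assoc2
  hcomp unith assoch hcomp_id2 inter)

section \<open>Calculus of pairs\<close>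

context fp_two_category
begin

declare terminal_cell [simp] prd_cell [simp]

lemma bang_cell [simp]:
  assumes "e \<in> cells0 A"
  shows "bang A e \<in> cells1 A" "src A (bang A e) = e" "trg A (bang A e) = \<one>"
  using theI'[OF terminal_univ1[OF assms]] by (auto simp: bang_def hom1_iff)

lemma bang_unique:
  assumes "f \<in> cells1 A" "trg A f = \<one>"
  shows "f = bang A (src A f)"
  using terminal_univ1[of "src A f"] assms bang_cell[of "src A f"] by (auto simp: hom1_iff)

lemma bang_comp [simp]:
  "u \<in> cells1 A \<Longrightarrow> e = trg A u \<Longrightarrow> bang A e \<cdot> u = bang A (src A u)"
  using bang_unique[of "bang A e \<cdot> u"] by simp

lemma pr_cell [simp]:
  assumes "x \<in> cells0 A" "y \<in> cells0 A"
  shows "pr1 A x y \<in> cells1 A" "src A (pr1 A x y) = x \<^bold>\<times> y" "trg A (pr1 A x y) = x"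
    "pr2 A x y \<in> cells1 A" "src A (pr2 A x y) = x \<^bold>\<times> y" "trg A (pr2 A x y) = y"
  using pr1_hom[OF assms] pr2_hom[OF assms] by (auto simp: hom1_iff)

lemma pair1_props:
  assumes "f \<in> cells1 A" "g \<in> cells1 A" "src A f = src A g"
  shows "\<langle>f, g\<rangle> \<in> hom1 A (src A f) (trg A f \<^bold>\<times> trg A g) \<and>
    pr1 A (trg A f) (trg A g) \<cdot> \<langle>f, g\<rangle> = f \<and> pr2 A (trg A f) (trg A g) \<cdot> \<langle>f, g\<rangle> = g"
  unfolding pair1_def
  by (rule theI', rule prd_univ1) (auto simp: hom1_iff assms)

lemma pair1_cell [simp]:
  assumes "f \<in> cells1 A" "g \<in> cells1 A" "src A f = src A g"
  shows "\<langle>f, g\<rangle> \<in> cells1 A" "src A \<langle>f, g\<rangle> = src A g" "trg A \<langle>f, g\<rangle> = trg A f \<^bold>\<times> trg A g"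
  using pair1_props[OF assms] assms(3) by (auto simp: hom1_iff)

lemma pr_pair1 [simp]:
  assumes "f \<in> cells1 A" "g \<in> cells1 A" "src A f = src A g" "x = trg A f" "y = trg A g"
  shows "pr1 A x y \<cdot> \<langle>f, g\<rangle> = f" "pr2 A x y \<cdot> \<langle>f, g\<rangle> = g"
  using pair1_props[OF assms(1-3)] assms(4,5) by auto

lemma pair1_unique:
  assumes "h \<in> cells1 A" "k \<in> cells1 A" "src A h = src A k" "x \<in> cells0 A" "y \<in> cells0 A"
    "trg A h = x \<^bold>\<times> y" "trg A k = x \<^bold>\<times> y"
    "pr1 A x y \<cdot> h = pr1 A x y \<cdot> k" "pr2 A x y \<cdot> h = pr2 A x y \<cdot> k"
  shows "h = k"
  using prd_univ1[of "pr1 A x y \<cdot> h" "src A h" x "pr2 A x y \<cdot> h" y] assms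
  by (auto simp: hom1_iff)

lemma pair1_eta [simp]:
  assumes "h \<in> cells1 A" "trg A h = x \<^bold>\<times> y" "x \<in> cells0 A" "y \<in> cells0 A"
  shows "\<langle>pr1 A x y \<cdot> h, pr2 A x y \<cdot> h\<rangle> = h"
  by (rule pair1_unique[of _ _ x y]) (use assms in auto)

lemma pair1_pr [simp]:
  assumes "x \<in> cells0 A" "y \<in> cells0 A"
  shows "\<langle>pr1 A x y, pr2 A x y\<rangle> = id1 (x \<^bold>\<times> y)"
  by (rule pair1_unique[of _ _ x y]) (use assms in auto)

lemma pair1_comp [simp]:
  assumes "f \<in> cells1 A" "g \<in> cells1 A" "src A f = src A g" "u \<in> cells1 A" "src A g = trg A u"
  shows "\<langle>f, g\<rangle> \<cdot> u = \<langle>f \<cdot> u, g \<cdot> u\<rangle>"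
  by (rule pair1_unique[of _ _ "trg A f" "trg A g"])
    (use assms in \<open>auto simp del: comp1_assoc' simp: comp1_assoc'[symmetric]\<close>)

lemma pair2_props:
  assumes "s \<in> cells2 A" "t \<in> cells2 A" "src2 A s = src2 A t"
  shows "\<llangle>s, t\<rrangle> \<in> homcat A (src2 A s) (trg2 A s \<^bold>\<times> trg2 A t) \<and>
    pr1 A (trg2 A s) (trg2 A t) \<rhd> \<llangle>s, t\<rrangle> = s \<and>
    pr2 A (trg2 A s) (trg2 A t) \<rhd> \<llangle>s, t\<rrangle> = t"
  unfolding pair2_def Let_def src_Dom_Cod trg_Dom_Cod
  by (rule theI', rule prd_univ2) (auto simp: homcat_iff assms)

lemma pair2_cell:
  assumes "s \<in> cells2 A" "t \<in> cells2 A" "src2 A s = src2 A t"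
  shows "\<llangle>s, t\<rrangle> \<in> cells2 A" "src2 A \<llangle>s, t\<rrangle> = src2 A t"
    "trg2 A \<llangle>s, t\<rrangle> = trg2 A s \<^bold>\<times> trg2 A t"
  using pair2_props[OF assms] assms(3) unfolding homcat_iff by metis+

lemma pr_pair2 [simp]:
  assumes "s \<in> cells2 A" "t \<in> cells2 A" "src2 A s = src2 A t"
    "x = trg2 A s" "y = trg2 A t"
  shows "pr1 A x y \<rhd> \<llangle>s, t\<rrangle> = s" "pr2 A x y \<rhd> \<llangle>s, t\<rrangle> = t"
  using pair2_props[OF assms(1-3)] assms(4,5) by auto

lemma pair2_unique:
  assumes "h \<in> cells2 A" "k \<in> cells2 A" "src2 A h = src2 A k"
    "x \<in> cells0 A" "y \<in> cells0 A" "trg2 A h = x \<^bold>\<times> y" "trg2 A k = x \<^bold>\<times> y"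
    "pr1 A x y \<rhd> h = pr1 A x y \<rhd> k" "pr2 A x y \<rhd> h = pr2 A x y \<rhd> k"
  shows "h = k"
  using prd_univ2[of "pr1 A x y \<rhd> h" "src2 A h" x "pr2 A x y \<rhd> h" y] assms
  by (auto simp: homcat_iff)

lemma pair2_Dom_Cod:
  assumes "s \<in> cells2 A" "t \<in> cells2 A" "src2 A s = src2 A t"
  shows "Dom A \<llangle>s, t\<rrangle> = \<langle>Dom A s, Dom A t\<rangle>" "Cod A \<llangle>s, t\<rrangle> = \<langle>Cod A s, Cod A t\<rangle>"
proof -
  let ?x = "trg2 A s" and ?y = "trg2 A t"
  note p = pr_pair2[OF assms refl refl] and c = pair2_cell[OF assms]
  have 1: "Dom A (pr1 A ?x ?y \<rhd> \<llangle>s, t\<rrangle>) = Dom A s" "Dom A (pr2 A ?x ?y \<rhd> \<llangle>s, t\<rrangle>) = Dom A t"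
    "Cod A (pr1 A ?x ?y \<rhd> \<llangle>s, t\<rrangle>) = Cod A s" "Cod A (pr2 A ?x ?y \<rhd> \<llangle>s, t\<rrangle>) = Cod A t"
    using p by simp_all
  show "Dom A \<llangle>s, t\<rrangle> = \<langle>Dom A s, Dom A t\<rangle>"
    by (rule pair1_unique[of _ _ ?x ?y]) (use 1 c assms in \<open>simp_all del: pr_pair2\<close>)
  show "Cod A \<llangle>s, t\<rrangle> = \<langle>Cod A s, Cod A t\<rangle>"
    by (rule pair1_unique[of _ _ ?x ?y]) (use 1 c assms in \<open>simp_all del: pr_pair2\<close>)
qed

declare pair2_cell [simp] pair2_Dom_Cod [simp]

lemma pair2_id2 [simp]:
  assumes "f \<in> cells1 A" "g \<in> cells1 A" "src A f = src A g"
  shows "\<llangle>id2 f, id2 g\<rrangle> = id2 \<langle>f, g\<rangle>"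
  by (rule pair2_unique[of _ _ "trg A f" "trg A g"]) (use assms in auto)

lemma pair2_whisker_right [simp]:
  assumes "s \<in> cells2 A" "t \<in> cells2 A" "src2 A s = src2 A t"
    "u \<in> cells1 A" "src2 A t = trg A u"
  shows "\<llangle>s, t\<rrangle> \<lhd> u = \<llangle>s \<lhd> u, t \<lhd> u\<rrangle>"
  by (rule pair2_unique[of _ _ "trg2 A s" "trg2 A t"])
    (use assms in \<open>auto simp del: whisker_left_right simp: whisker_left_right[symmetric]\<close>)

lemma pair1_whisker_left [simp]:
  assumes "f \<in> cells1 A" "g \<in> cells1 A" "src A f = src A g" "s \<in> cells2 A"
    "src A g = trg2 A s"
  shows "\<langle>f, g\<rangle> \<rhd> s = \<llangle>f \<rhd> s, g \<rhd> s\<rrangle>"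
  by (rule pair2_unique[of _ _ "trg A f" "trg A g"])
    (use assms in \<open>auto simp del: whisker_left_comp simp: whisker_left_comp[symmetric]\<close>)

lemma pair2_vcomp:
  assumes "s \<in> cells2 A" "t \<in> cells2 A" "src2 A s = src2 A t"
    "s' \<in> cells2 A" "t' \<in> cells2 A" "Dom A s' = Cod A s" "Dom A t' = Cod A t"
  shows "\<llangle>s', t'\<rrangle> \<bullet> \<llangle>s, t\<rrangle> = \<llangle>s' \<bullet> s, t' \<bullet> t\<rrangle>"
  by (rule pair2_unique[of _ _ "trg2 A s" "trg2 A t"])
    (use assms src2_composable[OF assms(1,4,6)] src2_composable[OF assms(2,5,7)] in simp_all)

text \<open>A pair of composites splits into a composite of pairs in several ways when both entries are
  composite; next to an identity the splitting is forced, and it expresses the functoriality of a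
  1-cell \<open>T(-, b)\<close> or \<open>T(b, -)\<close>.\<close>

lemma pair2_vcomp_id2 [simp]:
  assumes "s \<in> cells2 A" "s' \<in> cells2 A" "Dom A s' = Cod A s" "f \<in> cells1 A"
    "src2 A s = src A f"
  shows "\<llangle>s' \<bullet> s, id2 f\<rrangle> = \<llangle>s', id2 f\<rrangle> \<bullet> \<llangle>s, id2 f\<rrangle>"
    "\<llangle>id2 f, s' \<bullet> s\<rrangle> = \<llangle>id2 f, s'\<rrangle> \<bullet> \<llangle>id2 f, s\<rrangle>"
  using assms src2_composable[OF assms(1-3)] by (simp_all add: pair2_vcomp)

lemma invertible2_pair2:
  assumes "invertible2 A s" "invertible2 A t" "src2 A s = src2 A t"
  shows "invertible2 A \<llangle>s, t\<rrangle>"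
proof -
  from assms(1) obtain s' where s: "s \<in> cells2 A" "s' \<in> cells2 A" "Dom A s' = Cod A s"
    "Cod A s' = Dom A s" "src2 A s' = src2 A s" "trg2 A s' = trg2 A s"
    "s' \<bullet> s = id2 (Dom A s)" "s \<bullet> s' = id2 (Cod A s)"
    by (rule invertible2E)
  from assms(2) obtain t' where t: "t \<in> cells2 A" "t' \<in> cells2 A" "Dom A t' = Cod A t"
    "Cod A t' = Dom A t" "src2 A t' = src2 A t" "trg2 A t' = trg2 A t"
    "t' \<bullet> t = id2 (Dom A t)" "t \<bullet> t' = id2 (Cod A t)"
    by (rule invertible2E)
  show ?thesis
    by (rule invertible2I[of _ "\<llangle>s', t'\<rrangle>"]) (use s t assms(3) in \<open>simp_all add: pair2_vcomp\<close>)
qed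

end

section \<open>Lax monoidal 1-cells and their composites\<close>

context fp_two_category
begin

lemma monoidal_object_cell [simp]:
  assumes "monoidal_object A M"
  defines "C \<equiv> car M"
  shows "C \<in> cells0 A"
    "ten M \<in> cells1 A" "src A (ten M) = C \<^bold>\<times> C" "trg A (ten M) = C"
    "unt M \<in> cells1 A" "src A (unt M) = \<one>" "trg A (unt M) = C"
    "alph M \<in> cells2 A" "src2 A (alph M) = C \<^bold>\<times> C \<^bold>\<times> C" "trg2 A (alph M) = C"
    "Dom A (alph M) = ten M \<cdot> \<langle>pr1 A C (C \<^bold>\<times> C), ten M \<cdot> pr2 A C (C \<^bold>\<times> C)\<rangle>"
    "Cod A (alph M) = ten M \<cdot>
       \<langle>ten M \<cdot> \<langle>pr1 A C (C \<^bold>\<times> C), pr1 A C C \<cdot> pr2 A C (C \<^bold>\<times> C)\<rangle>, pr2 A C C \<cdot> pr2 A C (C \<^bold>\<times> C)\<rangle>"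
    "lam M \<in> cells2 A" "src2 A (lam M) = C" "trg2 A (lam M) = C"
    "Dom A (lam M) = ten M \<cdot> \<langle>unt M \<cdot> bang A C, id1 C\<rangle>"
    "Cod A (lam M) = id1 C"
    "rho M \<in> cells2 A" "src2 A (rho M) = C" "trg2 A (rho M) = C"
    "Dom A (rho M) = ten M \<cdot> \<langle>id1 C, unt M \<cdot> bang A C\<rangle>"
    "Cod A (rho M) = id1 C"
proof -
  have "car M \<in> cells0 A" "ten M \<in> hom1 A (C \<^bold>\<times> C) C" "unt M \<in> hom1 A \<one> C"
    and \<alpha>: "alph M \<in> hom2 A (ap1 A (ten M) (pr1 A C (C \<^bold>\<times> C))
        (ap1 A (ten M) (pr1 A C C \<cdot> pr2 A C (C \<^bold>\<times> C)) (pr2 A C C \<cdot> pr2 A C (C \<^bold>\<times> C))))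
      (ap1 A (ten M) (ap1 A (ten M) (pr1 A C (C \<^bold>\<times> C)) (pr1 A C C \<cdot> pr2 A C (C \<^bold>\<times> C)))
        (pr2 A C C \<cdot> pr2 A C (C \<^bold>\<times> C)))"
    and l: "lam M \<in> hom2 A (ap1 A (ten M) (const1 A (unt M) C) (id1 C)) (id1 C)"
    and r: "rho M \<in> hom2 A (ap1 A (ten M) (id1 C) (const1 A (unt M) C)) (id1 C)"
    using assms(1) unfolding monoidal_object_def C_def Let_def vars3_def prod.case
    by blast+
  then show C [simp]: "C \<in> cells0 A" "ten M \<in> cells1 A" "src A (ten M) = C \<^bold>\<times> C"
    "trg A (ten M) = C" "unt M \<in> cells1 A" "src A (unt M) = \<one>" "trg A (unt M) = C"
    by (simp_all add: hom1_iff C_def)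
  show "alph M \<in> cells2 A"
    "Dom A (alph M) = ten M \<cdot> \<langle>pr1 A C (C \<^bold>\<times> C), ten M \<cdot> pr2 A C (C \<^bold>\<times> C)\<rangle>"
    "Cod A (alph M) = ten M \<cdot>
       \<langle>ten M \<cdot> \<langle>pr1 A C (C \<^bold>\<times> C), pr1 A C C \<cdot> pr2 A C (C \<^bold>\<times> C)\<rangle>, pr2 A C C \<cdot> pr2 A C (C \<^bold>\<times> C)\<rangle>"
    "lam M \<in> cells2 A"
    "Dom A (lam M) = ten M \<cdot> \<langle>unt M \<cdot> bang A C, id1 C\<rangle>"
    "Cod A (lam M) = id1 C"
    "rho M \<in> cells2 A"
    "Dom A (rho M) = ten M \<cdot> \<langle>id1 C, unt M \<cdot> bang A C\<rangle>"
    "Cod A (rho M) = id1 C"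
    using \<alpha> l r by (simp_all add: hom2_iff ap1_def const1_def)
  show "src2 A (alph M) = C \<^bold>\<times> C \<^bold>\<times> C" "trg2 A (alph M) = C"
    "src2 A (lam M) = C" "trg2 A (lam M) = C" "src2 A (rho M) = C" "trg2 A (rho M) = C"
    using \<alpha> l r by (simp_all add: hom2_iff ap1_def const1_def src2_def trg2_def del: src_Dom_Cod(1) trg_Dom_Cod(1))
qed

lemma mon1_cell_csrc [simp]: "mon1_cell A f \<Longrightarrow> monoidal_object A (csrc f)"
  and mon1_cell_ctrg [simp]: "mon1_cell A f \<Longrightarrow> monoidal_object A (ctrg f)"
  unfolding mon1_cell_def by blast+

lemma lax_monoidal_body: "mon1_cell A f \<Longrightarrow> lax_monoidal A (csrc f) (ctrg f) (body f)"
  unfolding mon1_cell_def by blast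

lemma mon1_cell_cell [simp]:
  assumes "mon1_cell A f"
  defines "C \<equiv> car (csrc f)" and "F \<equiv> und (body f)"
  shows "F \<in> cells1 A" "src A F = C" "trg A F = car (ctrg f)"
    "mlt (body f) \<in> cells2 A" "src2 A (mlt (body f)) = C \<^bold>\<times> C"
    "trg2 A (mlt (body f)) = car (ctrg f)"
    "Dom A (mlt (body f)) = ten (ctrg f) \<cdot> \<langle>F \<cdot> pr1 A C C, F \<cdot> pr2 A C C\<rangle>"
    "Cod A (mlt (body f)) = F \<cdot> ten (csrc f)"
    "ult (body f) \<in> cells2 A" "src2 A (ult (body f)) = \<one>" "trg2 A (ult (body f)) = car (ctrg f)"
    "Dom A (ult (body f)) = unt (ctrg f)"
    "Cod A (ult (body f)) = F \<cdot> unt (csrc f)"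
proof -
  let ?M = "csrc f"
  have C: "C \<in> cells0 A" using assms by simp
  have "F \<in> hom1 A C (car (ctrg f))"
    and m: "mlt (body f) \<in> hom2 A (ap1 A (ten (ctrg f)) (F \<cdot> pr1 A C C) (F \<cdot> pr2 A C C))
      (F \<cdot> ap1 A (ten ?M) (pr1 A C C) (pr2 A C C))"
    and u: "ult (body f) \<in> hom2 A (unt (ctrg f)) (F \<cdot> unt ?M)"
    using lax_monoidal_body[OF assms(1)]
    unfolding lax_monoidal_def C_def F_def Let_def vars2_def prod.case
    by blast+
  then show F: "F \<in> cells1 A" "src A F = C" "trg A F = car (ctrg f)"
    by (simp_all add: hom1_iff)
  show "mlt (body f) \<in> cells2 A"
    "Dom A (mlt (body f)) = ten (ctrg f) \<cdot> \<langle>F \<cdot> pr1 A C C, F \<cdot> pr2 A C C\<rangle>"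
    "Cod A (mlt (body f)) = F \<cdot> ten (csrc f)"
    "ult (body f) \<in> cells2 A" "Dom A (ult (body f)) = unt (ctrg f)"
    "Cod A (ult (body f)) = F \<cdot> unt (csrc f)"
    using m u F C assms(1) C_def by (simp_all add: hom2_iff ap1_def)
  show "src2 A (mlt (body f)) = C \<^bold>\<times> C" "trg2 A (mlt (body f)) = car (ctrg f)"
    "src2 A (ult (body f)) = \<one>" "trg2 A (ult (body f)) = car (ctrg f)"
    using m u F C assms(1) C_def
    by (simp_all add: hom2_iff ap1_def src2_def trg2_def del: src_Dom_Cod(1) trg_Dom_Cod(1))
qed

text \<open>The three axioms of a lax monoidal 1-cell, read at generalised elements.\<close>

definition lax_assoc_at :: "('o, 'a, 'c) mon1 \<Rightarrow> 'a \<Rightarrow> 'a \<Rightarrow> 'a \<Rightarrow> bool" where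
  "lax_assoc_at f a b c \<longleftrightarrow> (let F = und (body f); \<phi> = mlt (body f); T = ten (csrc f); T' = ten (ctrg f) in
     (F \<rhd> (alph (csrc f) \<lhd> \<langle>a, \<langle>b, c\<rangle>\<rangle>)) \<bullet> (\<phi> \<lhd> \<langle>a, T \<cdot> \<langle>b, c\<rangle>\<rangle>) \<bullet> (T' \<rhd> \<llangle>id2 (F \<cdot> a), \<phi> \<lhd> \<langle>b, c\<rangle>\<rrangle>) =
     (\<phi> \<lhd> \<langle>T \<cdot> \<langle>a, b\<rangle>, c\<rangle>) \<bullet> (T' \<rhd> \<llangle>\<phi> \<lhd> \<langle>a, b\<rangle>, id2 (F \<cdot> c)\<rrangle>) \<bullet>
       (alph (ctrg f) \<lhd> \<langle>F \<cdot> a, \<langle>F \<cdot> b, F \<cdot> c\<rangle>\<rangle>))"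

definition lax_lam_at :: "('o, 'a, 'c) mon1 \<Rightarrow> 'a \<Rightarrow> bool" where
  "lax_lam_at f a \<longleftrightarrow> (let F = und (body f); e = src A a in
     (F \<rhd> (lam (csrc f) \<lhd> a)) \<bullet> (mlt (body f) \<lhd> \<langle>unt (csrc f) \<cdot> bang A e, a\<rangle>) \<bullet>
       (ten (ctrg f) \<rhd> \<llangle>ult (body f) \<lhd> bang A e, id2 (F \<cdot> a)\<rrangle>) = lam (ctrg f) \<lhd> (F \<cdot> a))"

definition lax_rho_at :: "('o, 'a, 'c) mon1 \<Rightarrow> 'a \<Rightarrow> bool" where
  "lax_rho_at f a \<longleftrightarrow> (let F = und (body f); e = src A a in
     (F \<rhd> (rho (csrc f) \<lhd> a)) \<bullet> (mlt (body f) \<lhd> \<langle>a, unt (csrc f) \<cdot> bang A e\<rangle>) \<bullet>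
       (ten (ctrg f) \<rhd> \<llangle>id2 (F \<cdot> a), ult (body f) \<lhd> bang A e\<rrangle>) = rho (ctrg f) \<lhd> (F \<cdot> a))"

text \<open>The axiom is stable under substitution, since all its constituents are. This is what passes from
  the product projections to arbitrary elements.\<close>

lemma lax_assoc_at_comp:
  assumes f: "mon1_cell A f" and abc: "a \<in> cells1 A" "b \<in> cells1 A" "c \<in> cells1 A"
    "src A b = src A a" "src A c = src A a"
    "trg A a = car (csrc f)" "trg A b = car (csrc f)" "trg A c = car (csrc f)"
   "u \<in> cells1 A" "trg A u = src A a"
   and at: "lax_assoc_at f a b c"
  shows "lax_assoc_at f (a \<cdot> u) (b \<cdot> u) (c \<cdot> u)"
proof -
  note gen = at[unfolded lax_assoc_at_def Let_def]
  let ?F = "und (body f)" and ?\<phi> = "mlt (body f)" and ?T = "ten (csrc f)" and ?T' = "ten (ctrg f)"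
  have 1: "((?F \<rhd> (alph (csrc f) \<lhd> \<langle>a, \<langle>b, c\<rangle>\<rangle>)) \<bullet> (?\<phi> \<lhd> \<langle>a, ?T \<cdot> \<langle>b, c\<rangle>\<rangle>) \<bullet> (?T' \<rhd> \<llangle>id2 (?F \<cdot> a), ?\<phi> \<lhd> \<langle>b, c\<rangle>\<rrangle>)) \<lhd> u
    = (?F \<rhd> (alph (csrc f) \<lhd> \<langle>a \<cdot> u, \<langle>b \<cdot> u, c \<cdot> u\<rangle>\<rangle>)) \<bullet> (?\<phi> \<lhd> \<langle>a \<cdot> u, ?T \<cdot> \<langle>b \<cdot> u, c \<cdot> u\<rangle>\<rangle>) \<bullet> (?T' \<rhd> \<llangle>id2 (?F \<cdot> a \<cdot> u), ?\<phi> \<lhd> \<langle>b \<cdot> u, c \<cdot> u\<rangle>\<rrangle>)"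
    using f abc by (subst whisker_right_vcomp3) simp_all
  have 2: "((?\<phi> \<lhd> \<langle>?T \<cdot> \<langle>a, b\<rangle>, c\<rangle>) \<bullet> (?T' \<rhd> \<llangle>?\<phi> \<lhd> \<langle>a, b\<rangle>, id2 (?F \<cdot> c)\<rrangle>) \<bullet>
       (alph (ctrg f) \<lhd> \<langle>?F \<cdot> a, \<langle>?F \<cdot> b, ?F \<cdot> c\<rangle>\<rangle>)) \<lhd> u
    = (?\<phi> \<lhd> \<langle>?T \<cdot> \<langle>a \<cdot> u, b \<cdot> u\<rangle>, c \<cdot> u\<rangle>) \<bullet> (?T' \<rhd> \<llangle>?\<phi> \<lhd> \<langle>a \<cdot> u, b \<cdot> u\<rangle>, id2 (?F \<cdot> c \<cdot> u)\<rrangle>) \<bullet>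
       (alph (ctrg f) \<lhd> \<langle>?F \<cdot> a \<cdot> u, \<langle>?F \<cdot> b \<cdot> u, ?F \<cdot> c \<cdot> u\<rangle>\<rangle>)"
    using f abc by (subst whisker_right_vcomp3) simp_all
  show ?thesis
    unfolding lax_assoc_at_def Let_def 1[symmetric] 2[symmetric] gen ..
qed

lemma lax_assoc_elem:
  assumes f: "mon1_cell A f" and abc: "a \<in> cells1 A" "b \<in> cells1 A" "c \<in> cells1 A"
    "src A b = src A a" "src A c = src A a"
    "trg A a = car (csrc f)" "trg A b = car (csrc f)" "trg A c = car (csrc f)"
  shows "lax_assoc_at f a b c"
proof -
  let ?C = "car (csrc f)"
  let ?x = "pr1 A ?C (?C \<^bold>\<times> ?C)" and ?y = "pr1 A ?C ?C \<cdot> pr2 A ?C (?C \<^bold>\<times> ?C)"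
    and ?z = "pr2 A ?C ?C \<cdot> pr2 A ?C (?C \<^bold>\<times> ?C)"
  have "lax_assoc_at f ?x ?y ?z"
    using lax_monoidal_body[OF f]
    unfolding lax_monoidal_def Let_def vars3_def prod.case ap1_def ap2_def at2_def at3_def
      lax_assoc_at_def
    by - (elim conjE, assumption)
  then have "lax_assoc_at f (?x \<cdot> \<langle>a, \<langle>b, c\<rangle>\<rangle>) (?y \<cdot> \<langle>a, \<langle>b, c\<rangle>\<rangle>) (?z \<cdot> \<langle>a, \<langle>b, c\<rangle>\<rangle>)"
    using f abc by (intro lax_assoc_at_comp) simp_all
  then show ?thesis
    using f abc by simp
qed

lemma lax_unit_elem:
  assumes f: "mon1_cell A f" and a: "a \<in> cells1 A" "trg A a = car (csrc f)"
  shows "lax_lam_at f a" "lax_rho_at f a"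
proof -
  let ?C = "car (csrc f)"
  let ?F = "und (body f)" and ?\<phi> = "mlt (body f)" and ?I = "unt (csrc f)"
  have l: "(?F \<rhd> lam (csrc f)) \<bullet> (?\<phi> \<lhd> \<langle>?I \<cdot> bang A ?C, id1 ?C\<rangle>) \<bullet>
      (ten (ctrg f) \<rhd> \<llangle>ult (body f) \<lhd> bang A ?C, id2 ?F\<rrangle>) = lam (ctrg f) \<lhd> ?F"
    and r: "(?F \<rhd> rho (csrc f)) \<bullet> (?\<phi> \<lhd> \<langle>id1 ?C, ?I \<cdot> bang A ?C\<rangle>) \<bullet>
      (ten (ctrg f) \<rhd> \<llangle>id2 ?F, ult (body f) \<lhd> bang A ?C\<rrangle>) = rho (ctrg f) \<lhd> ?F"
    using lax_monoidal_body[OF f]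
    unfolding lax_monoidal_def Let_def const1_def ap2_def at2_def
    by - (elim conjE, assumption)+
  show "lax_lam_at f a"
    using l[THEN arg_cong[where f = "\<lambda>t. t \<lhd> a"]] f a
    by (simp add: lax_lam_at_def)
  show "lax_rho_at f a"
    using r[THEN arg_cong[where f = "\<lambda>t. t \<lhd> a"]] f a
    by (simp add: lax_rho_at_def)
qed

text \<open>The converse passage: the axioms in the definition are the instances at the projections, or at
  the identity for the two unit axioms.\<close>

lemma mon1_cellI:
  assumes M [simp]: "monoidal_object A (csrc f)" and N [simp]: "monoidal_object A (ctrg f)"
  defines "C \<equiv> car (csrc f)" and "F \<equiv> und (body f)"
  assumes F [simp]: "F \<in> cells1 A" "src A F = C" "trg A F = car (ctrg f)"
    and \<phi>: "mlt (body f) \<in> cells2 A"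
      "Dom A (mlt (body f)) = ten (ctrg f) \<cdot> \<langle>F \<cdot> pr1 A C C, F \<cdot> pr2 A C C\<rangle>"
      "Cod A (mlt (body f)) = F \<cdot> ten (csrc f)"
    and \<phi>0: "ult (body f) \<in> cells2 A" "Dom A (ult (body f)) = unt (ctrg f)"
      "Cod A (ult (body f)) = F \<cdot> unt (csrc f)"
    and assoc: "\<And>a b c. \<lbrakk>a \<in> cells1 A; b \<in> cells1 A; c \<in> cells1 A; src A b = src A a;
        src A c = src A a; trg A a = C; trg A b = C; trg A c = C\<rbrakk> \<Longrightarrow> lax_assoc_at f a b c"
    and lam: "\<And>a. \<lbrakk>a \<in> cells1 A; trg A a = C\<rbrakk> \<Longrightarrow> lax_lam_at f a"
    and rho: "\<And>a. \<lbrakk>a \<in> cells1 A; trg A a = C\<rbrakk> \<Longrightarrow> lax_rho_at f a"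
  shows "mon1_cell A f"
proof -
  have C [simp]: "C \<in> cells0 A" by (simp add: C_def)
  have \<phi>2 [simp]: "src2 A (mlt (body f)) = C \<^bold>\<times> C" "trg2 A (mlt (body f)) = car (ctrg f)"
    unfolding src2_def trg2_def using \<phi> C_def by (simp_all del: src_Dom_Cod(1) trg_Dom_Cod(1))
  have "lax_assoc_at f (pr1 A C (C \<^bold>\<times> C)) (pr1 A C C \<cdot> pr2 A C (C \<^bold>\<times> C)) (pr2 A C C \<cdot> pr2 A C (C \<^bold>\<times> C))"
    by (rule assoc) simp_all
  moreover have "(F \<rhd> lam (csrc f)) \<bullet> at2 A (mlt (body f)) (const1 A (unt (csrc f)) C) (id1 C) \<bullet>
      ap2 A (ten (ctrg f)) (ult (body f) \<lhd> bang A C) (id2 F) = lam (ctrg f) \<lhd> F"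
    using lam[of "id1 C"]
    unfolding lax_lam_at_def at2_def ap2_def const1_def Let_def C_def[symmetric] F_def[symmetric]
    by (simp add: C_def)
  moreover have "(F \<rhd> rho (csrc f)) \<bullet> at2 A (mlt (body f)) (id1 C) (const1 A (unt (csrc f)) C) \<bullet>
      ap2 A (ten (ctrg f)) (id2 F) (ult (body f) \<lhd> bang A C) = rho (ctrg f) \<lhd> F"
    using rho[of "id1 C"]
    unfolding lax_rho_at_def at2_def ap2_def const1_def Let_def C_def[symmetric] F_def[symmetric]
    by (simp add: C_def)
  moreover have "F \<in> hom1 A C (car (ctrg f))" by (simp add: hom1_iff)
  moreover have "mlt (body f) \<in> hom2 A (ap1 A (ten (ctrg f)) (F \<cdot> pr1 A C C) (F \<cdot> pr2 A C C))
      (F \<cdot> ap1 A (ten (csrc f)) (pr1 A C C) (pr2 A C C))"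
    using \<phi> C_def by (simp add: hom2_iff ap1_def)
  moreover have "ult (body f) \<in> hom2 A (unt (ctrg f)) (F \<cdot> unt (csrc f))"
    using \<phi>0 by (simp add: hom2_iff)
  ultimately show ?thesis
    using M N
    unfolding mon1_cell_def lax_monoidal_def Let_def vars3_def vars2_def prod.case ap1_def ap2_def
      at2_def at3_def lax_assoc_at_def C_def F_def
    by blast
qed

lemma mlt_natural:
  assumes f: "mon1_cell A f" and st: "s \<in> cells2 A" "t \<in> cells2 A" "src2 A s = src2 A t"
    "trg2 A s = car (csrc f)" "trg2 A t = car (csrc f)"
  defines "F \<equiv> und (body f)"
  shows "(mlt (body f) \<lhd> \<langle>Cod A s, Cod A t\<rangle>) \<bullet> (ten (ctrg f) \<rhd> \<llangle>F \<rhd> s, F \<rhd> t\<rrangle>) =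
    (F \<rhd> ten (csrc f) \<rhd> \<llangle>s, t\<rrangle>) \<bullet> (mlt (body f) \<lhd> \<langle>Dom A s, Dom A t\<rangle>)"
  using whisker_exchange[of "\<llangle>s, t\<rrangle>" "mlt (body f)"] f st unfolding F_def by simp

lemma mon_comp1_sel [simp]:
  "csrc (mon_comp1 A g f) = csrc f" "ctrg (mon_comp1 A g f) = ctrg g"
  "und (body (mon_comp1 A g f)) = und (body g) \<cdot> und (body f)"
  "ult (body (mon_comp1 A g f)) = (und (body g) \<rhd> ult (body f)) \<bullet> ult (body g)"
  by (simp_all add: mon_comp1_def Let_def vars2_def)

lemma mlt_mon_comp1:
  "mlt (body (mon_comp1 A g f)) = (und (body g) \<rhd> mlt (body f)) \<bullet>
     (mlt (body g) \<lhd> \<langle>und (body f) \<cdot> pr1 A (car (csrc f)) (car (csrc f)),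
        und (body f) \<cdot> pr2 A (car (csrc f)) (car (csrc f))\<rangle>)"
  by (simp add: mon_comp1_def Let_def vars2_def at2_def)

lemma mlt_mon_comp1_at [simp]:
  assumes "mon1_cell A f" "mon1_cell A g" "ctrg f = csrc g"
    "a \<in> cells1 A" "b \<in> cells1 A" "src A a = src A b"
    "trg A a = car (csrc f)" "trg A b = car (csrc f)"
  shows "mlt (body (mon_comp1 A g f)) \<lhd> \<langle>a, b\<rangle> = (und (body g) \<rhd> (mlt (body f) \<lhd> \<langle>a, b\<rangle>)) \<bullet>
     (mlt (body g) \<lhd> \<langle>und (body f) \<cdot> a, und (body f) \<cdot> b\<rangle>)"
  using assms by (simp add: mlt_mon_comp1)

text \<open>The pasting that proves associativity of a composite \<open>G F\<close>, with one variable for each 2-cell: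
  \<open>1\<close> is the axiom of \<open>F\<close> under \<open>G\<close>, \<open>3\<close> is the axiom of \<open>G\<close>, and \<open>2\<close>, \<open>4\<close> are the naturality squares of
  the multiplication of \<open>G\<close> that connect them.\<close>

lemma mon_comp1_assoc_paste:
  assumes "p \<in> hom2 A x4 x5" "q \<in> hom2 A x3 x4" "v \<in> hom2 A x2 x3" "x \<in> hom2 A x1 x2"
    "z \<in> hom2 A x0 x1" "r \<in> hom2 A y2 x3" "v' \<in> hom2 A x1 y2"
    "s \<in> hom2 A z4 x5" "t \<in> hom2 A z3 z4" "w \<in> hom2 A y2 z3"
    "v2 \<in> hom2 A z2 z3" "y \<in> hom2 A z1 z2" "k \<in> hom2 A x0 z1"
    "v3 \<in> hom2 A w3 z4" "j \<in> hom2 A z2 w3"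
    and 1: "p \<bullet> q \<bullet> r = s \<bullet> t \<bullet> w" and 2: "v \<bullet> x = r \<bullet> v'"
    and 3: "w \<bullet> v' \<bullet> z = v2 \<bullet> y \<bullet> k" and 4: "v3 \<bullet> j = t \<bullet> v2"
  shows "p \<bullet> (q \<bullet> v) \<bullet> (x \<bullet> z) = (s \<bullet> v3) \<bullet> (j \<bullet> y) \<bullet> k"
proof -
  note [simp] = assms(1-15)[unfolded hom2_iff]
  have "p \<bullet> (q \<bullet> v) \<bullet> (x \<bullet> z) = p \<bullet> q \<bullet> (v \<bullet> x) \<bullet> z" by simp
  also have "\<dots> = (p \<bullet> q \<bullet> r) \<bullet> v' \<bullet> z" unfolding 2 by simp
  also have "\<dots> = s \<bullet> t \<bullet> (w \<bullet> v' \<bullet> z)" unfolding 1 by simp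
  also have "\<dots> = s \<bullet> (t \<bullet> v2) \<bullet> y \<bullet> k" unfolding 3 by simp
  also have "\<dots> = (s \<bullet> v3) \<bullet> (j \<bullet> y) \<bullet> k" unfolding 4[symmetric] by simp
  finally show ?thesis .
qed

text \<open>The same pasting for the unit axioms, where a single naturality square suffices.\<close>

lemma mon_comp1_unit_paste:
  assumes "p \<in> hom2 A x4 x5" "q \<in> hom2 A x3 x4" "v \<in> hom2 A x2 x3" "x \<in> hom2 A x1 x2"
    "z \<in> hom2 A x0 x1" "r \<in> hom2 A y2 x3" "v' \<in> hom2 A x1 y2"
    "w \<in> hom2 A y2 x5"
    and 1: "p \<bullet> q \<bullet> r = w" and 2: "v \<bullet> x = r \<bullet> v'" and 3: "w \<bullet> v' \<bullet> z = k"
  shows "p \<bullet> (q \<bullet> v) \<bullet> (x \<bullet> z) = k"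
proof -
  note [simp] = assms(1-8)[unfolded hom2_iff]
  have "p \<bullet> (q \<bullet> v) \<bullet> (x \<bullet> z) = p \<bullet> q \<bullet> (v \<bullet> x) \<bullet> z" by simp
  also have "\<dots> = (p \<bullet> q \<bullet> r) \<bullet> v' \<bullet> z" unfolding 2 by simp
  finally show ?thesis unfolding 1 3 .
qed

lemma mon_comp1_assoc_at:
  assumes [simp]: "mon1_cell A f" "mon1_cell A g" "ctrg f = csrc g"
    and [simp]: "a \<in> cells1 A" "b \<in> cells1 A" "c \<in> cells1 A" "src A b = src A a" "src A c = src A a"
      "trg A a = car (csrc f)" "trg A b = car (csrc f)" "trg A c = car (csrc f)"
  shows "lax_assoc_at (mon_comp1 A g f) a b c"
proof -
  let ?F = "und (body f)" and ?\<phi> = "mlt (body f)" and ?T = "ten (csrc f)" and ?T' = "ten (csrc g)"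
  let ?G = "und (body g)" and ?\<gamma> = "mlt (body g)" and ?T'' = "ten (ctrg g)"
  have f: "(?F \<rhd> (alph (csrc f) \<lhd> \<langle>a, \<langle>b, c\<rangle>\<rangle>)) \<bullet> (?\<phi> \<lhd> \<langle>a, ?T \<cdot> \<langle>b, c\<rangle>\<rangle>) \<bullet> (?T' \<rhd> \<llangle>id2 (?F \<cdot> a), ?\<phi> \<lhd> \<langle>b, c\<rangle>\<rrangle>) =
     (?\<phi> \<lhd> \<langle>?T \<cdot> \<langle>a, b\<rangle>, c\<rangle>) \<bullet> (?T' \<rhd> \<llangle>?\<phi> \<lhd> \<langle>a, b\<rangle>, id2 (?F \<cdot> c)\<rrangle>) \<bullet>
       (alph (csrc g) \<lhd> \<langle>?F \<cdot> a, \<langle>?F \<cdot> b, ?F \<cdot> c\<rangle>\<rangle>)"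
    using lax_assoc_elem[of f a b c] unfolding lax_assoc_at_def Let_def by simp
  have Gf: "(?G \<rhd> ?F \<rhd> (alph (csrc f) \<lhd> \<langle>a, \<langle>b, c\<rangle>\<rangle>)) \<bullet> (?G \<rhd> (?\<phi> \<lhd> \<langle>a, ?T \<cdot> \<langle>b, c\<rangle>\<rangle>)) \<bullet>
       (?G \<rhd> ?T' \<rhd> \<llangle>id2 (?F \<cdot> a), ?\<phi> \<lhd> \<langle>b, c\<rangle>\<rrangle>) =
     (?G \<rhd> (?\<phi> \<lhd> \<langle>?T \<cdot> \<langle>a, b\<rangle>, c\<rangle>)) \<bullet> (?G \<rhd> ?T' \<rhd> \<llangle>?\<phi> \<lhd> \<langle>a, b\<rangle>, id2 (?F \<cdot> c)\<rrangle>) \<bullet>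
       (?G \<rhd> (alph (csrc g) \<lhd> \<langle>?F \<cdot> a, \<langle>?F \<cdot> b, ?F \<cdot> c\<rangle>\<rangle>))"
    by (rule whisker_left_eq3[OF f]) simp_all
  have g: "(?G \<rhd> (alph (csrc g) \<lhd> \<langle>?F \<cdot> a, \<langle>?F \<cdot> b, ?F \<cdot> c\<rangle>\<rangle>)) \<bullet> (?\<gamma> \<lhd> \<langle>?F \<cdot> a, ?T' \<cdot> \<langle>?F \<cdot> b, ?F \<cdot> c\<rangle>\<rangle>) \<bullet>
       (?T'' \<rhd> \<llangle>id2 (?G \<cdot> ?F \<cdot> a), ?\<gamma> \<lhd> \<langle>?F \<cdot> b, ?F \<cdot> c\<rangle>\<rrangle>) =
     (?\<gamma> \<lhd> \<langle>?T' \<cdot> \<langle>?F \<cdot> a, ?F \<cdot> b\<rangle>, ?F \<cdot> c\<rangle>) \<bullet> (?T'' \<rhd> \<llangle>?\<gamma> \<lhd> \<langle>?F \<cdot> a, ?F \<cdot> b\<rangle>, id2 (?G \<cdot> ?F \<cdot> c)\<rrangle>) \<bullet>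
       (alph (ctrg g) \<lhd> \<langle>?G \<cdot> ?F \<cdot> a, \<langle>?G \<cdot> ?F \<cdot> b, ?G \<cdot> ?F \<cdot> c\<rangle>\<rangle>)"
    using lax_assoc_elem[of g "?F \<cdot> a" "?F \<cdot> b" "?F \<cdot> c"] unfolding lax_assoc_at_def Let_def by simp
  have n1: "(?\<gamma> \<lhd> \<langle>?F \<cdot> a, ?F \<cdot> ?T \<cdot> \<langle>b, c\<rangle>\<rangle>) \<bullet> (?T'' \<rhd> \<llangle>id2 (?G \<cdot> ?F \<cdot> a), ?G \<rhd> (?\<phi> \<lhd> \<langle>b, c\<rangle>)\<rrangle>) =
      (?G \<rhd> ?T' \<rhd> \<llangle>id2 (?F \<cdot> a), ?\<phi> \<lhd> \<langle>b, c\<rangle>\<rrangle>) \<bullet> (?\<gamma> \<lhd> \<langle>?F \<cdot> a, ?T' \<cdot> \<langle>?F \<cdot> b, ?F \<cdot> c\<rangle>\<rangle>)"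
    using mlt_natural[of g "id2 (?F \<cdot> a)" "?\<phi> \<lhd> \<langle>b, c\<rangle>"] by simp
  have n2: "(?\<gamma> \<lhd> \<langle>?F \<cdot> ?T \<cdot> \<langle>a, b\<rangle>, ?F \<cdot> c\<rangle>) \<bullet> (?T'' \<rhd> \<llangle>?G \<rhd> (?\<phi> \<lhd> \<langle>a, b\<rangle>), id2 (?G \<cdot> ?F \<cdot> c)\<rrangle>) =
      (?G \<rhd> ?T' \<rhd> \<llangle>?\<phi> \<lhd> \<langle>a, b\<rangle>, id2 (?F \<cdot> c)\<rrangle>) \<bullet> (?\<gamma> \<lhd> \<langle>?T' \<cdot> \<langle>?F \<cdot> a, ?F \<cdot> b\<rangle>, ?F \<cdot> c\<rangle>)"
    using mlt_natural[of g "?\<phi> \<lhd> \<langle>a, b\<rangle>" "id2 (?F \<cdot> c)"] by simp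
  note paste = mon_comp1_assoc_paste[OF _ _ _ _ _ _ _ _ _ _ _ _ _ _ _ Gf n1 g n2]
  show ?thesis
    unfolding lax_assoc_at_def Let_def
    by (simp del: vcomp_assoc', rule paste) (simp_all add: hom2_iff)
qed

lemma mon_comp1_lam_at:
  assumes [simp]: "mon1_cell A f" "mon1_cell A g" "ctrg f = csrc g"
    and [simp]: "a \<in> cells1 A" "trg A a = car (csrc f)"
  shows "lax_lam_at (mon_comp1 A g f) a"
proof -
  let ?F = "und (body f)" and ?\<phi> = "mlt (body f)" and ?T = "ten (csrc f)" and ?T' = "ten (csrc g)"
  let ?G = "und (body g)" and ?\<gamma> = "mlt (body g)" and ?T'' = "ten (ctrg g)"
  let ?I = "unt (csrc f) \<cdot> bang A (src A a)" and ?u = "ult (body f) \<lhd> bang A (src A a)"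
    and ?I' = "unt (csrc g) \<cdot> bang A (src A a)" and ?v = "ult (body g) \<lhd> bang A (src A a)"
  have f: "(?F \<rhd> (lam (csrc f) \<lhd> a)) \<bullet> (?\<phi> \<lhd> \<langle>?I, a\<rangle>) \<bullet> (?T' \<rhd> \<llangle>?u, id2 (?F \<cdot> a)\<rrangle>) = lam (csrc g) \<lhd> (?F \<cdot> a)"
    using lax_unit_elem(1)[of f a] unfolding lax_lam_at_def Let_def by simp
  have Gf: "(?G \<rhd> ?F \<rhd> (lam (csrc f) \<lhd> a)) \<bullet> (?G \<rhd> (?\<phi> \<lhd> \<langle>?I, a\<rangle>)) \<bullet> (?G \<rhd> ?T' \<rhd> \<llangle>?u, id2 (?F \<cdot> a)\<rrangle>) =
      ?G \<rhd> (lam (csrc g) \<lhd> (?F \<cdot> a))"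
    unfolding f[symmetric] by (rule whisker_left_vcomp3[symmetric]) simp_all
  have g: "(?G \<rhd> (lam (csrc g) \<lhd> (?F \<cdot> a))) \<bullet> (?\<gamma> \<lhd> \<langle>?I', ?F \<cdot> a\<rangle>) \<bullet> (?T'' \<rhd> \<llangle>?v, id2 (?G \<cdot> ?F \<cdot> a)\<rrangle>) =
      lam (ctrg g) \<lhd> (?G \<cdot> ?F \<cdot> a)"
    using lax_unit_elem(1)[of g "?F \<cdot> a"] unfolding lax_lam_at_def Let_def by simp
  have n: "(?\<gamma> \<lhd> \<langle>?F \<cdot> ?I, ?F \<cdot> a\<rangle>) \<bullet> (?T'' \<rhd> \<llangle>?G \<rhd> ?u, id2 (?G \<cdot> ?F \<cdot> a)\<rrangle>) = (?G \<rhd> ?T' \<rhd> \<llangle>?u, id2 (?F \<cdot> a)\<rrangle>) \<bullet> (?\<gamma> \<lhd> \<langle>?I', ?F \<cdot> a\<rangle>)"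
    using mlt_natural[of g "?u" "id2 (?F \<cdot> a)"] by simp
  note paste = mon_comp1_unit_paste[OF _ _ _ _ _ _ _ _ Gf n g]
  show ?thesis
    unfolding lax_lam_at_def Let_def
    by (simp del: vcomp_assoc', rule paste) (simp_all add: hom2_iff)
qed

lemma mon_comp1_rho_at:
  assumes [simp]: "mon1_cell A f" "mon1_cell A g" "ctrg f = csrc g"
    and [simp]: "a \<in> cells1 A" "trg A a = car (csrc f)"
  shows "lax_rho_at (mon_comp1 A g f) a"
proof -
  let ?F = "und (body f)" and ?\<phi> = "mlt (body f)" and ?T = "ten (csrc f)" and ?T' = "ten (csrc g)"
  let ?G = "und (body g)" and ?\<gamma> = "mlt (body g)" and ?T'' = "ten (ctrg g)"
  let ?I = "unt (csrc f) \<cdot> bang A (src A a)" and ?u = "ult (body f) \<lhd> bang A (src A a)"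
    and ?I' = "unt (csrc g) \<cdot> bang A (src A a)" and ?v = "ult (body g) \<lhd> bang A (src A a)"
  have f: "(?F \<rhd> (rho (csrc f) \<lhd> a)) \<bullet> (?\<phi> \<lhd> \<langle>a, ?I\<rangle>) \<bullet> (?T' \<rhd> \<llangle>id2 (?F \<cdot> a), ?u\<rrangle>) = rho (csrc g) \<lhd> (?F \<cdot> a)"
    using lax_unit_elem(2)[of f a] unfolding lax_rho_at_def Let_def by simp
  have Gf: "(?G \<rhd> ?F \<rhd> (rho (csrc f) \<lhd> a)) \<bullet> (?G \<rhd> (?\<phi> \<lhd> \<langle>a, ?I\<rangle>)) \<bullet> (?G \<rhd> ?T' \<rhd> \<llangle>id2 (?F \<cdot> a), ?u\<rrangle>) =
      ?G \<rhd> (rho (csrc g) \<lhd> (?F \<cdot> a))"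
    unfolding f[symmetric] by (rule whisker_left_vcomp3[symmetric]) simp_all
  have g: "(?G \<rhd> (rho (csrc g) \<lhd> (?F \<cdot> a))) \<bullet> (?\<gamma> \<lhd> \<langle>?F \<cdot> a, ?I'\<rangle>) \<bullet> (?T'' \<rhd> \<llangle>id2 (?G \<cdot> ?F \<cdot> a), ?v\<rrangle>) =
      rho (ctrg g) \<lhd> (?G \<cdot> ?F \<cdot> a)"
    using lax_unit_elem(2)[of g "?F \<cdot> a"] unfolding lax_rho_at_def Let_def by simp
  have n: "(?\<gamma> \<lhd> \<langle>?F \<cdot> a, ?F \<cdot> ?I\<rangle>) \<bullet> (?T'' \<rhd> \<llangle>id2 (?G \<cdot> ?F \<cdot> a), ?G \<rhd> ?u\<rrangle>) = (?G \<rhd> ?T' \<rhd> \<llangle>id2 (?F \<cdot> a), ?u\<rrangle>) \<bullet> (?\<gamma> \<lhd> \<langle>?F \<cdot> a, ?I'\<rangle>)"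
    using mlt_natural[of g "id2 (?F \<cdot> a)" "?u"] by simp
  note paste = mon_comp1_unit_paste[OF _ _ _ _ _ _ _ _ Gf n g]
  show ?thesis
    unfolding lax_rho_at_def Let_def
    by (simp del: vcomp_assoc', rule paste) (simp_all add: hom2_iff)
qed

lemma mon_comp1_cell [simp]:
  assumes [simp]: "mon1_cell A f" "mon1_cell A g" "ctrg f = csrc g"
  shows "mon1_cell A (mon_comp1 A g f)"
proof (rule mon1_cellI)
  show "mlt (body (mon_comp1 A g f)) \<in> cells2 A"
    "Dom A (mlt (body (mon_comp1 A g f))) = ten (ctrg (mon_comp1 A g f)) \<cdot>
      \<langle>und (body (mon_comp1 A g f)) \<cdot> pr1 A (car (csrc (mon_comp1 A g f))) (car (csrc (mon_comp1 A g f))),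
       und (body (mon_comp1 A g f)) \<cdot> pr2 A (car (csrc (mon_comp1 A g f))) (car (csrc (mon_comp1 A g f)))\<rangle>"
    "Cod A (mlt (body (mon_comp1 A g f))) = und (body (mon_comp1 A g f)) \<cdot> ten (csrc (mon_comp1 A g f))"
    by (simp_all add: mlt_mon_comp1)
qed (simp_all add: mon_comp1_assoc_at mon_comp1_lam_at mon_comp1_rho_at)

lemma mon_id1_cell [simp]:
  assumes [simp]: "monoidal_object A M"
  shows "mon1_cell A (mon_id1 A M)"
  by (rule mon1_cellI) (simp_all add: mon_id1_def lax_assoc_at_def lax_lam_at_def lax_rho_at_def)

lemma mon_id1_sel [simp]:
  "csrc (mon_id1 A M) = M" "ctrg (mon_id1 A M) = M" "und (body (mon_id1 A M)) = id1 (car M)"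
  "mlt (body (mon_id1 A M)) = id2 (ten M)" "ult (body (mon_id1 A M)) = id2 (unt M)"
  by (simp_all add: mon_id1_def)

lemma mon1_eqI:
  assumes "csrc f = csrc g" "ctrg f = ctrg g" "und (body f) = und (body g)"
    "mlt (body f) = mlt (body g)" "ult (body f) = ult (body g)"
  shows "f = (g :: ('o, 'a, 'c) mon1)"
  using assms by (intro cell.expand lax_data.expand conjI) simp_all

lemma mon_comp1_id1 [simp]:
  assumes [simp]: "mon1_cell A f"
  shows "M = csrc f \<Longrightarrow> mon_comp1 A f (mon_id1 A M) = f"
    "M = ctrg f \<Longrightarrow> mon_comp1 A (mon_id1 A M) f = f"
  by (rule mon1_eqI; simp add: mlt_mon_comp1)+

lemma mon_comp1_assoc:
  assumes [simp]: "mon1_cell A f" "mon1_cell A g" "mon1_cell A h" "ctrg f = csrc g" "ctrg g = csrc h"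
  shows "mon_comp1 A (mon_comp1 A h g) f = mon_comp1 A h (mon_comp1 A g f)"
proof (rule mon1_eqI)
  let ?C = "car (csrc f)"
  have "mlt (body (mon_comp1 A (mon_comp1 A h g) f)) =
    (und (body h) \<rhd> und (body g) \<rhd> mlt (body f)) \<bullet>
    (mlt (body (mon_comp1 A h g)) \<lhd> \<langle>und (body f) \<cdot> pr1 A ?C ?C, und (body f) \<cdot> pr2 A ?C ?C\<rangle>)"
    by (simp add: mlt_mon_comp1[of "mon_comp1 A h g"])
  also have "\<dots> = mlt (body (mon_comp1 A h (mon_comp1 A g f)))"
    by (simp add: mlt_mon_comp1[of h "mon_comp1 A g f"] mlt_mon_comp1[of g f])
  finally show "mlt (body (mon_comp1 A (mon_comp1 A h g) f)) = mlt (body (mon_comp1 A h (mon_comp1 A g f)))" .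
qed simp_all

section \<open>Monoidal transformations\<close>

text \<open>Compatibility of a transformation with the multiplications, at generalised elements.\<close>

definition trans_at :: "('o, 'a, 'c) mon2 \<Rightarrow> 'a \<Rightarrow> 'a \<Rightarrow> bool" where
  "trans_at t a b \<longleftrightarrow> (let f = csrc t; g = ctrg t; \<tau> = body t in
     (\<tau> \<lhd> (ten (csrc f) \<cdot> \<langle>a, b\<rangle>)) \<bullet> (mlt (body f) \<lhd> \<langle>a, b\<rangle>) =
     (mlt (body g) \<lhd> \<langle>a, b\<rangle>) \<bullet> (ten (ctrg f) \<rhd> \<llangle>\<tau> \<lhd> a, \<tau> \<lhd> b\<rrangle>))"

lemma mon2_cell_csrc [simp]: "mon2_cell A t \<Longrightarrow> mon1_cell A (csrc t)"
  and mon2_cell_ctrg [simp]: "mon2_cell A t \<Longrightarrow> mon1_cell A (ctrg t)"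
  unfolding mon2_cell_def by blast+

lemma mon2_cell_parallel [simp]:
  assumes "mon2_cell A t"
  shows "csrc (ctrg t) = csrc (csrc t)" "ctrg (ctrg t) = ctrg (csrc t)"
  using assms unfolding mon2_cell_def by metis+

lemma mon2_cell_cell [simp]:
  assumes t: "mon2_cell A t"
  shows "body t \<in> cells2 A" "Dom A (body t) = und (body (csrc t))"
    "Cod A (body t) = und (body (ctrg t))"
    "src2 A (body t) = car (csrc (csrc t))" "trg2 A (body t) = car (ctrg (csrc t))"
proof -
  show 1: "body t \<in> cells2 A" "Dom A (body t) = und (body (csrc t))"
    "Cod A (body t) = und (body (ctrg t))"
    using t unfolding mon2_cell_def monoidal_transformation_def Let_def hom2_iff by blast+
  show "src2 A (body t) = car (csrc (csrc t))" "trg2 A (body t) = car (ctrg (csrc t))"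
    unfolding src2_def trg2_def 1 using t by simp_all
qed

lemma mon2_cell_unit:
  assumes "mon2_cell A t"
  shows "(body t \<lhd> unt (csrc (csrc t))) \<bullet> ult (body (csrc t)) = ult (body (ctrg t))"
  using assms unfolding mon2_cell_def monoidal_transformation_def Let_def by blast

lemma trans_elem:
  assumes t: "mon2_cell A t" and ab: "a \<in> cells1 A" "b \<in> cells1 A" "src A a = src A b"
    "trg A a = car (csrc (csrc t))" "trg A b = car (csrc (csrc t))"
  shows "trans_at t a b"
proof -
  let ?M = "csrc (csrc t)" and ?N = "ctrg (csrc t)" and ?\<tau> = "body t"
  let ?x = "pr1 A (car ?M) (car ?M)" and ?y = "pr2 A (car ?M) (car ?M)"
  have gen: "(?\<tau> \<lhd> ten ?M \<cdot> \<langle>?x, ?y\<rangle>) \<bullet> mlt (body (csrc t)) =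
      mlt (body (ctrg t)) \<bullet> (ten ?N \<rhd> \<llangle>?\<tau> \<lhd> ?x, ?\<tau> \<lhd> ?y\<rrangle>)"
    using t unfolding mon2_cell_def monoidal_transformation_def Let_def vars2_def prod.case
      ap1_def ap2_def by blast
  have "(?\<tau> \<lhd> (ten ?M \<cdot> \<langle>a, b\<rangle>)) \<bullet> (mlt (body (csrc t)) \<lhd> \<langle>a, b\<rangle>) =
      ((?\<tau> \<lhd> ten ?M \<cdot> \<langle>?x, ?y\<rangle>) \<bullet> mlt (body (csrc t))) \<lhd> \<langle>a, b\<rangle>"
    using t ab by simp
  also have "\<dots> = (mlt (body (ctrg t)) \<lhd> \<langle>a, b\<rangle>) \<bullet> (ten ?N \<rhd> \<llangle>?\<tau> \<lhd> a, ?\<tau> \<lhd> b\<rrangle>)"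
    unfolding gen using t ab by simp
  finally show ?thesis by (simp add: trans_at_def Let_def)
qed

lemma mon2_cellI:
  assumes [simp]: "mon1_cell A (csrc t)" "mon1_cell A (ctrg t)" "csrc (ctrg t) = csrc (csrc t)"
      "ctrg (ctrg t) = ctrg (csrc t)" "body t \<in> cells2 A" "Dom A (body t) = und (body (csrc t))"
      "Cod A (body t) = und (body (ctrg t))"
    and mult: "\<And>a b. \<lbrakk>a \<in> cells1 A; b \<in> cells1 A; src A a = src A b; trg A a = car (csrc (csrc t));
        trg A b = car (csrc (csrc t))\<rbrakk> \<Longrightarrow> trans_at t a b"
    and unit: "(body t \<lhd> unt (csrc (csrc t))) \<bullet> ult (body (csrc t)) = ult (body (ctrg t))"
  shows "mon2_cell A t"
proof -
  let ?C = "car (csrc (csrc t))"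
  have [simp]: "src2 A (body t) = ?C" "trg2 A (body t) = car (ctrg (csrc t))"
    unfolding src2_def trg2_def by simp_all
  have "trans_at t (pr1 A ?C ?C) (pr2 A ?C ?C)"
    by (rule mult) simp_all
  then have "(body t \<lhd> ap1 A (ten (csrc (csrc t))) (pr1 A ?C ?C) (pr2 A ?C ?C)) \<bullet> mlt (body (csrc t)) =
      mlt (body (ctrg t)) \<bullet> ap2 A (ten (ctrg (csrc t))) (body t \<lhd> pr1 A ?C ?C) (body t \<lhd> pr2 A ?C ?C)"
    by (simp add: trans_at_def ap1_def ap2_def Let_def)
  then show ?thesis
    unfolding mon2_cell_def monoidal_transformation_def Let_def vars2_def prod.case hom2_iff
    using unit by simp
qed

lemma mon2_id2_cell:
  assumes [simp]: "mon1_cell A f"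
  shows "mon2_cell A (Cell f f (id2 (und (body f))))"
  by (rule mon2_cellI) (simp_all add: trans_at_def Let_def)

lemma mon2_vcomp_cell:
  assumes [simp]: "mon2_cell A s" "mon2_cell A t" "ctrg s = csrc t"
  shows "mon2_cell A (Cell (csrc s) (ctrg t) (body t \<bullet> body s))"
proof -
  have [simp]: "csrc (csrc t) = csrc (csrc s)" "ctrg (csrc t) = ctrg (csrc s)"
    using mon2_cell_parallel[of s] by simp_all
  let ?M = "csrc (csrc s)" and ?N = "ctrg (csrc s)"
  have "trans_at (Cell (csrc s) (ctrg t) (body t \<bullet> body s)) a b"
    if [simp]: "a \<in> cells1 A" "b \<in> cells1 A" "src A a = src A b" "trg A a = car ?M" "trg A b = car ?M" for a b
  proof -
    have s: "(body s \<lhd> ten ?M \<cdot> \<langle>a, b\<rangle>) \<bullet> (mlt (body (csrc s)) \<lhd> \<langle>a, b\<rangle>) =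
        (mlt (body (csrc t)) \<lhd> \<langle>a, b\<rangle>) \<bullet> (ten ?N \<rhd> \<llangle>body s \<lhd> a, body s \<lhd> b\<rrangle>)"
      using trans_elem[of s a b] by (simp add: trans_at_def Let_def)
    have t: "(body t \<lhd> ten ?M \<cdot> \<langle>a, b\<rangle>) \<bullet> (mlt (body (csrc t)) \<lhd> \<langle>a, b\<rangle>) =
        (mlt (body (ctrg t)) \<lhd> \<langle>a, b\<rangle>) \<bullet> (ten ?N \<rhd> \<llangle>body t \<lhd> a, body t \<lhd> b\<rrangle>)"
      using trans_elem[of t a b] by (simp add: trans_at_def Let_def)
    have "((body t \<bullet> body s) \<lhd> ten ?M \<cdot> \<langle>a, b\<rangle>) \<bullet> (mlt (body (csrc s)) \<lhd> \<langle>a, b\<rangle>) =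
        (body t \<lhd> ten ?M \<cdot> \<langle>a, b\<rangle>) \<bullet> (body s \<lhd> ten ?M \<cdot> \<langle>a, b\<rangle>) \<bullet> (mlt (body (csrc s)) \<lhd> \<langle>a, b\<rangle>)"
      by simp
    also have "\<dots> = ((body t \<lhd> ten ?M \<cdot> \<langle>a, b\<rangle>) \<bullet> (mlt (body (csrc t)) \<lhd> \<langle>a, b\<rangle>)) \<bullet>
        (ten ?N \<rhd> \<llangle>body s \<lhd> a, body s \<lhd> b\<rrangle>)"
      unfolding s by simp
    also have "\<dots> = (mlt (body (ctrg t)) \<lhd> \<langle>a, b\<rangle>) \<bullet>
        (ten ?N \<rhd> (\<llangle>body t \<lhd> a, body t \<lhd> b\<rrangle> \<bullet> \<llangle>body s \<lhd> a, body s \<lhd> b\<rrangle>))"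
      unfolding t by simp
    also have "\<dots> = (mlt (body (ctrg t)) \<lhd> \<langle>a, b\<rangle>) \<bullet>
        (ten ?N \<rhd> \<llangle>(body t \<bullet> body s) \<lhd> a, (body t \<bullet> body s) \<lhd> b\<rrangle>)"
      by (subst pair2_vcomp) simp_all
    finally show ?thesis by (simp add: trans_at_def Let_def)
  qed
  moreover have "((body t \<bullet> body s) \<lhd> unt ?M) \<bullet> ult (body (csrc s)) = ult (body (ctrg t))"
    using mon2_cell_unit[of s] mon2_cell_unit[of t] by simp
  ultimately show ?thesis
    by (intro mon2_cellI) simp_all
qed

text \<open>The pasting that proves monoidality of a horizontal composite \<open>\<sigma> \<ast> \<tau>\<close>: \<open>1\<close> and \<open>4\<close> are
  monoidality of \<open>\<tau>\<close> (under \<open>G\<close>) and of \<open>\<sigma>\<close>, \<open>2\<close> and \<open>3\<close> are naturality of \<open>\<sigma>\<close> and of the multiplication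
  of \<open>G\<close>.\<close>

lemma mon2_hcomp_paste:
  assumes "r1 \<in> hom2 A x3 x4" "r2 \<in> hom2 A x2 x3" "r3 \<in> hom2 A x1 x2" "r4 \<in> hom2 A x0 x1"
    "r5 \<in> hom2 A y2 x3" "r6 \<in> hom2 A x1 y2" "r7 \<in> hom2 A z2 x4" "r8 \<in> hom2 A y2 z2"
    "r9 \<in> hom2 A y1 y2" "r10 \<in> hom2 A x0 y1" "r11 \<in> hom2 A z1 z2" "r12 \<in> hom2 A y1 z1"
    and 1: "r2 \<bullet> r3 = r5 \<bullet> r6" and 2: "r1 \<bullet> r5 = r7 \<bullet> r8" and 3: "r9 \<bullet> r10 = r6 \<bullet> r4"
    and 4: "r8 \<bullet> r9 = r11 \<bullet> r12"
  shows "(r1 \<bullet> r2) \<bullet> (r3 \<bullet> r4) = (r7 \<bullet> r11) \<bullet> (r12 \<bullet> r10)"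
proof -
  note [simp] = assms(1-12)[unfolded hom2_iff]
  have "(r1 \<bullet> r2) \<bullet> (r3 \<bullet> r4) = r1 \<bullet> (r2 \<bullet> r3) \<bullet> r4" by simp
  also have "\<dots> = (r1 \<bullet> r5) \<bullet> (r6 \<bullet> r4)" unfolding 1 by simp
  also have "\<dots> = r7 \<bullet> (r8 \<bullet> r9) \<bullet> r10" unfolding 2 3[symmetric] by simp
  also have "\<dots> = (r7 \<bullet> r11) \<bullet> (r12 \<bullet> r10)" unfolding 4 by simp
  finally show ?thesis .
qed

lemma mon2_hcomp_cell:
  assumes [simp]: "mon2_cell A s" "mon2_cell A t" and st: "csrc (csrc t) = ctrg (csrc s)"
  shows "mon2_cell A (Cell (mon_comp1 A (csrc t) (csrc s)) (mon_comp1 A (ctrg t) (ctrg s))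
    (body t \<ast> body s))"
proof -
  note [simp] = st[symmetric]
  let ?M = "csrc (csrc s)" and ?N = "csrc (csrc t)" and ?P = "ctrg (csrc t)"
  let ?f = "csrc s" and ?f' = "ctrg s" and ?g = "csrc t" and ?g' = "ctrg t"
  let ?F = "und (body ?f)" and ?F' = "und (body ?f')" and ?G = "und (body ?g)" and ?G' = "und (body ?g')"
  let ?\<phi> = "mlt (body ?f)" and ?\<phi>' = "mlt (body ?f')" and ?\<gamma> = "mlt (body ?g)" and ?\<gamma>' = "mlt (body ?g')"
  let ?\<tau> = "body s" and ?\<sigma> = "body t"
  have comp: "(?\<sigma> \<ast> ?\<tau>) \<lhd> c = (?\<sigma> \<lhd> ?F' \<cdot> c) \<bullet> (?G \<rhd> (?\<tau> \<lhd> c))"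
    if [simp]: "c \<in> cells1 A" "trg A c = car ?M" for c
    by (simp add: hcomp_whisker)
  have "trans_at (Cell (mon_comp1 A ?g ?f) (mon_comp1 A ?g' ?f') (?\<sigma> \<ast> ?\<tau>)) a b"
    if [simp]: "a \<in> cells1 A" "b \<in> cells1 A" "src A a = src A b" "trg A a = car ?M" "trg A b = car ?M" for a b
  proof -
    let ?ab = "ten ?M \<cdot> \<langle>a, b\<rangle>"
    have s: "(?\<tau> \<lhd> ?ab) \<bullet> (?\<phi> \<lhd> \<langle>a, b\<rangle>) = (?\<phi>' \<lhd> \<langle>a, b\<rangle>) \<bullet> (ten ?N \<rhd> \<llangle>?\<tau> \<lhd> a, ?\<tau> \<lhd> b\<rrangle>)"
      using trans_elem[of s a b] by (simp add: trans_at_def Let_def)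
    have "?G \<rhd> ((?\<tau> \<lhd> ?ab) \<bullet> (?\<phi> \<lhd> \<langle>a, b\<rangle>)) = ?G \<rhd> ((?\<phi>' \<lhd> \<langle>a, b\<rangle>) \<bullet> (ten ?N \<rhd> \<llangle>?\<tau> \<lhd> a, ?\<tau> \<lhd> b\<rrangle>))"
      unfolding s ..
    then have Gs: "(?G \<rhd> (?\<tau> \<lhd> ?ab)) \<bullet> (?G \<rhd> (?\<phi> \<lhd> \<langle>a, b\<rangle>)) =
        (?G \<rhd> (?\<phi>' \<lhd> \<langle>a, b\<rangle>)) \<bullet> (?G \<rhd> ten ?N \<rhd> \<llangle>?\<tau> \<lhd> a, ?\<tau> \<lhd> b\<rrangle>)"
      by simp
    have t: "(?\<sigma> \<lhd> ten ?N \<cdot> \<langle>?F' \<cdot> a, ?F' \<cdot> b\<rangle>) \<bullet> (?\<gamma> \<lhd> \<langle>?F' \<cdot> a, ?F' \<cdot> b\<rangle>) =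
        (?\<gamma>' \<lhd> \<langle>?F' \<cdot> a, ?F' \<cdot> b\<rangle>) \<bullet> (ten ?P \<rhd> \<llangle>?\<sigma> \<lhd> ?F' \<cdot> a, ?\<sigma> \<lhd> ?F' \<cdot> b\<rrangle>)"
      using trans_elem[of t "?F' \<cdot> a" "?F' \<cdot> b"] by (simp add: trans_at_def Let_def)
    have n1: "(?\<sigma> \<lhd> ?F' \<cdot> ?ab) \<bullet> (?G \<rhd> (?\<phi>' \<lhd> \<langle>a, b\<rangle>)) =
        (?G' \<rhd> (?\<phi>' \<lhd> \<langle>a, b\<rangle>)) \<bullet> (?\<sigma> \<lhd> ten ?N \<cdot> \<langle>?F' \<cdot> a, ?F' \<cdot> b\<rangle>)"
      using whisker_exchange[of "?\<phi>' \<lhd> \<langle>a, b\<rangle>" ?\<sigma>] by simp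
    have n2: "(?\<gamma> \<lhd> \<langle>?F' \<cdot> a, ?F' \<cdot> b\<rangle>) \<bullet> (ten ?P \<rhd> \<llangle>?G \<rhd> (?\<tau> \<lhd> a), ?G \<rhd> (?\<tau> \<lhd> b)\<rrangle>) =
        (?G \<rhd> ten ?N \<rhd> \<llangle>?\<tau> \<lhd> a, ?\<tau> \<lhd> b\<rrangle>) \<bullet> (?\<gamma> \<lhd> \<langle>?F \<cdot> a, ?F \<cdot> b\<rangle>)"
      using mlt_natural[of ?g "?\<tau> \<lhd> a" "?\<tau> \<lhd> b"] by simp
    have "((?\<sigma> \<lhd> ?F' \<cdot> ?ab) \<bullet> (?G \<rhd> (?\<tau> \<lhd> ?ab))) \<bullet> ((?G \<rhd> (?\<phi> \<lhd> \<langle>a, b\<rangle>)) \<bullet> (?\<gamma> \<lhd> \<langle>?F \<cdot> a, ?F \<cdot> b\<rangle>)) =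
      ((?G' \<rhd> (?\<phi>' \<lhd> \<langle>a, b\<rangle>)) \<bullet> (?\<gamma>' \<lhd> \<langle>?F' \<cdot> a, ?F' \<cdot> b\<rangle>)) \<bullet>
      ((ten ?P \<rhd> \<llangle>?\<sigma> \<lhd> ?F' \<cdot> a, ?\<sigma> \<lhd> ?F' \<cdot> b\<rrangle>) \<bullet> (ten ?P \<rhd> \<llangle>?G \<rhd> (?\<tau> \<lhd> a), ?G \<rhd> (?\<tau> \<lhd> b)\<rrangle>))"
      by (rule mon2_hcomp_paste[OF _ _ _ _ _ _ _ _ _ _ _ _ Gs n1 n2 t]) (simp_all add: hom2_iff)
    also have "(ten ?P \<rhd> \<llangle>?\<sigma> \<lhd> ?F' \<cdot> a, ?\<sigma> \<lhd> ?F' \<cdot> b\<rrangle>) \<bullet> (ten ?P \<rhd> \<llangle>?G \<rhd> (?\<tau> \<lhd> a), ?G \<rhd> (?\<tau> \<lhd> b)\<rrangle>) =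
      ten ?P \<rhd> (\<llangle>?\<sigma> \<lhd> ?F' \<cdot> a, ?\<sigma> \<lhd> ?F' \<cdot> b\<rrangle> \<bullet> \<llangle>?G \<rhd> (?\<tau> \<lhd> a), ?G \<rhd> (?\<tau> \<lhd> b)\<rrangle>)"
      by simp
    also have "\<llangle>?\<sigma> \<lhd> ?F' \<cdot> a, ?\<sigma> \<lhd> ?F' \<cdot> b\<rrangle> \<bullet> \<llangle>?G \<rhd> (?\<tau> \<lhd> a), ?G \<rhd> (?\<tau> \<lhd> b)\<rrangle> =
      \<llangle>(?\<sigma> \<ast> ?\<tau>) \<lhd> a, (?\<sigma> \<ast> ?\<tau>) \<lhd> b\<rrangle>"
      by (subst pair2_vcomp) (simp_all add: comp)
    finally show ?thesis
      by (simp add: trans_at_def Let_def comp del: vcomp_assoc')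
  qed
  moreover have "((?\<sigma> \<ast> ?\<tau>) \<lhd> unt ?M) \<bullet> ((?G \<rhd> ult (body ?f)) \<bullet> ult (body ?g)) =
      (?G' \<rhd> ult (body ?f')) \<bullet> ult (body ?g')"
  proof -
    have "((?\<sigma> \<ast> ?\<tau>) \<lhd> unt ?M) \<bullet> ((?G \<rhd> ult (body ?f)) \<bullet> ult (body ?g)) =
      (?\<sigma> \<lhd> ?F' \<cdot> unt ?M) \<bullet> (?G \<rhd> ((?\<tau> \<lhd> unt ?M) \<bullet> ult (body ?f))) \<bullet> ult (body ?g)"
      by (simp add: comp)
    also have "\<dots> = ((?\<sigma> \<lhd> ?F' \<cdot> unt ?M) \<bullet> (?G \<rhd> ult (body ?f'))) \<bullet> ult (body ?g)"
      unfolding mon2_cell_unit[OF assms(1)] by simp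
    also have "(?\<sigma> \<lhd> ?F' \<cdot> unt ?M) \<bullet> (?G \<rhd> ult (body ?f')) =
        (?G' \<rhd> ult (body ?f')) \<bullet> (?\<sigma> \<lhd> unt ?N)"
      using whisker_exchange[of "ult (body ?f')" ?\<sigma>] by simp
    also have "((?G' \<rhd> ult (body ?f')) \<bullet> (?\<sigma> \<lhd> unt ?N)) \<bullet> ult (body ?g) =
        (?G' \<rhd> ult (body ?f')) \<bullet> ((?\<sigma> \<lhd> unt ?N) \<bullet> ult (body ?g))" by simp
    finally show ?thesis unfolding mon2_cell_unit[OF assms(2)] .
  qed
  ultimately show ?thesis
    by (intro mon2_cellI) simp_all
qed

lemma Mon_l_sel [simp]:
  "cells0 (Mon_l A) = {M. monoidal_object A M}" "cells1 (Mon_l A) = {f. mon1_cell A f}"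
  "cells2 (Mon_l A) = {t. mon2_cell A t}" "src (Mon_l A) = csrc" "trg (Mon_l A) = ctrg"
  "Dom (Mon_l A) = csrc" "Cod (Mon_l A) = ctrg" "idn1 (Mon_l A) = mon_id1 A"
  "idn2 (Mon_l A) f = Cell f f (id2 (und (body f)))"
  "comp1 (Mon_l A) = mon_comp1 A"
  "vcomp (Mon_l A) t s = Cell (csrc s) (ctrg t) (body t \<bullet> body s)"
  "hcomp (Mon_l A) t s = Cell (mon_comp1 A (csrc t) (csrc s)) (mon_comp1 A (ctrg t) (ctrg s))
     (body t \<ast> body s)"
  by (simp_all add: Mon_l_def)

theorem two_category_Mon_l: "two_category (Mon_l A)"
proof (rule two_categoryI)
  fix t assume "t \<in> cells2 (Mon_l A)"
  then have [simp]: "mon2_cell A t" by simp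
  have "body t \<ast> id2 (id1 (car (csrc (csrc t)))) = body t"
    "id2 (id1 (car (ctrg (csrc t)))) \<ast> body t = body t"
    using whisker_right_id1[of "body t"] whisker_left_id1[of "body t"]
    by (simp_all add: whisker_right_def whisker_left_def)
  then show "t \<ast>\<^bsub>Mon_l A\<^esub> id2\<^bsub>Mon_l A\<^esub> (id1\<^bsub>Mon_l A\<^esub> (src (Mon_l A) (Dom (Mon_l A) t))) = t \<and>
      id2\<^bsub>Mon_l A\<^esub> (id1\<^bsub>Mon_l A\<^esub> (trg (Mon_l A) (Dom (Mon_l A) t))) \<ast>\<^bsub>Mon_l A\<^esub> t = t"
    by (simp add: cell.expand)
next
  fix f g assume "f \<in> cells1 (Mon_l A)" "g \<in> cells1 (Mon_l A)" "src (Mon_l A) g = trg (Mon_l A) f"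
  then show "id2\<^bsub>Mon_l A\<^esub> g \<ast>\<^bsub>Mon_l A\<^esub> id2\<^bsub>Mon_l A\<^esub> f = id2\<^bsub>Mon_l A\<^esub> (g \<cdot>\<^bsub>Mon_l A\<^esub> f)"
    using hcomp_id2'[of "und (body f)" "und (body g)"] by simp
qed (simp_all add: mon2_id2_cell mon2_vcomp_cell mon2_hcomp_cell mon_comp1_assoc cell.expand
  hcomp_assoc' interchange')

end

section \<open>Lax slices\<close>

context two_category
begin

context
  fixes m :: 'o
begin

lemma slice0_cell_cell:
  assumes "slice0_cell A m b"
  shows "b \<in> cells1 A" "trg A b = m"
  using assms by (simp_all add: slice0_cell_def)

lemma slice1_cell_ends:
  assumes "slice1_cell A m f"
  shows "slice0_cell A m (csrc f)" "slice0_cell A m (ctrg f)"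
  using assms by (simp_all add: slice1_cell_def Let_def split_def)

lemma slice1_cell_cell:
  assumes f: "slice1_cell A m f"
  shows "csrc f \<in> cells1 A" "trg A (csrc f) = m" "ctrg f \<in> cells1 A" "trg A (ctrg f) = m"
    "fst (body f) \<in> cells1 A" "src A (fst (body f)) = src A (csrc f)"
    "trg A (fst (body f)) = src A (ctrg f)"
    "snd (body f) \<in> cells2 A" "Dom A (snd (body f)) = ctrg f \<cdot> fst (body f)"
    "Cod A (snd (body f)) = csrc f" "src2 A (snd (body f)) = src A (csrc f)" "trg2 A (snd (body f)) = m"
proof -
  show 1: "csrc f \<in> cells1 A" "trg A (csrc f) = m" "ctrg f \<in> cells1 A" "trg A (ctrg f) = m"
    "fst (body f) \<in> cells1 A" "src A (fst (body f)) = src A (csrc f)"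
    "trg A (fst (body f)) = src A (ctrg f)"
    "snd (body f) \<in> cells2 A" "Dom A (snd (body f)) = ctrg f \<cdot> fst (body f)"
    "Cod A (snd (body f)) = csrc f"
    using f by (auto simp: slice1_cell_def slice0_cell_def Let_def split_def hom1_iff hom2_iff)
  show "src2 A (snd (body f)) = src A (csrc f)" "trg2 A (snd (body f)) = m"
    unfolding src2_def trg2_def 1(9) using 1(1-7) by simp_all
qed

lemma slice2_cell_cell:
  assumes t: "slice2_cell A m t"
  shows "slice1_cell A m (csrc t)" "slice1_cell A m (ctrg t)"
    "csrc (ctrg t) = csrc (csrc t)" "ctrg (ctrg t) = ctrg (csrc t)"
    "body t \<in> cells2 A" "Dom A (body t) = fst (body (csrc t))" "Cod A (body t) = fst (body (ctrg t))"
    "src2 A (body t) = src A (csrc (csrc t))" "trg2 A (body t) = src A (ctrg (csrc t))"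
proof -
  show 1: "slice1_cell A m (csrc t)" "slice1_cell A m (ctrg t)"
    "csrc (ctrg t) = csrc (csrc t)" "ctrg (ctrg t) = ctrg (csrc t)"
    "body t \<in> cells2 A" "Dom A (body t) = fst (body (csrc t))" "Cod A (body t) = fst (body (ctrg t))"
    using t by (auto simp: slice2_cell_def Let_def split_def hom2_iff)
  show "src2 A (body t) = src A (csrc (csrc t))" "trg2 A (body t) = src A (ctrg (csrc t))"
    unfolding src2_def trg2_def 1(6) using slice1_cell_cell[OF 1(1)] by simp_all
qed

lemma slice2_cell_eq:
  assumes "slice2_cell A m t"
  shows "snd (body (ctrg t)) \<bullet> (ctrg (csrc t) \<rhd> body t) = snd (body (csrc t))"
  using assms unfolding slice2_cell_def Let_def split_def by blast

lemma slice1_cellI: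
  assumes "slice0_cell A m (csrc f)" "slice0_cell A m (ctrg f)"
    "fst (body f) \<in> cells1 A" "src A (fst (body f)) = src A (csrc f)"
    "trg A (fst (body f)) = src A (ctrg f)"
    "snd (body f) \<in> cells2 A" "Dom A (snd (body f)) = ctrg f \<cdot> fst (body f)"
    "Cod A (snd (body f)) = csrc f"
  shows "slice1_cell A m f"
  using assms by (simp add: slice1_cell_def Let_def split_def hom1_iff hom2_iff)

lemma slice2_cellI:
  assumes "slice1_cell A m (csrc t)" "slice1_cell A m (ctrg t)"
    "csrc (ctrg t) = csrc (csrc t)" "ctrg (ctrg t) = ctrg (csrc t)"
    "body t \<in> cells2 A" "Dom A (body t) = fst (body (csrc t))" "Cod A (body t) = fst (body (ctrg t))"
    "snd (body (ctrg t)) \<bullet> (ctrg (csrc t) \<rhd> body t) = snd (body (csrc t))"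
  shows "slice2_cell A m t"
  using assms by (simp add: slice2_cell_def Let_def split_def hom2_iff)

lemma slice_comp1_sel [simp]:
  "csrc (slice_comp1 A g f) = csrc f" "ctrg (slice_comp1 A g f) = ctrg g"
  "fst (body (slice_comp1 A g f)) = fst (body g) \<cdot> fst (body f)"
  "snd (body (slice_comp1 A g f)) = snd (body f) \<bullet> (snd (body g) \<lhd> fst (body f))"
  by (simp_all add: slice_comp1_def split_def Let_def)

lemma lax_slice_sel [simp]:
  "cells0 (lax_slice A m) = {b. slice0_cell A m b}" "cells1 (lax_slice A m) = {f. slice1_cell A m f}"
  "cells2 (lax_slice A m) = {t. slice2_cell A m t}" "src (lax_slice A m) = csrc"
  "trg (lax_slice A m) = ctrg" "Dom (lax_slice A m) = csrc" "Cod (lax_slice A m) = ctrg"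
  "idn1 (lax_slice A m) b = Cell b b (id1 (src A b), id2 b)"
  "idn2 (lax_slice A m) f = Cell f f (id2 (fst (body f)))"
  "comp1 (lax_slice A m) = slice_comp1 A"
  "vcomp (lax_slice A m) t s = Cell (csrc s) (ctrg t) (body t \<bullet> body s)"
  "hcomp (lax_slice A m) t s = Cell (slice_comp1 A (csrc t) (csrc s)) (slice_comp1 A (ctrg t) (ctrg s))
     (body t \<ast> body s)"
  by (simp_all add: lax_slice_def)

lemma slice1_eqI:
  assumes "csrc f = csrc g" "ctrg f = ctrg g" "fst (body f) = fst (body g)" "snd (body f) = snd (body g)"
  shows "f = (g :: ('a, 'c) slice1)"
  using assms by (intro cell.expand conjI prod_eqI) simp_all

lemma slice_comp1_id1:
  assumes f: "slice1_cell A m f"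
  shows "slice_comp1 A f (Cell (csrc f) (csrc f) (id1 (src A (csrc f)), id2 (csrc f))) = f"
    "slice_comp1 A (Cell (ctrg f) (ctrg f) (id1 (src A (ctrg f)), id2 (ctrg f))) f = f"
  using slice1_cell_cell[OF f] by - (intro slice1_eqI; simp)+

lemma slice_comp1_assoc:
  assumes f: "slice1_cell A m f" and g: "slice1_cell A m g" and h: "slice1_cell A m h"
    and c: "csrc g = ctrg f" "csrc h = ctrg g"
  shows "slice_comp1 A (slice_comp1 A h g) f = slice_comp1 A h (slice_comp1 A g f)"
  using slice1_cell_cell[OF f] slice1_cell_cell[OF g] slice1_cell_cell[OF h] c
  by (intro slice1_eqI) simp_all

lemma slice_comp1_cell:
  assumes f: "slice1_cell A m f" and g: "slice1_cell A m g" and gf: "csrc g = ctrg f"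
  shows "slice1_cell A m (slice_comp1 A g f)"
  by (rule slice1_cellI)
    (use slice1_cell_ends[OF f] slice1_cell_ends[OF g] slice1_cell_cell[OF f] slice1_cell_cell[OF g] gf
      in simp_all)

lemma slice_vcomp_cell:
  assumes s: "slice2_cell A m s" and t: "slice2_cell A m t" and ts: "csrc t = ctrg s"
  shows "slice2_cell A m (Cell (csrc s) (ctrg t) (body t \<bullet> body s))"
proof (rule slice2_cellI)
  note [simp] = slice2_cell_cell[OF s] slice2_cell_cell[OF t] ts
    slice1_cell_cell[OF slice2_cell_cell(1)[OF s]] slice1_cell_cell[OF slice2_cell_cell(2)[OF s]]
    slice1_cell_cell[OF slice2_cell_cell(2)[OF t]]
  let ?c = "ctrg (csrc s)"
  have "snd (body (ctrg t)) \<bullet> (?c \<rhd> (body t \<bullet> body s)) =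
      (snd (body (ctrg t)) \<bullet> (?c \<rhd> body t)) \<bullet> (?c \<rhd> body s)"
    using s t by simp
  also have "\<dots> = snd (body (csrc s))"
    using slice2_cell_eq[OF s] slice2_cell_eq[OF t] by simp
  finally show "snd (body (ctrg (Cell (csrc s) (ctrg t) (body t \<bullet> body s)))) \<bullet>
    (ctrg (csrc (Cell (csrc s) (ctrg t) (body t \<bullet> body s))) \<rhd> body (Cell (csrc s) (ctrg t) (body t \<bullet> body s))) =
    snd (body (csrc (Cell (csrc s) (ctrg t) (body t \<bullet> body s))))"
    by simp
qed (use slice2_cell_cell[OF s] slice2_cell_cell[OF t] ts in simp_all)

text \<open>After interchange the triangle of \<open>t\<close> can be contracted first, and the triangle of \<open>s\<close> once
  \<open>body s\<close> has been moved past the 2-cell of \<open>csrc t\<close>.\<close>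

lemma slice_hcomp_cell:
  assumes s: "slice2_cell A m s" and t: "slice2_cell A m t" and ts: "csrc (csrc t) = ctrg (csrc s)"
  shows "slice2_cell A m (Cell (slice_comp1 A (csrc t) (csrc s)) (slice_comp1 A (ctrg t) (ctrg s))
    (body t \<ast> body s))"
proof -
  note [simp] = slice2_cell_cell[OF s] slice2_cell_cell[OF t] ts
    slice1_cell_cell[OF slice2_cell_cell(1)[OF s]] slice1_cell_cell[OF slice2_cell_cell(2)[OF s]]
    slice1_cell_cell[OF slice2_cell_cell(1)[OF t]] slice1_cell_cell[OF slice2_cell_cell(2)[OF t]]
  let ?b = "ctrg (csrc s)" and ?c = "ctrg (csrc t)"
  let ?F = "fst (body (csrc s))" and ?F' = "fst (body (ctrg s))"
  let ?\<theta> = "snd (body (csrc s))" and ?\<theta>' = "snd (body (ctrg s))"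
  let ?\<kappa> = "snd (body (csrc t))" and ?\<kappa>' = "snd (body (ctrg t))"
  have "(?\<theta>' \<bullet> (?\<kappa>' \<lhd> ?F')) \<bullet> (?c \<rhd> (body t \<ast> body s)) =
      ?\<theta>' \<bullet> (?\<kappa>' \<bullet> (?c \<rhd> body t)) \<lhd> ?F' \<bullet> (?c \<rhd> fst (body (csrc t)) \<rhd> body s)"
    by (simp add: hcomp_whisker)
  also have "\<dots> = ?\<theta>' \<bullet> (?\<kappa> \<lhd> ?F') \<bullet> (?c \<rhd> fst (body (csrc t)) \<rhd> body s)"
    unfolding slice2_cell_eq[OF t] ..
  also have "(?\<kappa> \<lhd> ?F') \<bullet> (?c \<rhd> fst (body (csrc t)) \<rhd> body s) = (?b \<rhd> body s) \<bullet> (?\<kappa> \<lhd> ?F)"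
    using whisker_exchange[of "body s" ?\<kappa>] by simp
  also have "?\<theta>' \<bullet> (?b \<rhd> body s) \<bullet> (?\<kappa> \<lhd> ?F) = (?\<theta>' \<bullet> (?b \<rhd> body s)) \<bullet> (?\<kappa> \<lhd> ?F)"
    by simp
  also have "\<dots> = ?\<theta> \<bullet> (?\<kappa> \<lhd> ?F)"
    unfolding slice2_cell_eq[OF s] ..
  finally show ?thesis
    by (intro slice2_cellI) (simp_all add: slice_comp1_cell del: vcomp_assoc')
qed

theorem two_category_lax_slice: "two_category (lax_slice A m)"
proof (rule two_categoryI)
  fix f assume "f \<in> cells1 (lax_slice A m)"
  then have f: "slice1_cell A m f" by simp
  show "src (lax_slice A m) f \<in> cells0 (lax_slice A m) \<and> trg (lax_slice A m) f \<in> cells0 (lax_slice A m)"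
    using slice1_cell_ends[OF f] by simp
  show "f \<cdot>\<^bsub>lax_slice A m\<^esub> id1\<^bsub>lax_slice A m\<^esub> (src (lax_slice A m) f) = f \<and>
      id1\<^bsub>lax_slice A m\<^esub> (trg (lax_slice A m) f) \<cdot>\<^bsub>lax_slice A m\<^esub> f = f"
    using slice_comp1_id1[OF f] by simp
  show "id2\<^bsub>lax_slice A m\<^esub> f \<in> cells2 (lax_slice A m) \<and>
      Dom (lax_slice A m) (id2\<^bsub>lax_slice A m\<^esub> f) = f \<and> Cod (lax_slice A m) (id2\<^bsub>lax_slice A m\<^esub> f) = f"
    using slice1_cell_cell[OF f] f by (simp add: slice2_cellI)
next
  fix t assume "t \<in> cells2 (lax_slice A m)"
  then have t: "slice2_cell A m t" by simp
  note t' = slice2_cell_cell[OF t]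
  show "Dom (lax_slice A m) t \<in> cells1 (lax_slice A m) \<and> Cod (lax_slice A m) t \<in> cells1 (lax_slice A m) \<and>
      src (lax_slice A m) (Cod (lax_slice A m) t) = src (lax_slice A m) (Dom (lax_slice A m) t) \<and>
      trg (lax_slice A m) (Cod (lax_slice A m) t) = trg (lax_slice A m) (Dom (lax_slice A m) t)"
    using t' by simp
  show "t \<bullet>\<^bsub>lax_slice A m\<^esub> id2\<^bsub>lax_slice A m\<^esub> (Dom (lax_slice A m) t) = t \<and>
      id2\<^bsub>lax_slice A m\<^esub> (Cod (lax_slice A m) t) \<bullet>\<^bsub>lax_slice A m\<^esub> t = t"
    using t' by (simp add: cell.expand)
  have "body t \<ast> id2 (id1 (src A (csrc (csrc t)))) = body t"
    "id2 (id1 (src A (ctrg (csrc t)))) \<ast> body t = body t"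
    using whisker_right_id1[of "body t"] whisker_left_id1[of "body t"] t'
    by (simp_all add: whisker_right_def whisker_left_def)
  then show "t \<ast>\<^bsub>lax_slice A m\<^esub> id2\<^bsub>lax_slice A m\<^esub> (id1\<^bsub>lax_slice A m\<^esub> (src (lax_slice A m) (Dom (lax_slice A m) t))) = t \<and>
      id2\<^bsub>lax_slice A m\<^esub> (id1\<^bsub>lax_slice A m\<^esub> (trg (lax_slice A m) (Dom (lax_slice A m) t))) \<ast>\<^bsub>lax_slice A m\<^esub> t = t"
    using t' slice_comp1_id1[OF t'(1)] slice_comp1_id1[OF t'(2)]
    by (intro conjI cell.expand) simp_all
next
  fix x assume "x \<in> cells0 (lax_slice A m)"
  then have x: "slice0_cell A m x" by simp
  then show "id1\<^bsub>lax_slice A m\<^esub> x \<in> cells1 (lax_slice A m) \<and> src (lax_slice A m) (id1\<^bsub>lax_slice A m\<^esub> x) = x \<and>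
      trg (lax_slice A m) (id1\<^bsub>lax_slice A m\<^esub> x) = x"
    using slice0_cell_cell[OF x] by (simp add: slice1_cellI)
next
  fix f g assume "f \<in> cells1 (lax_slice A m)" "g \<in> cells1 (lax_slice A m)"
    "src (lax_slice A m) g = trg (lax_slice A m) f"
  then have fg: "slice1_cell A m f" "slice1_cell A m g" "csrc g = ctrg f" by simp_all
  then show "g \<cdot>\<^bsub>lax_slice A m\<^esub> f \<in> cells1 (lax_slice A m) \<and>
      src (lax_slice A m) (g \<cdot>\<^bsub>lax_slice A m\<^esub> f) = src (lax_slice A m) f \<and>
      trg (lax_slice A m) (g \<cdot>\<^bsub>lax_slice A m\<^esub> f) = trg (lax_slice A m) g"
    by (simp add: slice_comp1_cell)
  show "id2\<^bsub>lax_slice A m\<^esub> g \<ast>\<^bsub>lax_slice A m\<^esub> id2\<^bsub>lax_slice A m\<^esub> f = id2\<^bsub>lax_slice A m\<^esub> (g \<cdot>\<^bsub>lax_slice A m\<^esub> f)"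
    using hcomp_id2'[of "fst (body f)" "fst (body g)"] slice1_cell_cell[OF fg(1)] slice1_cell_cell[OF fg(2)]
      fg(3) by simp
next
  fix f g h assume "f \<in> cells1 (lax_slice A m)" "g \<in> cells1 (lax_slice A m)" "h \<in> cells1 (lax_slice A m)"
    "src (lax_slice A m) g = trg (lax_slice A m) f" "src (lax_slice A m) h = trg (lax_slice A m) g"
  then have fgh: "slice1_cell A m f" "slice1_cell A m g" "slice1_cell A m h" "csrc g = ctrg f" "csrc h = ctrg g"
    by simp_all
  then show "(h \<cdot>\<^bsub>lax_slice A m\<^esub> g) \<cdot>\<^bsub>lax_slice A m\<^esub> f = h \<cdot>\<^bsub>lax_slice A m\<^esub> (g \<cdot>\<^bsub>lax_slice A m\<^esub> f)"
    by (simp add: slice_comp1_assoc)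
next
  fix s t assume "s \<in> cells2 (lax_slice A m)" "t \<in> cells2 (lax_slice A m)"
    "Dom (lax_slice A m) t = Cod (lax_slice A m) s"
  then show "t \<bullet>\<^bsub>lax_slice A m\<^esub> s \<in> cells2 (lax_slice A m) \<and>
      Dom (lax_slice A m) (t \<bullet>\<^bsub>lax_slice A m\<^esub> s) = Dom (lax_slice A m) s \<and>
      Cod (lax_slice A m) (t \<bullet>\<^bsub>lax_slice A m\<^esub> s) = Cod (lax_slice A m) t"
    by (simp add: slice_vcomp_cell)
next
  fix r s t assume "r \<in> cells2 (lax_slice A m)" "s \<in> cells2 (lax_slice A m)" "t \<in> cells2 (lax_slice A m)"
    "Dom (lax_slice A m) s = Cod (lax_slice A m) r" "Dom (lax_slice A m) t = Cod (lax_slice A m) s"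
  then show "(t \<bullet>\<^bsub>lax_slice A m\<^esub> s) \<bullet>\<^bsub>lax_slice A m\<^esub> r = t \<bullet>\<^bsub>lax_slice A m\<^esub> (s \<bullet>\<^bsub>lax_slice A m\<^esub> r)"
    by (simp add: slice2_cell_cell)
next
  fix s t assume "s \<in> cells2 (lax_slice A m)" "t \<in> cells2 (lax_slice A m)"
    "src (lax_slice A m) (Dom (lax_slice A m) t) = trg (lax_slice A m) (Dom (lax_slice A m) s)"
  then show "t \<ast>\<^bsub>lax_slice A m\<^esub> s \<in> cells2 (lax_slice A m) \<and>
      Dom (lax_slice A m) (t \<ast>\<^bsub>lax_slice A m\<^esub> s) = Dom (lax_slice A m) t \<cdot>\<^bsub>lax_slice A m\<^esub> Dom (lax_slice A m) s \<and>
      Cod (lax_slice A m) (t \<ast>\<^bsub>lax_slice A m\<^esub> s) = Cod (lax_slice A m) t \<cdot>\<^bsub>lax_slice A m\<^esub> Cod (lax_slice A m) s"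
    by (simp add: slice_hcomp_cell)
next
  fix r s t assume "r \<in> cells2 (lax_slice A m)" "s \<in> cells2 (lax_slice A m)" "t \<in> cells2 (lax_slice A m)"
    "src (lax_slice A m) (Dom (lax_slice A m) s) = trg (lax_slice A m) (Dom (lax_slice A m) r)"
    "src (lax_slice A m) (Dom (lax_slice A m) t) = trg (lax_slice A m) (Dom (lax_slice A m) s)"
  then have c: "slice2_cell A m r" "slice2_cell A m s" "slice2_cell A m t"
    "csrc (csrc s) = ctrg (csrc r)" "csrc (csrc t) = ctrg (csrc s)" by simp_all
  show "(t \<ast>\<^bsub>lax_slice A m\<^esub> s) \<ast>\<^bsub>lax_slice A m\<^esub> r = t \<ast>\<^bsub>lax_slice A m\<^esub> (s \<ast>\<^bsub>lax_slice A m\<^esub> r)"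
    using c slice2_cell_cell[OF c(1)] slice2_cell_cell[OF c(2)] slice2_cell_cell[OF c(3)]
    by (simp add: hcomp_assoc' slice_comp1_assoc)
next
  fix s s' t t' assume "s \<in> cells2 (lax_slice A m)" "s' \<in> cells2 (lax_slice A m)" "t \<in> cells2 (lax_slice A m)"
    "t' \<in> cells2 (lax_slice A m)" "Dom (lax_slice A m) s' = Cod (lax_slice A m) s"
    "Dom (lax_slice A m) t' = Cod (lax_slice A m) t"
    "src (lax_slice A m) (Dom (lax_slice A m) t) = trg (lax_slice A m) (Dom (lax_slice A m) s)"
  then show "(t' \<bullet>\<^bsub>lax_slice A m\<^esub> t) \<ast>\<^bsub>lax_slice A m\<^esub> (s' \<bullet>\<^bsub>lax_slice A m\<^esub> s) =
      (t' \<ast>\<^bsub>lax_slice A m\<^esub> s') \<bullet>\<^bsub>lax_slice A m\<^esub> (t \<ast>\<^bsub>lax_slice A m\<^esub> s)"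
    by (simp add: slice2_cell_cell interchange')
qed

end

end

section \<open>Transport of a 2-category structure along bijections\<close>

text \<open>Only \<open>B\<close> is assumed to be a 2-category. Every cell of \<open>C\<close> is the image of a unique cell of \<open>B\<close>, and
  composability in \<open>C\<close> reflects to \<open>B\<close> by injectivity, so each axiom for \<open>C\<close> is the image of the axiom
  for \<open>B\<close>.\<close>

lemma two_category_isomorphismI:
  fixes B :: "('o, 'a, 'c, 'm) two_cat_scheme" and C :: "('p, 'b, 'd, 'n) two_cat_scheme"
  assumes B: "two_category B"
    and bij: "bij_betw (map0 F) (cells0 B) (cells0 C)" "bij_betw (map1 F) (cells1 B) (cells1 C)"
      "bij_betw (map2 F) (cells2 B) (cells2 C)"
    and src: "\<And>f. f \<in> cells1 B \<Longrightarrow> src C (map1 F f) = map0 F (src B f)"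
    and trg: "\<And>f. f \<in> cells1 B \<Longrightarrow> trg C (map1 F f) = map0 F (trg B f)"
    and Dom: "\<And>t. t \<in> cells2 B \<Longrightarrow> Dom C (map2 F t) = map1 F (Dom B t)"
    and Cod: "\<And>t. t \<in> cells2 B \<Longrightarrow> Cod C (map2 F t) = map1 F (Cod B t)"
    and id1: "\<And>x. x \<in> cells0 B \<Longrightarrow> idn1 C (map0 F x) = map1 F (idn1 B x)"
    and id2: "\<And>f. f \<in> cells1 B \<Longrightarrow> idn2 C (map1 F f) = map2 F (idn2 B f)"
    and comp1: "\<And>f g. \<lbrakk>f \<in> cells1 B; g \<in> cells1 B; src B g = trg B f\<rbrakk>
      \<Longrightarrow> comp1 C (map1 F g) (map1 F f) = map1 F (comp1 B g f)"
    and vcomp: "\<And>s t. \<lbrakk>s \<in> cells2 B; t \<in> cells2 B; Dom B t = Cod B s\<rbrakk>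
      \<Longrightarrow> vcomp C (map2 F t) (map2 F s) = map2 F (vcomp B t s)"
    and hcomp: "\<And>s t. \<lbrakk>s \<in> cells2 B; t \<in> cells2 B; src B (Dom B t) = trg B (Dom B s)\<rbrakk>
      \<Longrightarrow> hcomp C (map2 F t) (map2 F s) = map2 F (hcomp B t s)"
  shows "two_category_isomorphism B C F"
proof -
  interpret B: two_category B by (rule B)
  have im: "cells0 C = map0 F ` cells0 B" "cells1 C = map1 F ` cells1 B" "cells2 C = map2 F ` cells2 B"
    using bij by (simp_all add: bij_betw_def)
  have inj [simp]: "\<lbrakk>x \<in> cells0 B; y \<in> cells0 B\<rbrakk> \<Longrightarrow> map0 F x = map0 F y \<longleftrightarrow> x = y"
    "\<lbrakk>f \<in> cells1 B; g \<in> cells1 B\<rbrakk> \<Longrightarrow> map1 F f = map1 F g \<longleftrightarrow> f = g"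
    "\<lbrakk>s \<in> cells2 B; t \<in> cells2 B\<rbrakk> \<Longrightarrow> map2 F s = map2 F t \<longleftrightarrow> s = t" for x y f g s t
    using bij by (auto simp: bij_betw_def dest: inj_onD)
  note [simp] = src trg Dom Cod id1 id2 comp1 vcomp hcomp
  have hc: "t \<ast>\<^bsub>B\<^esub> id2\<^bsub>B\<^esub> (id1\<^bsub>B\<^esub> (src2 B t)) = t" "id2\<^bsub>B\<^esub> (id1\<^bsub>B\<^esub> (trg2 B t)) \<ast>\<^bsub>B\<^esub> t = t"
    if "t \<in> cells2 B" for t
    using B.whisker_right_id1[of t] B.whisker_left_id1[of t] that
    by (simp_all add: whisker_right_def whisker_left_def)
  interpret C: two_category C
    by (rule two_categoryI)
      (auto simp: im hc B.hcomp_assoc' B.hcomp_id2' B.interchange' B.src2_composable)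
  show ?thesis
    by unfold_locales
      (auto simp: bij[unfolded im] im B.hom1_iff B.hom2_iff B.homcat_iff C.hom1_iff C.hom2_iff C.homcat_iff)
qed

section \<open>Transposition and evaluation\<close>

locale self_exponential = fp_two_category A + exponential A X X XX cur1 cur2
  for A :: "('o, 'a, 'c) fp_two_cat" (structure) and X XX cur1 cur2 +
  assumes X_cell [simp]: "X \<in> cells0 A"
begin

declare exp_cell [simp]

abbreviation ev :: 'a where
  "ev \<equiv> evaluation A X X XX cur1"

lemma evaluation_props: "ev \<in> hom1 A (XX \<^bold>\<times> X) X \<and> cur1 XX ev = id1 XX"
  unfolding evaluation_def
proof (rule theI')
  have bij: "bij_betw (cur1 XX) (hom1 A (XX \<^bold>\<times> X) X) (hom1 A XX XX)"
    by (rule cur1_bij) simp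
  have "id1 XX \<in> cur1 XX ` hom1 A (XX \<^bold>\<times> X) X"
    unfolding bij_betw_imp_surj_on[OF bij] by (simp add: hom1_iff)
  then obtain h where h: "h \<in> hom1 A (XX \<^bold>\<times> X) X" "cur1 XX h = id1 XX" by force
  then show "\<exists>!e. e \<in> hom1 A (XX \<^bold>\<times> X) X \<and> cur1 XX e = id1 XX"
    using inj_onD[OF bij_betw_imp_inj_on[OF bij]] by (intro ex1I[of _ h]) auto
qed

lemma evaluation_cell [simp]: "ev \<in> cells1 A" "src A ev = XX \<^bold>\<times> X" "trg A ev = X"
  using evaluation_props by (auto simp: hom1_iff)

text \<open>Transposition is inverse to evaluation at the generic element: naturality of transposition at
  \<open>F\<close>, applied to \<open>ev\<close>, whose transpose is the identity.\<close>

lemma cur1_app: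
  assumes "F \<in> cells1 A" "src A F = e" "trg A F = XX"
  shows "cur1 e (ev \<cdot> \<langle>F \<cdot> pr1 A e X, pr2 A e X\<rangle>) = F"
  using cur1_natural[of F e XX ev] evaluation_props assms by (simp add: times1_def hom1_iff)

text \<open>The same argument one dimension up, from the naturality in 2-cells between 1-cells into \<open>XX\<close>.\<close>

lemma cur2_app2:
  assumes "\<theta> \<in> cells2 A" "src2 A \<theta> = e" "trg2 A \<theta> = XX"
  shows "cur2 e (ev \<rhd> \<llangle>\<theta> \<lhd> pr1 A e X, id2 (pr2 A e X)\<rrangle>) = \<theta>"
  using cur2_natural2[of \<theta> e XX ev] evaluation_props assms
  by (simp add: times2_def homcat_iff hom1_iff)

lemma cur1_cell [simp]:
  assumes "e \<in> cells0 A" "h \<in> cells1 A" "src A h = e \<^bold>\<times> X" "trg A h = X"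
  shows "cur1 e h \<in> cells1 A" "src A (cur1 e h) = e" "trg A (cur1 e h) = XX"
  using bij_betwE[OF cur1_bij[OF assms(1)]] assms by (auto simp: hom1_iff)

lemma app_cur1:
  assumes e: "e \<in> cells0 A" and h: "h \<in> cells1 A" "src A h = e \<^bold>\<times> X" "trg A h = X"
  shows "ev \<cdot> \<langle>cur1 e h \<cdot> pr1 A e X, pr2 A e X\<rangle> = h"
proof (rule inj_onD[OF bij_betw_imp_inj_on[OF cur1_bij[OF e]]])
  show "cur1 e (ev \<cdot> \<langle>cur1 e h \<cdot> pr1 A e X, pr2 A e X\<rangle>) = cur1 e h"
    using assms by (intro cur1_app) simp_all
qed (use assms in \<open>simp_all add: hom1_iff\<close>)

lemma app_cur1_at:
  assumes "e \<in> cells0 A" "h \<in> cells1 A" "src A h = e \<^bold>\<times> X" "trg A h = X"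
    "a \<in> cells1 A" "x \<in> cells1 A" "src A a = src A x" "trg A a = e" "trg A x = X"
  shows "ev \<cdot> \<langle>cur1 e h \<cdot> a, x\<rangle> = h \<cdot> \<langle>a, x\<rangle>"
proof -
  have "ev \<cdot> \<langle>cur1 e h \<cdot> a, x\<rangle> = (ev \<cdot> \<langle>cur1 e h \<cdot> pr1 A e X, pr2 A e X\<rangle>) \<cdot> \<langle>a, x\<rangle>"
    using assms by simp
  then show ?thesis using app_cur1 assms by simp
qed

lemma app_inject:
  assumes "F \<in> cells1 A" "G \<in> cells1 A" "src A F = e" "src A G = e" "trg A F = XX" "trg A G = XX"
    and "ev \<cdot> \<langle>F \<cdot> pr1 A e X, pr2 A e X\<rangle> = ev \<cdot> \<langle>G \<cdot> pr1 A e X, pr2 A e X\<rangle>"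
  shows "F = G"
  using assms cur1_app by metis

lemma app2_inject:
  assumes "\<theta> \<in> cells2 A" "\<theta>' \<in> cells2 A" "src2 A \<theta> = e" "src2 A \<theta>' = e" "trg2 A \<theta> = XX" "trg2 A \<theta>' = XX"
    and "ev \<rhd> \<llangle>\<theta> \<lhd> pr1 A e X, id2 (pr2 A e X)\<rrangle> = ev \<rhd> \<llangle>\<theta>' \<lhd> pr1 A e X, id2 (pr2 A e X)\<rrangle>"
  shows "\<theta> = \<theta>'"
  using assms cur2_app2 by metis

text \<open>The projection from \<open>\<one> \<^bold>\<times> X\<close> to \<open>X\<close> is invertible, so for 2-cells between global elements the
  generic element can be replaced by the identity of \<open>X\<close>. In this form units of actions are given.\<close>

lemma app2_inject_global:
  assumes [simp]: "\<theta> \<in> cells2 A" "\<theta>' \<in> cells2 A" "src2 A \<theta> = \<one>" "src2 A \<theta>' = \<one>" "trg2 A \<theta> = XX"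
      "trg2 A \<theta>' = XX"
    and eq: "ev \<rhd> \<llangle>\<theta> \<lhd> bang A X, id2 (id1 X)\<rrangle> = ev \<rhd> \<llangle>\<theta>' \<lhd> bang A X, id2 (id1 X)\<rrangle>"
  shows "\<theta> = \<theta>'"
proof (rule app2_inject[where e = \<one>])
  have p: "pr1 A \<one> X = bang A (\<one> \<^bold>\<times> X)" using bang_unique[of "pr1 A \<one> X"] by simp
  have *: "ev \<rhd> \<llangle>t \<lhd> pr1 A \<one> X, id2 (pr2 A \<one> X)\<rrangle> = (ev \<rhd> \<llangle>t \<lhd> bang A X, id2 (id1 X)\<rrangle>) \<lhd> pr2 A \<one> X"
    if [simp]: "t \<in> cells2 A" "src2 A t = \<one>" "trg2 A t = XX" for t
    by (simp add: p)
  show "ev \<rhd> \<llangle>\<theta> \<lhd> pr1 A \<one> X, id2 (pr2 A \<one> X)\<rrangle> = ev \<rhd> \<llangle>\<theta>' \<lhd> pr1 A \<one> X, id2 (pr2 A \<one> X)\<rrangle>"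
    using eq by (simp add: *)
qed simp_all

text \<open>Surjectivity of evaluation, with control over domain and codomain: these are determined by their
  own evaluations.\<close>

lemma obtain_curried2:
  assumes [simp]: "e \<in> cells0 A" "s \<in> cells2 A" "F \<in> cells1 A" "G \<in> cells1 A" "src A F = e" "src A G = e"
      "trg A F = XX" "trg A G = XX"
    and s: "Dom A s = ev \<cdot> \<langle>F \<cdot> pr1 A e X, pr2 A e X\<rangle>" "Cod A s = ev \<cdot> \<langle>G \<cdot> pr1 A e X, pr2 A e X\<rangle>"
  obtains \<theta> where "\<theta> \<in> cells2 A" "Dom A \<theta> = F" "Cod A \<theta> = G" "src2 A \<theta> = e" "trg2 A \<theta> = XX"
    "ev \<rhd> \<llangle>\<theta> \<lhd> pr1 A e X, id2 (pr2 A e X)\<rrangle> = s"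
proof -
  have s2 [simp]: "src2 A s = e \<^bold>\<times> X" "trg2 A s = X"
    unfolding src2_def trg2_def s by simp_all
  define \<theta> where "\<theta> = cur2 e s"
  have \<theta> [simp]: "\<theta> \<in> cells2 A" "src2 A \<theta> = e" "trg2 A \<theta> = XX"
    using bij_betwE[OF cur2_bij[of e]] by (auto simp: homcat_iff \<theta>_def)
  have eq: "ev \<rhd> \<llangle>\<theta> \<lhd> pr1 A e X, id2 (pr2 A e X)\<rrangle> = s"
  proof (rule inj_onD[OF bij_betw_imp_inj_on[OF cur2_bij[of e]]])
    show "cur2 e (ev \<rhd> \<llangle>\<theta> \<lhd> pr1 A e X, id2 (pr2 A e X)\<rrangle>) = cur2 e s"
      by (subst cur2_app2) (simp_all add: \<theta>_def[symmetric])
  qed (simp_all add: homcat_iff)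
  have "Dom A \<theta> = F"
    by (rule app_inject[where e = e]) (use s arg_cong[OF eq, of "Dom A"] in simp_all)
  moreover have "Cod A \<theta> = G"
    by (rule app_inject[where e = e]) (use s arg_cong[OF eq, of "Cod A"] in simp_all)
  ultimately show ?thesis using that[OF \<theta>(1) _ _ \<theta>(2,3) eq] by blast
qed

section \<open>The monoidal object of endomorphisms\<close>

abbreviation T :: 'a where "T \<equiv> endo_tensor A X XX cur1"
abbreviation J :: 'a where "J \<equiv> endo_unit A X cur1"
abbreviation E :: "('o, 'a, 'c) monobj" where "E \<equiv> endo_mon A X XX cur1"

lemma endo_tensor_eq: "T = cur1 (XX \<^bold>\<times> XX) (ev \<cdot> \<langle>pr1 A XX XX \<cdot> pr1 A (XX \<^bold>\<times> XX) X,
    ev \<cdot> \<langle>pr2 A XX XX \<cdot> pr1 A (XX \<^bold>\<times> XX) X, pr2 A (XX \<^bold>\<times> XX) X\<rangle>\<rangle>)"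
  by (simp add: endo_tensor_def Let_def ap1_def)

lemma endo_tensor_cell [simp]: "T \<in> cells1 A" "src A T = XX \<^bold>\<times> XX" "trg A T = XX"
  by (simp_all add: endo_tensor_eq)

lemma endo_unit_cell [simp]: "J \<in> cells1 A" "src A J = \<one>" "trg A J = XX"
  by (simp_all add: endo_unit_def)

text \<open>\<open>(g \<otimes> h)(x) = g(h(x))\<close>: under evaluation the tensor disappears, and every statement about it
  becomes a statement about iterated evaluation. The 2-dimensional form below is obtained by whiskering
  the generic instance.\<close>

lemma app_endo_tensor [simp]:
  assumes "g \<in> cells1 A" "h \<in> cells1 A" "x \<in> cells1 A" "src A g = src A x" "src A h = src A x"
    "trg A g = XX" "trg A h = XX" "trg A x = X"
  shows "ev \<cdot> \<langle>T \<cdot> \<langle>g, h\<rangle>, x\<rangle> = ev \<cdot> \<langle>g, ev \<cdot> \<langle>h, x\<rangle>\<rangle>"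
  using assms by (simp add: endo_tensor_eq app_cur1_at)

lemma app2_endo_tensor [simp]:
  assumes "s \<in> cells2 A" "t \<in> cells2 A" "u \<in> cells2 A" "src2 A s = src2 A u" "src2 A t = src2 A u"
    "trg2 A s = XX" "trg2 A t = XX" "trg2 A u = X"
  shows "ev \<rhd> \<llangle>T \<rhd> \<llangle>s, t\<rrangle>, u\<rrangle> = ev \<rhd> \<llangle>s, ev \<rhd> \<llangle>t, u\<rrangle>\<rrangle>"
proof -
  let ?q = "pr1 A (XX \<^bold>\<times> XX) X" and ?x = "pr2 A (XX \<^bold>\<times> XX) X"
  have "ev \<rhd> \<llangle>T \<rhd> \<llangle>s, t\<rrangle>, u\<rrangle> = (ev \<cdot> \<langle>T \<cdot> ?q, ?x\<rangle>) \<rhd> \<llangle>\<llangle>s, t\<rrangle>, u\<rrangle>"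
    using assms by simp
  also have "ev \<cdot> \<langle>T \<cdot> ?q, ?x\<rangle> = ev \<cdot> \<langle>pr1 A XX XX \<cdot> ?q, ev \<cdot> \<langle>pr2 A XX XX \<cdot> ?q, ?x\<rangle>\<rangle>"
    by (simp add: endo_tensor_eq app_cur1)
  also have "\<dots> \<rhd> \<llangle>\<llangle>s, t\<rrangle>, u\<rrangle> = ev \<rhd> \<llangle>s, ev \<rhd> \<llangle>t, u\<rrangle>\<rrangle>"
    using assms by simp
  finally show ?thesis .
qed

lemma app_endo_unit [simp]:
  assumes "x \<in> cells1 A" "trg A x = X" "e = src A x"
  shows "ev \<cdot> \<langle>J \<cdot> bang A e, x\<rangle> = x"
  using assms by (simp add: endo_unit_def app_cur1_at)

text \<open>Both sides evaluate to \<open>a(b(c(x)))\<close>.\<close>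

lemma endo_tensor_assoc:
  assumes [simp]: "a \<in> cells1 A" "b \<in> cells1 A" "c \<in> cells1 A" "src A a = src A c" "src A b = src A c"
    "trg A a = XX" "trg A b = XX" "trg A c = XX"
  shows "T \<cdot> \<langle>T \<cdot> \<langle>a, b\<rangle>, c\<rangle> = T \<cdot> \<langle>a, T \<cdot> \<langle>b, c\<rangle>\<rangle>"
  by (rule app_inject[where e = "src A c"]) simp_all

lemma endo_tensor_unit [simp]:
  assumes [simp]: "a \<in> cells1 A" "trg A a = XX" "e = src A a"
  shows "T \<cdot> \<langle>J \<cdot> bang A e, a\<rangle> = a" "T \<cdot> \<langle>a, J \<cdot> bang A e\<rangle> = a"
  by (rule app_inject[where e = e]; simp)+

lemma endo_mon_sel [simp]:
  "car E = XX" "ten E = T" "unt E = J" "lam E = id2 (id1 XX)" "rho E = id2 (id1 XX)"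
  by (simp_all add: endo_mon_def)

lemma alph_endo_mon:
  "alph E = id2 (T \<cdot> \<langle>pr1 A XX (XX \<^bold>\<times> XX), T \<cdot> pr2 A XX (XX \<^bold>\<times> XX)\<rangle>)"
  by (simp add: endo_mon_def vars3_def ap1_def Let_def)

lemma alph_endo_mon_at [simp]:
  assumes "a \<in> cells1 A" "b \<in> cells1 A" "c \<in> cells1 A" "src A a = src A c" "src A b = src A c"
    "trg A a = XX" "trg A b = XX" "trg A c = XX"
  shows "alph E \<lhd> \<langle>a, \<langle>b, c\<rangle>\<rangle> = id2 (T \<cdot> \<langle>a, T \<cdot> \<langle>b, c\<rangle>\<rangle>)"
  using assms by (simp add: alph_endo_mon)

theorem monoidal_object_endo_mon [simp]: "monoidal_object A E"
  unfolding monoidal_object_def Let_def endo_mon_sel vars2_def vars3_def vars4_def prod.case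
    ap1_def ap2_def at3_def const1_def
  by (simp add: hom1_iff hom2_iff endo_tensor_assoc alph_endo_mon invertible2_id2)

end

section \<open>Actions at generalised elements\<close>

context self_exponential
begin

lemma action_object_amon [simp]: "action_object A X P \<Longrightarrow> monoidal_object A (amon P)"
  by (simp add: action_object_def Let_def)

lemma action_object_cell [simp]:
  assumes "action_object A X P"
  defines "C \<equiv> car (amon P)" and "S \<equiv> act P"
  shows "S \<in> cells1 A" "src A S = C \<^bold>\<times> X" "trg A S = X"
    "amlt P \<in> cells2 A" "src2 A (amlt P) = C \<^bold>\<times> C \<^bold>\<times> X" "trg2 A (amlt P) = X"
    "Dom A (amlt P) = S \<cdot> \<langle>pr1 A C (C \<^bold>\<times> X), S \<cdot> pr2 A C (C \<^bold>\<times> X)\<rangle>"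
    "Cod A (amlt P) = S \<cdot> \<langle>ten (amon P) \<cdot> \<langle>pr1 A C (C \<^bold>\<times> X), pr1 A C X \<cdot> pr2 A C (C \<^bold>\<times> X)\<rangle>,
       pr2 A C X \<cdot> pr2 A C (C \<^bold>\<times> X)\<rangle>"
    "ault P \<in> cells2 A" "src2 A (ault P) = X" "trg2 A (ault P) = X"
    "Dom A (ault P) = id1 X" "Cod A (ault P) = S \<cdot> \<langle>unt (amon P) \<cdot> bang A X, id1 X\<rangle>"
proof -
  have C [simp]: "C \<in> cells0 A" using assms by simp
  have S: "S \<in> hom1 A (C \<^bold>\<times> X) X"
    and m: "amlt P \<in> hom2 A (S \<cdot> \<langle>pr1 A C (C \<^bold>\<times> X), S \<cdot> \<langle>pr1 A C X \<cdot> pr2 A C (C \<^bold>\<times> X), pr2 A C X \<cdot> pr2 A C (C \<^bold>\<times> X)\<rangle>\<rangle>)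
      (S \<cdot> \<langle>ten (amon P) \<cdot> \<langle>pr1 A C (C \<^bold>\<times> X), pr1 A C X \<cdot> pr2 A C (C \<^bold>\<times> X)\<rangle>, pr2 A C X \<cdot> pr2 A C (C \<^bold>\<times> X)\<rangle>)"
    and u: "ault P \<in> hom2 A (id1 X) (S \<cdot> \<langle>unt (amon P) \<cdot> bang A X, id1 X\<rangle>)"
    using assms(1) unfolding action_object_def C_def S_def Let_def vars3_def prod.case ap1_def const1_def
    by blast+
  show 1: "S \<in> cells1 A" "src A S = C \<^bold>\<times> X" "trg A S = X"
    using S by (simp_all add: hom1_iff)
  show 2: "amlt P \<in> cells2 A"
    "Dom A (amlt P) = S \<cdot> \<langle>pr1 A C (C \<^bold>\<times> X), S \<cdot> pr2 A C (C \<^bold>\<times> X)\<rangle>"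
    "Cod A (amlt P) = S \<cdot> \<langle>ten (amon P) \<cdot> \<langle>pr1 A C (C \<^bold>\<times> X), pr1 A C X \<cdot> pr2 A C (C \<^bold>\<times> X)\<rangle>,
       pr2 A C X \<cdot> pr2 A C (C \<^bold>\<times> X)\<rangle>"
    "ault P \<in> cells2 A" "Dom A (ault P) = id1 X" "Cod A (ault P) = S \<cdot> \<langle>unt (amon P) \<cdot> bang A X, id1 X\<rangle>"
    using m u by (simp_all add: hom2_iff)
  show "src2 A (amlt P) = C \<^bold>\<times> C \<^bold>\<times> X" "trg2 A (amlt P) = X" "src2 A (ault P) = X" "trg2 A (ault P) = X"
    unfolding src2_def trg2_def 2 using 1 by simp_all
qed

text \<open>The three axioms of an action, read at generalised elements.\<close>

definition act_assoc_at :: "('o, 'a, 'c) actobj \<Rightarrow> 'a \<Rightarrow> 'a \<Rightarrow> 'a \<Rightarrow> 'a \<Rightarrow> bool" where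
  "act_assoc_at P a b c x \<longleftrightarrow> (let S = act P; \<psi> = amlt P; m = ten (amon P) in
     (S \<rhd> \<llangle>alph (amon P) \<lhd> \<langle>a, \<langle>b, c\<rangle>\<rangle>, id2 x\<rrangle>) \<bullet> (\<psi> \<lhd> \<langle>a, \<langle>m \<cdot> \<langle>b, c\<rangle>, x\<rangle>\<rangle>) \<bullet>
       (S \<rhd> \<llangle>id2 a, \<psi> \<lhd> \<langle>b, \<langle>c, x\<rangle>\<rangle>\<rrangle>) =
     (\<psi> \<lhd> \<langle>m \<cdot> \<langle>a, b\<rangle>, \<langle>c, x\<rangle>\<rangle>) \<bullet> (\<psi> \<lhd> \<langle>a, \<langle>b, S \<cdot> \<langle>c, x\<rangle>\<rangle>\<rangle>))"

definition act_lam_at :: "('o, 'a, 'c) actobj \<Rightarrow> 'a \<Rightarrow> 'a \<Rightarrow> bool" where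
  "act_lam_at P a x \<longleftrightarrow> (let S = act P; \<psi> = amlt P; i = unt (amon P) \<cdot> bang A (src A x) in
     (S \<rhd> \<llangle>lam (amon P) \<lhd> a, id2 x\<rrangle>) \<bullet> (\<psi> \<lhd> \<langle>i, \<langle>a, x\<rangle>\<rangle>) \<bullet> (ault P \<lhd> (S \<cdot> \<langle>a, x\<rangle>)) = id2 (S \<cdot> \<langle>a, x\<rangle>))"

definition act_rho_at :: "('o, 'a, 'c) actobj \<Rightarrow> 'a \<Rightarrow> 'a \<Rightarrow> bool" where
  "act_rho_at P a x \<longleftrightarrow> (let S = act P; \<psi> = amlt P; i = unt (amon P) \<cdot> bang A (src A x) in
     (S \<rhd> \<llangle>rho (amon P) \<lhd> a, id2 x\<rrangle>) \<bullet> (\<psi> \<lhd> \<langle>a, \<langle>i, x\<rangle>\<rangle>) \<bullet> (S \<rhd> \<llangle>id2 a, ault P \<lhd> x\<rrangle>) = id2 (S \<cdot> \<langle>a, x\<rangle>))"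

lemma act_at_comp:
  assumes [simp]: "action_object A X P" "a \<in> cells1 A" "b \<in> cells1 A" "c \<in> cells1 A" "x \<in> cells1 A"
    "src A a = src A x" "src A b = src A x" "src A c = src A x"
    "trg A a = car (amon P)" "trg A b = car (amon P)" "trg A c = car (amon P)" "trg A x = X"
    "u \<in> cells1 A" "trg A u = src A x"
  shows "act_assoc_at P a b c x \<Longrightarrow> act_assoc_at P (a \<cdot> u) (b \<cdot> u) (c \<cdot> u) (x \<cdot> u)"
    and "act_lam_at P a x \<Longrightarrow> act_lam_at P (a \<cdot> u) (x \<cdot> u)"
    and "act_rho_at P a x \<Longrightarrow> act_rho_at P (a \<cdot> u) (x \<cdot> u)"
proof -
  let ?S = "act P" and ?\<psi> = "amlt P" and ?T = "ten (amon P)"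
  let ?i = "unt (amon P) \<cdot> bang A (src A x)" and ?j = "unt (amon P) \<cdot> bang A (src A u)"
  have 1: "((?S \<rhd> \<llangle>alph (amon P) \<lhd> \<langle>a, \<langle>b, c\<rangle>\<rangle>, id2 x\<rrangle>) \<bullet> (?\<psi> \<lhd> \<langle>a, \<langle>?T \<cdot> \<langle>b, c\<rangle>, x\<rangle>\<rangle>) \<bullet>
       (?S \<rhd> \<llangle>id2 a, ?\<psi> \<lhd> \<langle>b, \<langle>c, x\<rangle>\<rangle>\<rrangle>)) \<lhd> u =
     (?S \<rhd> \<llangle>alph (amon P) \<lhd> \<langle>a \<cdot> u, \<langle>b \<cdot> u, c \<cdot> u\<rangle>\<rangle>, id2 (x \<cdot> u)\<rrangle>) \<bullet>
       (?\<psi> \<lhd> \<langle>a \<cdot> u, \<langle>?T \<cdot> \<langle>b \<cdot> u, c \<cdot> u\<rangle>, x \<cdot> u\<rangle>\<rangle>) \<bullet>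
       (?S \<rhd> \<llangle>id2 (a \<cdot> u), ?\<psi> \<lhd> \<langle>b \<cdot> u, \<langle>c \<cdot> u, x \<cdot> u\<rangle>\<rangle>\<rrangle>)"
    by (subst whisker_right_vcomp3) simp_all
  have 2: "((?\<psi> \<lhd> \<langle>?T \<cdot> \<langle>a, b\<rangle>, \<langle>c, x\<rangle>\<rangle>) \<bullet> (?\<psi> \<lhd> \<langle>a, \<langle>b, ?S \<cdot> \<langle>c, x\<rangle>\<rangle>\<rangle>)) \<lhd> u =
      (?\<psi> \<lhd> \<langle>?T \<cdot> \<langle>a \<cdot> u, b \<cdot> u\<rangle>, \<langle>c \<cdot> u, x \<cdot> u\<rangle>\<rangle>) \<bullet> (?\<psi> \<lhd> \<langle>a \<cdot> u, \<langle>b \<cdot> u, ?S \<cdot> \<langle>c \<cdot> u, x \<cdot> u\<rangle>\<rangle>\<rangle>)"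
    by simp
  show "act_assoc_at P (a \<cdot> u) (b \<cdot> u) (c \<cdot> u) (x \<cdot> u)" if "act_assoc_at P a b c x"
    using arg_cong[OF that[unfolded act_assoc_at_def Let_def], of "\<lambda>t. t \<lhd> u"]
    unfolding 1 2 by (simp only: act_assoc_at_def Let_def)
  have 3: "((?S \<rhd> \<llangle>lam (amon P) \<lhd> a, id2 x\<rrangle>) \<bullet> (?\<psi> \<lhd> \<langle>?i, \<langle>a, x\<rangle>\<rangle>) \<bullet> (ault P \<lhd> (?S \<cdot> \<langle>a, x\<rangle>))) \<lhd> u =
      (?S \<rhd> \<llangle>lam (amon P) \<lhd> (a \<cdot> u), id2 (x \<cdot> u)\<rrangle>) \<bullet> (?\<psi> \<lhd> \<langle>?j, \<langle>a \<cdot> u, x \<cdot> u\<rangle>\<rangle>) \<bullet>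
        (ault P \<lhd> (?S \<cdot> \<langle>a \<cdot> u, x \<cdot> u\<rangle>))"
    by (subst whisker_right_vcomp3) simp_all
  show "act_lam_at P (a \<cdot> u) (x \<cdot> u)" if "act_lam_at P a x"
    using arg_cong[OF that[unfolded act_lam_at_def Let_def], of "\<lambda>t. t \<lhd> u"]
    unfolding 3 act_lam_at_def Let_def by simp
  have 4: "((?S \<rhd> \<llangle>rho (amon P) \<lhd> a, id2 x\<rrangle>) \<bullet> (?\<psi> \<lhd> \<langle>a, \<langle>?i, x\<rangle>\<rangle>) \<bullet> (?S \<rhd> \<llangle>id2 a, ault P \<lhd> x\<rrangle>)) \<lhd> u =
      (?S \<rhd> \<llangle>rho (amon P) \<lhd> (a \<cdot> u), id2 (x \<cdot> u)\<rrangle>) \<bullet> (?\<psi> \<lhd> \<langle>a \<cdot> u, \<langle>?j, x \<cdot> u\<rangle>\<rangle>) \<bullet>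
        (?S \<rhd> \<llangle>id2 (a \<cdot> u), ault P \<lhd> (x \<cdot> u)\<rrangle>)"
    by (subst whisker_right_vcomp3) simp_all
  show "act_rho_at P (a \<cdot> u) (x \<cdot> u)" if "act_rho_at P a x"
    using arg_cong[OF that[unfolded act_rho_at_def Let_def], of "\<lambda>t. t \<lhd> u"]
    unfolding 4 act_rho_at_def Let_def by simp
qed

text \<open>The third and fourth variable are bracketed as composites of projections in the way in which
  \<open>vars4\<close> is built from \<open>vars3\<close>.\<close>

lemma action_object_iff:
  assumes M [simp]: "monoidal_object A (amon P)"
  defines "C \<equiv> car (amon P)" and "S \<equiv> act P"
  shows "action_object A X P \<longleftrightarrow> S \<in> cells1 A \<and> src A S = C \<^bold>\<times> X \<and> trg A S = X \<and>
    amlt P \<in> cells2 A \<and> Dom A (amlt P) = S \<cdot> \<langle>pr1 A C (C \<^bold>\<times> X), S \<cdot> pr2 A C (C \<^bold>\<times> X)\<rangle> \<and>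
    Cod A (amlt P) = S \<cdot> \<langle>ten (amon P) \<cdot> \<langle>pr1 A C (C \<^bold>\<times> X), pr1 A C X \<cdot> pr2 A C (C \<^bold>\<times> X)\<rangle>,
       pr2 A C X \<cdot> pr2 A C (C \<^bold>\<times> X)\<rangle> \<and>
    ault P \<in> cells2 A \<and> Dom A (ault P) = id1 X \<and>
    Cod A (ault P) = S \<cdot> \<langle>unt (amon P) \<cdot> bang A X, id1 X\<rangle> \<and>
    act_assoc_at P (pr1 A C (C \<^bold>\<times> C \<^bold>\<times> X)) (pr1 A C (C \<^bold>\<times> X) \<cdot> pr2 A C (C \<^bold>\<times> C \<^bold>\<times> X))
      ((pr1 A C X \<cdot> pr2 A C (C \<^bold>\<times> X)) \<cdot> pr2 A C (C \<^bold>\<times> C \<^bold>\<times> X))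
      ((pr2 A C X \<cdot> pr2 A C (C \<^bold>\<times> X)) \<cdot> pr2 A C (C \<^bold>\<times> C \<^bold>\<times> X)) \<and>
    act_lam_at P (pr1 A C X) (pr2 A C X) \<and> act_rho_at P (pr1 A C X) (pr2 A C X)"
proof -
  have [simp]: "C \<in> cells0 A" by (simp add: C_def)
  have e: "\<langle>pr1 A C X \<cdot> pr2 A C (C \<^bold>\<times> X), pr2 A C X \<cdot> pr2 A C (C \<^bold>\<times> X)\<rangle> = pr2 A C (C \<^bold>\<times> X)"
    "src A (pr2 A C X) = C \<^bold>\<times> X" by simp_all
  show ?thesis
    unfolding action_object_def Let_def vars2_def vars3_def vars4_def prod.case ap1_def ap2_def
      const1_def at3_def hom1_iff hom2_iff act_assoc_at_def act_lam_at_def act_rho_at_def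
      C_def[symmetric] S_def[symmetric] e
    using M by blast
qed

lemma act_assoc_elem:
  assumes [simp]: "action_object A X P" "a \<in> cells1 A" "b \<in> cells1 A" "c \<in> cells1 A" "x \<in> cells1 A"
    "src A a = src A x" "src A b = src A x" "src A c = src A x"
    "trg A a = car (amon P)" "trg A b = car (amon P)" "trg A c = car (amon P)" "trg A x = X"
  shows "act_assoc_at P a b c x"
proof -
  let ?C = "car (amon P)" and ?u = "\<langle>a, \<langle>b, \<langle>c, x\<rangle>\<rangle>\<rangle>"
  let ?a = "pr1 A ?C (?C \<^bold>\<times> ?C \<^bold>\<times> X)" and ?b = "pr1 A ?C (?C \<^bold>\<times> X) \<cdot> pr2 A ?C (?C \<^bold>\<times> ?C \<^bold>\<times> X)"
    and ?c = "(pr1 A ?C X \<cdot> pr2 A ?C (?C \<^bold>\<times> X)) \<cdot> pr2 A ?C (?C \<^bold>\<times> ?C \<^bold>\<times> X)"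
    and ?x = "(pr2 A ?C X \<cdot> pr2 A ?C (?C \<^bold>\<times> X)) \<cdot> pr2 A ?C (?C \<^bold>\<times> ?C \<^bold>\<times> X)"
  have "act_assoc_at P ?a ?b ?c ?x"
    using action_object_iff[OF action_object_amon[OF assms(1)]] assms(1) by blast
  then have "act_assoc_at P (?a \<cdot> ?u) (?b \<cdot> ?u) (?c \<cdot> ?u) (?x \<cdot> ?u)"
    by (intro act_at_comp(1)) simp_all
  then show ?thesis by simp
qed

lemma act_unit_elem:
  assumes [simp]: "action_object A X P" "a \<in> cells1 A" "x \<in> cells1 A" "src A a = src A x"
    "trg A a = car (amon P)" "trg A x = X"
  shows "act_lam_at P a x" "act_rho_at P a x"
proof -
  let ?C = "car (amon P)"
  have 1: "act_lam_at P (pr1 A ?C X) (pr2 A ?C X)" "act_rho_at P (pr1 A ?C X) (pr2 A ?C X)"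
    using action_object_iff[OF action_object_amon[OF assms(1)]] assms(1) by blast+
  have "act_lam_at P (pr1 A ?C X \<cdot> \<langle>a, x\<rangle>) (pr2 A ?C X \<cdot> \<langle>a, x\<rangle>)"
    using 1 by (intro act_at_comp(2)[where b = "pr1 A ?C X" and c = "pr1 A ?C X"]) simp_all
  then show "act_lam_at P a x" by simp
  have "act_rho_at P (pr1 A ?C X \<cdot> \<langle>a, x\<rangle>) (pr2 A ?C X \<cdot> \<langle>a, x\<rangle>)"
    using 1 by (intro act_at_comp(3)[where b = "pr1 A ?C X" and c = "pr1 A ?C X"]) simp_all
  then show "act_rho_at P a x" by simp
qed

end

section \<open>Representations and actions\<close>

context self_exponential
begin

text \<open>Below, \<open>F\<close>, \<open>\<phi>\<close> and \<open>\<phi>0\<close> have the types of the constituents of a lax monoidal 1-cell into the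
  endomorphism object, without its axioms: the axioms on one side are to be derived from those on the
  other.\<close>

context
  fixes M :: "('o, 'a, 'c) monobj" and F :: 'a and \<phi> \<phi>0 :: 'c
  assumes M [simp]: "monoidal_object A M"
    and F [simp]: "F \<in> cells1 A" "src A F = car M" "trg A F = XX"
    and \<phi> [simp]: "\<phi> \<in> cells2 A" "src2 A \<phi> = car M \<^bold>\<times> car M" "trg2 A \<phi> = XX"
      "Dom A \<phi> = T \<cdot> \<langle>F \<cdot> pr1 A (car M) (car M), F \<cdot> pr2 A (car M) (car M)\<rangle>" "Cod A \<phi> = F \<cdot> ten M"
    and \<phi>0 [simp]: "\<phi>0 \<in> cells2 A" "src2 A \<phi>0 = \<one>" "trg2 A \<phi>0 = XX" "Dom A \<phi>0 = J" "Cod A \<phi>0 = F \<cdot> unt M"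
begin

private abbreviation r :: "('o, 'a, 'c) mon1" where "r \<equiv> Cell M E (LaxData F \<phi> \<phi>0)"
private abbreviation P :: "('o, 'a, 'c) actobj" where "P \<equiv> transpose0 A X XX cur1 r"

lemma transpose0_sel [simp]:
  "amon P = M" "act P = ev \<cdot> \<langle>F \<cdot> pr1 A (car M) X, pr2 A (car M) X\<rangle>"
  "ault P = ev \<rhd> \<llangle>\<phi>0 \<lhd> bang A X, id2 (id1 X)\<rrangle>"
  by (simp_all add: transpose0_def Let_def vars2_def vars3_def ap1_def ap2_def)

lemma transpose0_mlt:
  "amlt P = ev \<rhd> \<llangle>\<phi> \<lhd> \<langle>pr1 A (car M) (car M \<^bold>\<times> X), pr1 A (car M) X \<cdot> pr2 A (car M) (car M \<^bold>\<times> X)\<rangle>,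
     id2 (pr2 A (car M) X \<cdot> pr2 A (car M) (car M \<^bold>\<times> X))\<rrangle>"
  by (simp add: transpose0_def Let_def vars2_def vars3_def ap1_def ap2_def at2_def)

lemma transpose0_mlt_at [simp]:
  assumes "a \<in> cells1 A" "b \<in> cells1 A" "x \<in> cells1 A" "src A a = src A x" "src A b = src A x"
    "trg A a = car M" "trg A b = car M" "trg A x = X"
  shows "amlt P \<lhd> \<langle>a, \<langle>b, x\<rangle>\<rangle> = ev \<rhd> \<llangle>\<phi> \<lhd> \<langle>a, b\<rangle>, id2 x\<rrangle>"
  using assms by (simp add: transpose0_mlt)

text \<open>The two sides of the axiom for \<open>F\<close>, evaluated at \<open>x\<close>, are the two sides of the axiom for the
  action: evaluation turns \<open>F(a) \<otimes> \<phi>\<^sub>b\<^sub>c\<close> into \<open>a \<star> \<psi>\<^sub>b\<^sub>c\<^sub>x\<close> and \<open>\<phi>\<^sub>a\<^sub>b \<otimes> F(c)\<close> into the component of \<open>\<psi>\<close> at \<open>a\<close>, \<open>b\<close>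
  and \<open>c \<star> x\<close>. The associativity of the endomorphism object is an identity and has no counterpart.\<close>

lemma lax_assoc_iff_act_assoc:
  assumes [simp]: "a \<in> cells1 A" "b \<in> cells1 A" "c \<in> cells1 A" "x \<in> cells1 A" "src A a = src A x"
    "src A b = src A x" "src A c = src A x" "trg A a = car M" "trg A b = car M" "trg A c = car M"
    "trg A x = X"
  shows "act_assoc_at P a b c x \<longleftrightarrow>
    ev \<rhd> \<llangle>(F \<rhd> (alph M \<lhd> \<langle>a, \<langle>b, c\<rangle>\<rangle>)) \<bullet> (\<phi> \<lhd> \<langle>a, ten M \<cdot> \<langle>b, c\<rangle>\<rangle>) \<bullet> (T \<rhd> \<llangle>id2 (F \<cdot> a), \<phi> \<lhd> \<langle>b, c\<rangle>\<rrangle>), id2 x\<rrangle> =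
    ev \<rhd> \<llangle>(\<phi> \<lhd> \<langle>ten M \<cdot> \<langle>a, b\<rangle>, c\<rangle>) \<bullet> (T \<rhd> \<llangle>\<phi> \<lhd> \<langle>a, b\<rangle>, id2 (F \<cdot> c)\<rrangle>), id2 x\<rrangle>"
  unfolding act_assoc_at_def Let_def
  by (simp add: endo_tensor_assoc)

lemma lax_lam_iff_act_lam:
  assumes [simp]: "a \<in> cells1 A" "x \<in> cells1 A" "src A a = src A x" "trg A a = car M" "trg A x = X"
  shows "act_lam_at P a x \<longleftrightarrow>
    ev \<rhd> \<llangle>(F \<rhd> (lam M \<lhd> a)) \<bullet> (\<phi> \<lhd> \<langle>unt M \<cdot> bang A (src A x), a\<rangle>) \<bullet>
      (T \<rhd> \<llangle>\<phi>0 \<lhd> bang A (src A x), id2 (F \<cdot> a)\<rrangle>), id2 x\<rrangle> = id2 (ev \<cdot> \<langle>F \<cdot> a, x\<rangle>)"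
  unfolding act_lam_at_def Let_def by simp

lemma lax_rho_iff_act_rho:
  assumes [simp]: "a \<in> cells1 A" "x \<in> cells1 A" "src A a = src A x" "trg A a = car M" "trg A x = X"
  shows "act_rho_at P a x \<longleftrightarrow>
    ev \<rhd> \<llangle>(F \<rhd> (rho M \<lhd> a)) \<bullet> (\<phi> \<lhd> \<langle>a, unt M \<cdot> bang A (src A x)\<rangle>) \<bullet>
      (T \<rhd> \<llangle>id2 (F \<cdot> a), \<phi>0 \<lhd> bang A (src A x)\<rrangle>), id2 x\<rrangle> = id2 (ev \<cdot> \<langle>F \<cdot> a, x\<rangle>)"
  unfolding act_rho_at_def Let_def by simp

lemma action_object_transpose0_if_mon1_cell:
  assumes r: "mon1_cell A r"
  shows "action_object A X P"
proof -
  have assoc: "act_assoc_at P a b c x" if [simp]: "a \<in> cells1 A" "b \<in> cells1 A" "c \<in> cells1 A"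
    "x \<in> cells1 A" "src A a = src A x" "src A b = src A x" "src A c = src A x" "trg A a = car M"
    "trg A b = car M" "trg A c = car M" "trg A x = X" for a b c x
  proof -
    have "lax_assoc_at r a b c" by (rule lax_assoc_elem[OF r]) simp_all
    then have "(F \<rhd> (alph M \<lhd> \<langle>a, \<langle>b, c\<rangle>\<rangle>)) \<bullet> (\<phi> \<lhd> \<langle>a, ten M \<cdot> \<langle>b, c\<rangle>\<rangle>) \<bullet> (T \<rhd> \<llangle>id2 (F \<cdot> a), \<phi> \<lhd> \<langle>b, c\<rangle>\<rrangle>) =
        (\<phi> \<lhd> \<langle>ten M \<cdot> \<langle>a, b\<rangle>, c\<rangle>) \<bullet> (T \<rhd> \<llangle>\<phi> \<lhd> \<langle>a, b\<rangle>, id2 (F \<cdot> c)\<rrangle>)"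
      by (simp add: lax_assoc_at_def Let_def endo_tensor_assoc)
    then show ?thesis by (subst lax_assoc_iff_act_assoc) simp_all
  qed
  have lam: "act_lam_at P a x" if [simp]: "a \<in> cells1 A" "x \<in> cells1 A" "src A a = src A x"
    "trg A a = car M" "trg A x = X" for a x
  proof -
    have "lax_lam_at r a" by (rule lax_unit_elem[OF r]) simp_all
    then have "(F \<rhd> (lam M \<lhd> a)) \<bullet> (\<phi> \<lhd> \<langle>unt M \<cdot> bang A (src A x), a\<rangle>) \<bullet>
      (T \<rhd> \<llangle>\<phi>0 \<lhd> bang A (src A x), id2 (F \<cdot> a)\<rrangle>) = id2 (F \<cdot> a)"
      unfolding lax_lam_at_def Let_def by simp
    then show ?thesis by (subst lax_lam_iff_act_lam) simp_all
  qed
  have rho: "act_rho_at P a x" if [simp]: "a \<in> cells1 A" "x \<in> cells1 A" "src A a = src A x"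
    "trg A a = car M" "trg A x = X" for a x
  proof -
    have "lax_rho_at r a" by (rule lax_unit_elem[OF r]) simp_all
    then have "(F \<rhd> (rho M \<lhd> a)) \<bullet> (\<phi> \<lhd> \<langle>a, unt M \<cdot> bang A (src A x)\<rangle>) \<bullet>
      (T \<rhd> \<llangle>id2 (F \<cdot> a), \<phi>0 \<lhd> bang A (src A x)\<rrangle>) = id2 (F \<cdot> a)"
      unfolding lax_rho_at_def Let_def by simp
    then show ?thesis by (subst lax_rho_iff_act_rho) simp_all
  qed
  show ?thesis
    by (subst action_object_iff) (simp_all add: transpose0_mlt assoc lam rho)
qed

text \<open>The axioms of the action are used at \<open>src A a \<^bold>\<times> X\<close>, with its second projection as \<open>x\<close>. There
  evaluation is injective.\<close>

lemma mon1_cell_if_action_object_transpose0: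
  assumes P: "action_object A X P"
  shows "mon1_cell A r"
proof (rule mon1_cellI)
  fix a b c assume "a \<in> cells1 A" "b \<in> cells1 A" "c \<in> cells1 A" "src A b = src A a" "src A c = src A a"
    "trg A a = car (csrc r)" "trg A b = car (csrc r)" "trg A c = car (csrc r)"
  then have [simp]: "a \<in> cells1 A" "b \<in> cells1 A" "c \<in> cells1 A" "src A b = src A a" "src A c = src A a"
    "trg A a = car M" "trg A b = car M" "trg A c = car M" by simp_all
  let ?p = "pr1 A (src A a) X" and ?x = "pr2 A (src A a) X"
  have at: "act_assoc_at P (a \<cdot> ?p) (b \<cdot> ?p) (c \<cdot> ?p) ?x"
    by (rule act_assoc_elem[OF P]) simp_all
  have gen: "ev \<rhd> \<llangle>(F \<rhd> (alph M \<lhd> \<langle>a \<cdot> ?p, \<langle>b \<cdot> ?p, c \<cdot> ?p\<rangle>\<rangle>)) \<bullet>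
        (\<phi> \<lhd> \<langle>a \<cdot> ?p, ten M \<cdot> \<langle>b \<cdot> ?p, c \<cdot> ?p\<rangle>\<rangle>) \<bullet> (T \<rhd> \<llangle>id2 (F \<cdot> a \<cdot> ?p), \<phi> \<lhd> \<langle>b \<cdot> ?p, c \<cdot> ?p\<rangle>\<rrangle>), id2 ?x\<rrangle> =
      ev \<rhd> \<llangle>(\<phi> \<lhd> \<langle>ten M \<cdot> \<langle>a \<cdot> ?p, b \<cdot> ?p\<rangle>, c \<cdot> ?p\<rangle>) \<bullet>
        (T \<rhd> \<llangle>\<phi> \<lhd> \<langle>a \<cdot> ?p, b \<cdot> ?p\<rangle>, id2 (F \<cdot> c \<cdot> ?p)\<rrangle>), id2 ?x\<rrangle>"
    by (rule lax_assoc_iff_act_assoc[THEN iffD1]) (simp_all add: at)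
  have "(F \<rhd> (alph M \<lhd> \<langle>a, \<langle>b, c\<rangle>\<rangle>)) \<bullet> (\<phi> \<lhd> \<langle>a, ten M \<cdot> \<langle>b, c\<rangle>\<rangle>) \<bullet> (T \<rhd> \<llangle>id2 (F \<cdot> a), \<phi> \<lhd> \<langle>b, c\<rangle>\<rrangle>) =
      (\<phi> \<lhd> \<langle>ten M \<cdot> \<langle>a, b\<rangle>, c\<rangle>) \<bullet> (T \<rhd> \<llangle>\<phi> \<lhd> \<langle>a, b\<rangle>, id2 (F \<cdot> c)\<rrangle>)" (is "?L = ?R")
  proof (rule app2_inject[where e = "src A a"])
    have 1: "?L \<lhd> ?p = (F \<rhd> (alph M \<lhd> \<langle>a \<cdot> ?p, \<langle>b \<cdot> ?p, c \<cdot> ?p\<rangle>\<rangle>)) \<bullet>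
        (\<phi> \<lhd> \<langle>a \<cdot> ?p, ten M \<cdot> \<langle>b \<cdot> ?p, c \<cdot> ?p\<rangle>\<rangle>) \<bullet> (T \<rhd> \<llangle>id2 (F \<cdot> a \<cdot> ?p), \<phi> \<lhd> \<langle>b \<cdot> ?p, c \<cdot> ?p\<rangle>\<rrangle>)"
      by (subst whisker_right_vcomp3) simp_all
    have 2: "?R \<lhd> ?p = (\<phi> \<lhd> \<langle>ten M \<cdot> \<langle>a \<cdot> ?p, b \<cdot> ?p\<rangle>, c \<cdot> ?p\<rangle>) \<bullet>
        (T \<rhd> \<llangle>\<phi> \<lhd> \<langle>a \<cdot> ?p, b \<cdot> ?p\<rangle>, id2 (F \<cdot> c \<cdot> ?p)\<rrangle>)"
      by (simp add: endo_tensor_assoc)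
    show "ev \<rhd> \<llangle>?L \<lhd> ?p, id2 ?x\<rrangle> = ev \<rhd> \<llangle>?R \<lhd> ?p, id2 ?x\<rrangle>"
      unfolding 1 2 by (rule gen)
  qed (simp_all add: endo_tensor_assoc)
  then show "lax_assoc_at r a b c"
    by (simp add: lax_assoc_at_def Let_def endo_tensor_assoc)
next
  fix a assume "a \<in> cells1 A" "trg A a = car (csrc r)"
  then have [simp]: "a \<in> cells1 A" "trg A a = car M" by simp_all
  let ?e = "src A a"
  let ?p = "pr1 A ?e X" and ?x = "pr2 A ?e X"
  have at: "act_lam_at P (a \<cdot> ?p) ?x"
    by (rule act_unit_elem[OF P]) simp_all
  have gen: "ev \<rhd> \<llangle>(F \<rhd> (lam M \<lhd> (a \<cdot> ?p))) \<bullet> (\<phi> \<lhd> \<langle>unt M \<cdot> bang A (src A ?x), a \<cdot> ?p\<rangle>) \<bullet>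
      (T \<rhd> \<llangle>\<phi>0 \<lhd> bang A (src A ?x), id2 (F \<cdot> a \<cdot> ?p)\<rrangle>), id2 ?x\<rrangle> = id2 (ev \<cdot> \<langle>F \<cdot> a \<cdot> ?p, ?x\<rangle>)"
    by (rule lax_lam_iff_act_lam[THEN iffD1]) (simp_all add: at)
  have "(F \<rhd> (lam M \<lhd> a)) \<bullet> (\<phi> \<lhd> \<langle>unt M \<cdot> bang A ?e, a\<rangle>) \<bullet>
      (T \<rhd> \<llangle>\<phi>0 \<lhd> bang A ?e, id2 (F \<cdot> a)\<rrangle>) = id2 (F \<cdot> a)" (is "?L = ?R")
  proof (rule app2_inject[where e = ?e])
    have 1: "?L \<lhd> ?p = (F \<rhd> (lam M \<lhd> (a \<cdot> ?p))) \<bullet> (\<phi> \<lhd> \<langle>unt M \<cdot> bang A (src A ?x), a \<cdot> ?p\<rangle>) \<bullet>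
      (T \<rhd> \<llangle>\<phi>0 \<lhd> bang A (src A ?x), id2 (F \<cdot> a \<cdot> ?p)\<rrangle>)"
      by (subst whisker_right_vcomp3) simp_all
    show "ev \<rhd> \<llangle>?L \<lhd> ?p, id2 ?x\<rrangle> = ev \<rhd> \<llangle>?R \<lhd> ?p, id2 ?x\<rrangle>"
      unfolding 1 gen by simp
  qed simp_all
  then show "lax_lam_at r a"
    by (simp add: lax_lam_at_def Let_def)
  have at: "act_rho_at P (a \<cdot> ?p) ?x"
    by (rule act_unit_elem[OF P]) simp_all
  have gen: "ev \<rhd> \<llangle>(F \<rhd> (rho M \<lhd> (a \<cdot> ?p))) \<bullet> (\<phi> \<lhd> \<langle>a \<cdot> ?p, unt M \<cdot> bang A (src A ?x)\<rangle>) \<bullet>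
      (T \<rhd> \<llangle>id2 (F \<cdot> a \<cdot> ?p), \<phi>0 \<lhd> bang A (src A ?x)\<rrangle>), id2 ?x\<rrangle> = id2 (ev \<cdot> \<langle>F \<cdot> a \<cdot> ?p, ?x\<rangle>)"
    by (rule lax_rho_iff_act_rho[THEN iffD1]) (simp_all add: at)
  have "(F \<rhd> (rho M \<lhd> a)) \<bullet> (\<phi> \<lhd> \<langle>a, unt M \<cdot> bang A ?e\<rangle>) \<bullet>
      (T \<rhd> \<llangle>id2 (F \<cdot> a), \<phi>0 \<lhd> bang A ?e\<rrangle>) = id2 (F \<cdot> a)" (is "?L = ?R")
  proof (rule app2_inject[where e = ?e])
    have 1: "?L \<lhd> ?p = (F \<rhd> (rho M \<lhd> (a \<cdot> ?p))) \<bullet> (\<phi> \<lhd> \<langle>a \<cdot> ?p, unt M \<cdot> bang A (src A ?x)\<rangle>) \<bullet>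
      (T \<rhd> \<llangle>id2 (F \<cdot> a \<cdot> ?p), \<phi>0 \<lhd> bang A (src A ?x)\<rrangle>)"
      by (subst whisker_right_vcomp3) simp_all
    show "ev \<rhd> \<llangle>?L \<lhd> ?p, id2 ?x\<rrangle> = ev \<rhd> \<llangle>?R \<lhd> ?p, id2 ?x\<rrangle>"
      unfolding 1 gen by simp
  qed simp_all
  then show "lax_rho_at r a"
    by (simp add: lax_rho_at_def Let_def)
qed simp_all

end

lemma mon1_cell_collapse:
  assumes r: "mon1_cell A r" "ctrg r = E"
  shows "r = Cell (csrc r) E (LaxData (und (body r)) (mlt (body r)) (ult (body r)))"
  using r(2) by (intro cell.expand) simp

lemma representation_cell:
  assumes r: "mon1_cell A r" "ctrg r = E"
  defines "M \<equiv> csrc r" and "F \<equiv> und (body r)" and "\<phi> \<equiv> mlt (body r)" and "\<phi>0 \<equiv> ult (body r)"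
  shows "monoidal_object A M" "F \<in> cells1 A" "src A F = car M" "trg A F = XX"
    "\<phi> \<in> cells2 A" "src2 A \<phi> = car M \<^bold>\<times> car M" "trg2 A \<phi> = XX"
    "Dom A \<phi> = T \<cdot> \<langle>F \<cdot> pr1 A (car M) (car M), F \<cdot> pr2 A (car M) (car M)\<rangle>" "Cod A \<phi> = F \<cdot> ten M"
    "\<phi>0 \<in> cells2 A" "src2 A \<phi>0 = \<one>" "trg2 A \<phi>0 = XX" "Dom A \<phi>0 = J" "Cod A \<phi>0 = F \<cdot> unt M"
  using r unfolding M_def F_def \<phi>_def \<phi>0_def by simp_all

lemma action_object_transpose0:
  assumes r: "mon1_cell A r" "ctrg r = E"
  shows "action_object A X (transpose0 A X XX cur1 r)"
proof -
  note eq = mon1_cell_collapse[OF r]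
  show ?thesis
    using action_object_transpose0_if_mon1_cell[OF representation_cell[OF r]] r(1)
    unfolding eq[symmetric] by blast
qed

lemma transpose0_inject:
  assumes r: "mon1_cell A r" "ctrg r = E" and r': "mon1_cell A r'" "ctrg r' = E"
    and eq: "transpose0 A X XX cur1 r = transpose0 A X XX cur1 r'"
  shows "r = r'"
proof -
  let ?M = "csrc r"
  let ?C = "car ?M"
  note R = representation_cell[OF r] and R' = representation_cell[OF r']
  note sel = transpose0_sel[OF R, folded mon1_cell_collapse[OF r]]
    and sel' = transpose0_sel[OF R', folded mon1_cell_collapse[OF r']]
  have M [simp]: "csrc r' = ?M" using sel(1) sel'(1) eq by simp
  note [simp] = R R'[unfolded M]
  have F: "und (body r') = und (body r)"
    by (rule app_inject[where e = ?C]) (use sel(2) sel'(2) eq in simp_all)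
  have "mlt (body r) = mlt (body r')"
  proof (rule app2_inject[where e = "?C \<^bold>\<times> ?C"])
    let ?q = "pr1 A (?C \<^bold>\<times> ?C) X" and ?x = "pr2 A (?C \<^bold>\<times> ?C) X"
    have 1: "amlt (transpose0 A X XX cur1 r) \<lhd> \<langle>pr1 A ?C ?C \<cdot> ?q, \<langle>pr2 A ?C ?C \<cdot> ?q, ?x\<rangle>\<rangle> =
        ev \<rhd> \<llangle>mlt (body r) \<lhd> ?q, id2 ?x\<rrangle>"
      by (subst transpose0_mlt_at[OF R, folded mon1_cell_collapse[OF r]]) simp_all
    have 2: "amlt (transpose0 A X XX cur1 r') \<lhd> \<langle>pr1 A ?C ?C \<cdot> ?q, \<langle>pr2 A ?C ?C \<cdot> ?q, ?x\<rangle>\<rangle> =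
        ev \<rhd> \<llangle>mlt (body r') \<lhd> ?q, id2 ?x\<rrangle>"
      by (subst transpose0_mlt_at[OF R', folded mon1_cell_collapse[OF r']]) simp_all
    show "ev \<rhd> \<llangle>mlt (body r) \<lhd> ?q, id2 ?x\<rrangle> = ev \<rhd> \<llangle>mlt (body r') \<lhd> ?q, id2 ?x\<rrangle>"
      using 1 2 eq by simp
  qed simp_all
  moreover have "ult (body r) = ult (body r')"
    by (rule app2_inject_global) (use sel(3) sel'(3) eq in simp_all)
  ultimately show ?thesis
    using F r(2) r'(2) by (intro mon1_eqI) simp_all
qed

text \<open>\<open>F\<close> is the transpose of the action 1-cell. The transposes of \<open>\<psi>\<close> and of the unit are formed after
  reassociating \<open>C \<^bold>\<times> C \<^bold>\<times> X\<close> to \<open>(C \<^bold>\<times> C) \<^bold>\<times> X\<close> and replacing \<open>X\<close> by \<open>\<one> \<^bold>\<times> X\<close>.\<close>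

lemma transpose0_surj:
  assumes P: "action_object A X P"
  obtains r where "mon1_cell A r" "ctrg r = E" "transpose0 A X XX cur1 r = P"
proof -
  let ?M = "amon P"
  let ?C = "car ?M"
  let ?q = "pr1 A (?C \<^bold>\<times> ?C) X" and ?x = "pr2 A (?C \<^bold>\<times> ?C) X"
  let ?a = "pr1 A ?C ?C \<cdot> ?q" and ?b = "pr2 A ?C ?C \<cdot> ?q"
  note [simp] = P
  define F where "F = cur1 ?C (act P)"
  have F [simp]: "F \<in> cells1 A" "src A F = ?C" "trg A F = XX"
    unfolding F_def by (rule cur1_cell; simp)+
  have act: "ev \<cdot> \<langle>F \<cdot> pr1 A ?C X, pr2 A ?C X\<rangle> = act P"
    unfolding F_def by (rule app_cur1) simp_all
  have act_at: "act P \<cdot> \<langle>a, x\<rangle> = ev \<cdot> \<langle>F \<cdot> a, x\<rangle>" if [simp]: "a \<in> cells1 A" "x \<in> cells1 A"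
    "src A a = src A x" "trg A a = ?C" "trg A x = X" for a x
    unfolding act[symmetric] by simp
  obtain \<phi> where \<phi> [simp]: "\<phi> \<in> cells2 A" "Dom A \<phi> = T \<cdot> \<langle>F \<cdot> pr1 A ?C ?C, F \<cdot> pr2 A ?C ?C\<rangle>"
    "Cod A \<phi> = F \<cdot> ten ?M" "src2 A \<phi> = ?C \<^bold>\<times> ?C" "trg2 A \<phi> = XX"
    and app_\<phi>: "ev \<rhd> \<llangle>\<phi> \<lhd> ?q, id2 ?x\<rrangle> = amlt P \<lhd> \<langle>?a, \<langle>?b, ?x\<rangle>\<rangle>"
  proof (rule obtain_curried2[where e = "?C \<^bold>\<times> ?C" and s = "amlt P \<lhd> \<langle>?a, \<langle>?b, ?x\<rangle>\<rangle>"
        and F = "T \<cdot> \<langle>F \<cdot> pr1 A ?C ?C, F \<cdot> pr2 A ?C ?C\<rangle>" and G = "F \<cdot> ten ?M"])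
    show "Dom A (amlt P \<lhd> \<langle>?a, \<langle>?b, ?x\<rangle>\<rangle>) =
        ev \<cdot> \<langle>(T \<cdot> \<langle>F \<cdot> pr1 A ?C ?C, F \<cdot> pr2 A ?C ?C\<rangle>) \<cdot> ?q, ?x\<rangle>"
      by (simp add: act_at)
    show "Cod A (amlt P \<lhd> \<langle>?a, \<langle>?b, ?x\<rangle>\<rangle>) = ev \<cdot> \<langle>(F \<cdot> ten ?M) \<cdot> ?q, ?x\<rangle>"
      by (simp add: act_at)
  qed (simp_all)
  obtain \<phi>0 where \<phi>0 [simp]: "\<phi>0 \<in> cells2 A" "Dom A \<phi>0 = J" "Cod A \<phi>0 = F \<cdot> unt ?M" "src2 A \<phi>0 = \<one>"
    "trg2 A \<phi>0 = XX" and app_\<phi>0: "ev \<rhd> \<llangle>\<phi>0 \<lhd> pr1 A \<one> X, id2 (pr2 A \<one> X)\<rrangle> = ault P \<lhd> pr2 A \<one> X"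
  proof (rule obtain_curried2[where e = \<one> and s = "ault P \<lhd> pr2 A \<one> X" and F = J and G = "F \<cdot> unt ?M"])
    have p: "pr1 A \<one> X = bang A (\<one> \<^bold>\<times> X)" using bang_unique[of "pr1 A \<one> X"] by simp
    show "Dom A (ault P \<lhd> pr2 A \<one> X) = ev \<cdot> \<langle>J \<cdot> pr1 A \<one> X, pr2 A \<one> X\<rangle>" by (simp add: p)
    show "Cod A (ault P \<lhd> pr2 A \<one> X) = ev \<cdot> \<langle>(F \<cdot> unt ?M) \<cdot> pr1 A \<one> X, pr2 A \<one> X\<rangle>"
      by (simp add: p act_at)
  qed simp_all
  define r where "r = Cell ?M E (LaxData F \<phi> \<phi>0)"
  have M: "monoidal_object A ?M" by simp
  note facts = M F \<phi>(1,4,5,2,3) \<phi>0(1,4,5,2,3)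
  have "amlt (transpose0 A X XX cur1 r) = amlt P"
  proof -
    let ?u = "\<langle>\<langle>pr1 A ?C (?C \<^bold>\<times> X), pr1 A ?C X \<cdot> pr2 A ?C (?C \<^bold>\<times> X)\<rangle>, pr2 A ?C X \<cdot> pr2 A ?C (?C \<^bold>\<times> X)\<rangle>"
    \<comment> \<open>\<open>?u\<close> is the inverse of the reassociation by which \<open>\<phi>\<close> was formed\<close>
    have "amlt (transpose0 A X XX cur1 r) = (ev \<rhd> \<llangle>\<phi> \<lhd> ?q, id2 ?x\<rrangle>) \<lhd> ?u"
      unfolding r_def transpose0_mlt[OF facts] by simp
    also have "\<dots> = amlt P" unfolding app_\<phi> by simp
    finally show ?thesis .
  qed
  moreover have "ault (transpose0 A X XX cur1 r) = ault P"
  proof -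
    have "ault (transpose0 A X XX cur1 r) = (ev \<rhd> \<llangle>\<phi>0 \<lhd> pr1 A \<one> X, id2 (pr2 A \<one> X)\<rrangle>) \<lhd> \<langle>bang A X, id1 X\<rangle>"
      unfolding r_def transpose0_sel[OF facts] by simp
    also have "\<dots> = ault P" unfolding app_\<phi>0 by simp
    finally show ?thesis .
  qed
  ultimately have eq: "transpose0 A X XX cur1 r = P"
    using act by (intro actobj.expand) (simp add: r_def transpose0_sel[OF facts])
  moreover have "mon1_cell A r"
    using mon1_cell_if_action_object_transpose0[OF facts] P eq unfolding r_def by simp
  ultimately show ?thesis
    using that[of r] by (simp add: r_def)
qed

lemma transpose0_simps [simp]:
  assumes r: "mon1_cell A r" "ctrg r = E"
  shows "amon (transpose0 A X XX cur1 r) = csrc r"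
    "act (transpose0 A X XX cur1 r) =
       ev \<cdot> \<langle>und (body r) \<cdot> pr1 A (car (csrc r)) X, pr2 A (car (csrc r)) X\<rangle>"
    "ault (transpose0 A X XX cur1 r) = ev \<rhd> \<llangle>ult (body r) \<lhd> bang A X, id2 (id1 X)\<rrangle>"
  using transpose0_sel[OF representation_cell[OF r]] unfolding mon1_cell_collapse[OF r, symmetric] .

lemma transpose0_mlt_simp [simp]:
  assumes r: "mon1_cell A r" "ctrg r = E"
    and ab: "a \<in> cells1 A" "b \<in> cells1 A" "x \<in> cells1 A" "src A a = src A x" "src A b = src A x"
    "trg A a = car (csrc r)" "trg A b = car (csrc r)" "trg A x = X"
  shows "amlt (transpose0 A X XX cur1 r) \<lhd> \<langle>a, \<langle>b, x\<rangle>\<rangle> = ev \<rhd> \<llangle>mlt (body r) \<lhd> \<langle>a, b\<rangle>, id2 x\<rrangle>"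
  using transpose0_mlt_at[OF representation_cell[OF r] ab] unfolding mon1_cell_collapse[OF r, symmetric] .

section \<open>Transposition of 1-cells\<close>

text \<open>As for 0-cells, \<open>\<tau>\<close> has the type of a 2-cell from \<open>r' L\<close> to \<open>r\<close>, and is not assumed to be
  monoidal. Then \<open>lhs a b\<close> and \<open>rhs a b\<close> are the two sides of the multiplication axiom at \<open>a\<close>, \<open>b\<close>.\<close>

context
  fixes r r' L :: "('o, 'a, 'c) mon1" and \<tau> :: 'c
  assumes r [simp]: "mon1_cell A r" "ctrg r = E" and r' [simp]: "mon1_cell A r'" "ctrg r' = E"
    and L [simp]: "mon1_cell A L" "csrc L = csrc r" "ctrg L = csrc r'"
    and \<tau> [simp]: "\<tau> \<in> cells2 A" "Dom A \<tau> = und (body r') \<cdot> und (body L)" "Cod A \<tau> = und (body r)"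
      "src2 A \<tau> = car (csrc r)" "trg2 A \<tau> = XX"
begin

private abbreviation C :: 'o where "C \<equiv> car (csrc r)"
private abbreviation Q :: "('o, 'a, 'c) actobj" where "Q \<equiv> transpose0 A X XX cur1 r"
private abbreviation Q' :: "('o, 'a, 'c) actobj" where "Q' \<equiv> transpose0 A X XX cur1 r'"
private abbreviation \<xi> :: 'c where "\<xi> \<equiv> ev \<rhd> \<llangle>\<tau> \<lhd> pr1 A C X, id2 (pr2 A C X)\<rrangle>"

private definition lhs :: "'a \<Rightarrow> 'a \<Rightarrow> 'c" where
  "lhs a b = (\<tau> \<lhd> ten (csrc r) \<cdot> \<langle>a, b\<rangle>) \<bullet> (und (body r') \<rhd> (mlt (body L) \<lhd> \<langle>a, b\<rangle>)) \<bullet>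
     (mlt (body r') \<lhd> \<langle>und (body L) \<cdot> a, und (body L) \<cdot> b\<rangle>)"

private definition rhs :: "'a \<Rightarrow> 'a \<Rightarrow> 'c" where
  "rhs a b = (mlt (body r) \<lhd> \<langle>a, b\<rangle>) \<bullet> (T \<rhd> \<llangle>\<tau> \<lhd> a, \<tau> \<lhd> b\<rrangle>)"

lemma trans_sides:
  assumes [simp]: "a \<in> cells1 A" "b \<in> cells1 A" "src A a = src A b" "trg A a = C" "trg A b = C"
  shows "lhs a b \<in> cells2 A" "src2 A (lhs a b) = src A b" "trg2 A (lhs a b) = XX"
    "rhs a b \<in> cells2 A" "src2 A (rhs a b) = src A b" "trg2 A (rhs a b) = XX"
    "\<lbrakk>u \<in> cells1 A; trg A u = src A b\<rbrakk> \<Longrightarrow> lhs a b \<lhd> u = lhs (a \<cdot> u) (b \<cdot> u)"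
    "\<lbrakk>u \<in> cells1 A; trg A u = src A b\<rbrakk> \<Longrightarrow> rhs a b \<lhd> u = rhs (a \<cdot> u) (b \<cdot> u)"
  unfolding lhs_def rhs_def by simp_all

lemma trans_at_iff_sides:
  assumes [simp]: "a \<in> cells1 A" "b \<in> cells1 A" "src A a = src A b" "trg A a = C" "trg A b = C"
  shows "trans_at (Cell (mon_comp1 A r' L) r \<tau>) a b \<longleftrightarrow> lhs a b = rhs a b"
  unfolding lhs_def rhs_def by (simp add: trans_at_def Let_def)

lemma app_lhs:
  assumes [simp]: "a \<in> cells1 A" "b \<in> cells1 A" "x \<in> cells1 A" "src A a = src A x" "src A b = src A x"
    "trg A a = C" "trg A b = C" "trg A x = X"
  shows "ev \<rhd> \<llangle>lhs a b, id2 x\<rrangle> = (\<xi> \<lhd> \<langle>ten (csrc r) \<cdot> \<langle>a, b\<rangle>, x\<rangle>) \<bullet>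
    (act Q' \<rhd> \<llangle>mlt (body L) \<lhd> \<langle>a, b\<rangle>, id2 x\<rrangle>) \<bullet>
    (amlt Q' \<lhd> \<langle>und (body L) \<cdot> a, \<langle>und (body L) \<cdot> b, x\<rangle>\<rangle>)"
  unfolding lhs_def by simp

text \<open>The tensor \<open>\<tau>\<^sub>a \<otimes> \<tau>\<^sub>b\<close> evaluates to \<open>\<tau>\<^sub>a(\<tau>\<^sub>b(x))\<close>, which interchange splits into the component of \<open>\<xi>\<close> at
  \<open>a\<close> and \<open>b \<star> x\<close> after \<open>L(a) \<star>' \<xi>\<^sub>b\<^sub>x\<close>.\<close>

lemma app_rhs:
  assumes [simp]: "a \<in> cells1 A" "b \<in> cells1 A" "x \<in> cells1 A" "src A a = src A x" "src A b = src A x"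
    "trg A a = C" "trg A b = C" "trg A x = X"
  shows "ev \<rhd> \<llangle>rhs a b, id2 x\<rrangle> = (amlt Q \<lhd> \<langle>a, \<langle>b, x\<rangle>\<rangle>) \<bullet> (\<xi> \<lhd> \<langle>a, act Q \<cdot> \<langle>b, x\<rangle>\<rangle>) \<bullet>
    (act Q' \<rhd> \<llangle>id2 (und (body L) \<cdot> a), \<xi> \<lhd> \<langle>b, x\<rangle>\<rrangle>)"
proof -
  let ?b = "ev \<rhd> \<llangle>\<tau> \<lhd> b, id2 x\<rrangle>"
  have "\<llangle>\<tau> \<lhd> a, ?b\<rrangle> = \<llangle>\<tau> \<lhd> a, id2 (Cod A ?b)\<rrangle> \<bullet> \<llangle>id2 (Dom A (\<tau> \<lhd> a)), ?b\<rrangle>"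
    by (subst pair2_vcomp) simp_all
  then have "ev \<rhd> \<llangle>\<tau> \<lhd> a, ?b\<rrangle> = (ev \<rhd> \<llangle>\<tau> \<lhd> a, id2 (Cod A ?b)\<rrangle>) \<bullet> (ev \<rhd> \<llangle>id2 (Dom A (\<tau> \<lhd> a)), ?b\<rrangle>)"
    by simp
  then show ?thesis
    unfolding rhs_def by simp
qed

definition transposed1 :: "('o, 'a, 'c) act1" where
  "transposed1 = Cell Q Q' (L, \<xi>)"

text \<open>Both axioms of a 1-cell of actions are evaluations of an axiom of a monoidal transformation; for
  the unit axiom the evaluation at the identity of \<open>X\<close> is already cancelled.\<close>

lemma act1_cell_iff_sides:
  "act1_cell A X transposed1 \<longleftrightarrow>
    (ev \<rhd> \<llangle>lhs (pr1 A C (C \<^bold>\<times> X)) (pr1 A C X \<cdot> pr2 A C (C \<^bold>\<times> X)), id2 (pr2 A C X \<cdot> pr2 A C (C \<^bold>\<times> X))\<rrangle> =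
     ev \<rhd> \<llangle>rhs (pr1 A C (C \<^bold>\<times> X)) (pr1 A C X \<cdot> pr2 A C (C \<^bold>\<times> X)), id2 (pr2 A C X \<cdot> pr2 A C (C \<^bold>\<times> X))\<rrangle>) \<and>
    (\<tau> \<lhd> unt (csrc r)) \<bullet> (und (body r') \<rhd> ult (body L)) \<bullet> ult (body r') = ult (body r)"
proof -
  let ?I = "unt (csrc r) \<cdot> bang A X"
  have Q: "action_object A X Q" "action_object A X Q'"
    by (rule action_object_transpose0; simp)+
  have \<xi>: "\<xi> \<in> hom2 A (act Q' \<cdot> \<langle>und (body L) \<cdot> pr1 A C X, pr2 A C X\<rangle>) (act Q \<cdot> \<langle>pr1 A C X, pr2 A C X\<rangle>)"
    by (simp add: hom2_iff)
  have unit: "(\<xi> \<lhd> \<langle>?I, id1 X\<rangle>) \<bullet> (act Q' \<rhd> \<llangle>ult (body L) \<lhd> bang A X, id2 (id1 X)\<rrangle>) \<bullet> ault Q' = ault Q \<longleftrightarrow>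
      (\<tau> \<lhd> unt (csrc r)) \<bullet> (und (body r') \<rhd> ult (body L)) \<bullet> ult (body r') = ult (body r)" (is "?l \<longleftrightarrow> ?s = _")
  proof -
    have "(\<xi> \<lhd> \<langle>?I, id1 X\<rangle>) \<bullet> (act Q' \<rhd> \<llangle>ult (body L) \<lhd> bang A X, id2 (id1 X)\<rrangle>) \<bullet> ault Q' =
        ev \<rhd> \<llangle>?s \<lhd> bang A X, id2 (id1 X)\<rrangle>"
      by simp
    moreover have "ault Q = ev \<rhd> \<llangle>ult (body r) \<lhd> bang A X, id2 (id1 X)\<rrangle>" by simp
    moreover have "?s = ult (body r)"
      if "ev \<rhd> \<llangle>?s \<lhd> bang A X, id2 (id1 X)\<rrangle> = ev \<rhd> \<llangle>ult (body r) \<lhd> bang A X, id2 (id1 X)\<rrangle>"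
      by (rule app2_inject_global[OF _ _ _ _ _ _ that]) simp_all
    ultimately show ?thesis by metis
  qed
  let ?a = "pr1 A C (C \<^bold>\<times> X)" and ?b = "pr1 A C X \<cdot> pr2 A C (C \<^bold>\<times> X)" and ?x = "pr2 A C X \<cdot> pr2 A C (C \<^bold>\<times> X)"
  have sides: "ev \<rhd> \<llangle>lhs ?a ?b, id2 ?x\<rrangle> = (\<xi> \<lhd> \<langle>ten (csrc r) \<cdot> \<langle>?a, ?b\<rangle>, ?x\<rangle>) \<bullet>
      (act Q' \<rhd> \<llangle>mlt (body L) \<lhd> \<langle>?a, ?b\<rangle>, id2 ?x\<rrangle>) \<bullet>
      (amlt Q' \<lhd> \<langle>und (body L) \<cdot> ?a, \<langle>und (body L) \<cdot> ?b, ?x\<rangle>\<rangle>)"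
    "ev \<rhd> \<llangle>rhs ?a ?b, id2 ?x\<rrangle> = (amlt Q \<lhd> \<langle>?a, \<langle>?b, ?x\<rangle>\<rangle>) \<bullet> (\<xi> \<lhd> \<langle>?a, act Q \<cdot> \<langle>?b, ?x\<rangle>\<rangle>) \<bullet>
      (act Q' \<rhd> \<llangle>id2 (und (body L) \<cdot> ?a), \<xi> \<lhd> \<langle>?b, ?x\<rangle>\<rrangle>)"
    by (rule app_lhs; simp) (rule app_rhs; simp)
  show ?thesis
    unfolding sides unit[symmetric]
    unfolding act1_cell_def Let_def transposed1_def cell.sel prod.case vars2_def vars3_def ap1_def ap2_def
      at2_def at3_def const1_def transpose0_simps(1)[OF r] transpose0_simps(1)[OF r']
    using Q \<xi> L by blast
qed

text \<open>From right to left the equation holds at all elements, in particular at the projections of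
  \<open>C \<^bold>\<times> C \<^bold>\<times> X\<close>. From left to right it is substituted along \<open>\<langle>a, \<langle>b, x\<rangle>\<rangle>\<close> for the generic element \<open>x\<close>
  over the common source of \<open>a\<close> and \<open>b\<close>, where evaluation cancels.\<close>

lemma act1_cell_transposed1_iff:
  "act1_cell A X transposed1 \<longleftrightarrow> mon2_cell A (Cell (mon_comp1 A r' L) r \<tau>)" (is "_ \<longleftrightarrow> mon2_cell A ?\<theta>")
proof
  assume \<theta>: "mon2_cell A ?\<theta>"
  have "trans_at ?\<theta> a b" if "a \<in> cells1 A" "b \<in> cells1 A" "src A a = src A b" "trg A a = C" "trg A b = C" for a b
    by (rule trans_elem[OF \<theta>]) (use that in simp_all)
  then have "lhs a b = rhs a b" if "a \<in> cells1 A" "b \<in> cells1 A" "src A a = src A b" "trg A a = C" "trg A b = C" for a b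
    using that trans_at_iff_sides by blast
  moreover have "(\<tau> \<lhd> unt (csrc r)) \<bullet> (und (body r') \<rhd> ult (body L)) \<bullet> ult (body r') = ult (body r)"
    using mon2_cell_unit[OF \<theta>] by simp
  ultimately show "act1_cell A X transposed1"
    unfolding act1_cell_iff_sides by simp
next
  assume f: "act1_cell A X transposed1"
  have unit: "(\<tau> \<lhd> unt (csrc r)) \<bullet> (und (body r') \<rhd> ult (body L)) \<bullet> ult (body r') = ult (body r)"
    using f unfolding act1_cell_iff_sides by blast
  have "trans_at ?\<theta> a b" if [simp]: "a \<in> cells1 A" "b \<in> cells1 A" "src A a = src A b" "trg A a = C" "trg A b = C" for a b
  proof -
    let ?p = "pr1 A (src A b) X" and ?x = "pr2 A (src A b) X"
    let ?u = "\<langle>a \<cdot> ?p, \<langle>b \<cdot> ?p, ?x\<rangle>\<rangle>"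
    let ?a = "pr1 A C (C \<^bold>\<times> X)" and ?b = "pr1 A C X \<cdot> pr2 A C (C \<^bold>\<times> X)" and ?y = "pr2 A C X \<cdot> pr2 A C (C \<^bold>\<times> X)"
    have gen: "ev \<rhd> \<llangle>lhs ?a ?b, id2 ?y\<rrangle> = ev \<rhd> \<llangle>rhs ?a ?b, id2 ?y\<rrangle>"
      using f unfolding act1_cell_iff_sides by blast
    have 1: "(ev \<rhd> \<llangle>lhs ?a ?b, id2 ?y\<rrangle>) \<lhd> ?u = ev \<rhd> \<llangle>lhs a b \<lhd> ?p, id2 ?x\<rrangle>"
      "(ev \<rhd> \<llangle>rhs ?a ?b, id2 ?y\<rrangle>) \<lhd> ?u = ev \<rhd> \<llangle>rhs a b \<lhd> ?p, id2 ?x\<rrangle>"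
      by (simp_all add: trans_sides)
    have "lhs a b = rhs a b"
      by (rule app2_inject[where e = "src A b"]) (simp_all add: trans_sides(1-6) 1[symmetric] gen)
    then show ?thesis by (simp add: trans_at_iff_sides)
  qed
  then show "mon2_cell A ?\<theta>"
    using unit by (intro mon2_cellI) simp_all
qed

end

lemma slice0_cell_Mon_l: "slice0_cell (Mon_l A) E r \<longleftrightarrow> mon1_cell A r \<and> ctrg r = E"
  by (simp add: slice0_cell_def)

lemma slice1_cell_Mon_l:
  "slice1_cell (Mon_l A) E f \<longleftrightarrow>
    mon1_cell A (csrc f) \<and> ctrg (csrc f) = E \<and> mon1_cell A (ctrg f) \<and> ctrg (ctrg f) = E \<and>
    mon1_cell A (fst (body f)) \<and> csrc (fst (body f)) = csrc (csrc f) \<and> ctrg (fst (body f)) = csrc (ctrg f) \<and>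
    mon2_cell A (snd (body f)) \<and> csrc (snd (body f)) = mon_comp1 A (ctrg f) (fst (body f)) \<and>
    ctrg (snd (body f)) = csrc f"
  unfolding slice1_cell_def slice0_cell_def hom1_def hom2_def Let_def split_def by auto

lemma slice1_facts:
  assumes f: "slice1_cell (Mon_l A) E f"
  defines "r \<equiv> csrc f" and "r' \<equiv> ctrg f" and "L \<equiv> fst (body f)" and "\<tau> \<equiv> body (snd (body f))"
  shows "mon1_cell A r" "ctrg r = E" "mon1_cell A r'" "ctrg r' = E"
    "mon1_cell A L" "csrc L = csrc r" "ctrg L = csrc r'"
    "\<tau> \<in> cells2 A" "Dom A \<tau> = und (body r') \<cdot> und (body L)" "Cod A \<tau> = und (body r)"
    "src2 A \<tau> = car (csrc r)" "trg2 A \<tau> = XX"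
  using f unfolding slice1_cell_Mon_l r_def r'_def L_def \<tau>_def by simp_all

text \<open>The source and target of the 2-cell in a 1-cell of the slice are dictated by the rest, so it is
  determined by its underlying 2-cell.\<close>

lemma slice1_collapse:
  assumes f: "slice1_cell (Mon_l A) E f"
  shows "snd (body f) = Cell (mon_comp1 A (ctrg f) (fst (body f))) (csrc f) (body (snd (body f)))"
  using f unfolding slice1_cell_Mon_l by (intro cell.expand) simp

lemma transpose1_eq:
  assumes f: "slice1_cell (Mon_l A) E f"
  shows "transpose1 A X XX cur1 f = transposed1 (csrc f) (ctrg f) (fst (body f)) (body (snd (body f)))"
  unfolding transposed1_def[OF slice1_facts[OF f]]
  using slice1_facts(6)[OF f]
  by (simp add: transpose1_def split_def Let_def vars2_def ap2_def)

lemma transpose1_sel: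
  assumes f: "slice1_cell (Mon_l A) E f"
  shows "csrc (transpose1 A X XX cur1 f) = transpose0 A X XX cur1 (csrc f)"
    "ctrg (transpose1 A X XX cur1 f) = transpose0 A X XX cur1 (ctrg f)"
    "body (transpose1 A X XX cur1 f) = (fst (body f),
      ev \<rhd> \<llangle>body (snd (body f)) \<lhd> pr1 A (car (csrc (csrc f))) X, id2 (pr2 A (car (csrc (csrc f))) X)\<rrangle>)"
  unfolding transpose1_eq[OF f] transposed1_def[OF slice1_facts[OF f]] by simp_all

lemma act1_cell_transpose1:
  assumes f: "slice1_cell (Mon_l A) E f"
  shows "act1_cell A X (transpose1 A X XX cur1 f)"
  unfolding transpose1_eq[OF f] act1_cell_transposed1_iff[OF slice1_facts[OF f]]
    slice1_collapse[OF f, symmetric]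
  using f unfolding slice1_cell_Mon_l by blast

lemma transpose1_inject:
  assumes f: "slice1_cell (Mon_l A) E f" and g: "slice1_cell (Mon_l A) E g"
    and eq: "transpose1 A X XX cur1 f = transpose1 A X XX cur1 g"
  shows "f = g"
proof -
  note F = slice1_facts[OF f] and G = slice1_facts[OF g]
  have c: "csrc g = csrc f" "ctrg g = ctrg f"
    using transpose0_inject[OF F(1,2) G(1,2)] transpose0_inject[OF F(3,4) G(3,4)] eq
      transpose1_sel[OF f] transpose1_sel[OF g] by simp_all
  note [simp] = F G[unfolded c]
  have L: "fst (body g) = fst (body f)"
    using eq transpose1_sel(3)[OF f] transpose1_sel(3)[OF g] by simp
  have \<tau>: "body (snd (body f)) = body (snd (body g))"
    by (rule app2_inject[where e = "car (csrc (csrc f))"])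
      (use eq transpose1_sel(3)[OF f] transpose1_sel(3)[OF g] c in simp_all)
  show ?thesis
  proof (rule cell.expand, intro conjI prod_eqI)
    show "snd (body f) = snd (body g)"
      by (subst slice1_collapse[OF f], subst slice1_collapse[OF g]) (simp only: c L \<tau>)
  qed (simp_all add: c L)
qed

lemma transpose1_surj:
  assumes g: "act1_cell A X g"
  obtains f where "slice1_cell (Mon_l A) E f" "transpose1 A X XX cur1 f = g"
proof -
  let ?L = "fst (body g)" and ?\<xi> = "snd (body g)" and ?C = "car (amon (csrc g))"
  have P: "action_object A X (csrc g)" "action_object A X (ctrg g)"
    and L: "mon1_cell A ?L" "csrc ?L = amon (csrc g)" "ctrg ?L = amon (ctrg g)"
    and \<xi>: "?\<xi> \<in> hom2 A (act (ctrg g) \<cdot> \<langle>und (body ?L) \<cdot> pr1 A ?C X, pr2 A ?C X\<rangle>)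
      (act (csrc g) \<cdot> \<langle>pr1 A ?C X, pr2 A ?C X\<rangle>)"
    using g unfolding act1_cell_def Let_def split_def vars2_def vars3_def fst_conv snd_conv ap1_def by blast+
  obtain r where r: "mon1_cell A r" "ctrg r = E" "transpose0 A X XX cur1 r = csrc g"
    using transpose0_surj[OF P(1)] .
  obtain r' where r': "mon1_cell A r'" "ctrg r' = E" "transpose0 A X XX cur1 r' = ctrg g"
    using transpose0_surj[OF P(2)] .
  have M: "amon (csrc g) = csrc r" "amon (ctrg g) = csrc r'"
    using transpose0_simps(1)[OF r(1,2)] transpose0_simps(1)[OF r'(1,2)] r(3) r'(3) by simp_all
  have S: "act (csrc g) = ev \<cdot> \<langle>und (body r) \<cdot> pr1 A ?C X, pr2 A ?C X\<rangle>"
    "act (ctrg g) = ev \<cdot> \<langle>und (body r') \<cdot> pr1 A (car (csrc r')) X, pr2 A (car (csrc r')) X\<rangle>"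
    using transpose0_simps(2)[OF r(1,2)] transpose0_simps(2)[OF r'(1,2)] r(3) r'(3) M by simp_all
  note [simp] = r(1,2) r'(1,2) L[unfolded M]
  obtain \<tau> where \<tau>: "\<tau> \<in> cells2 A" "Dom A \<tau> = und (body r') \<cdot> und (body ?L)" "Cod A \<tau> = und (body r)"
    "src2 A \<tau> = ?C" "trg2 A \<tau> = XX" and app: "ev \<rhd> \<llangle>\<tau> \<lhd> pr1 A ?C X, id2 (pr2 A ?C X)\<rrangle> = ?\<xi>"
    by (rule obtain_curried2[where e = ?C and s = ?\<xi> and F = "und (body r') \<cdot> und (body ?L)"
          and G = "und (body r)"]) (use \<xi> M in \<open>simp_all add: S hom2_iff\<close>)
  define f where "f = Cell r r' (?L, Cell (mon_comp1 A r' ?L) r \<tau>)"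
  have facts: "mon1_cell A r" "ctrg r = E" "mon1_cell A r'" "ctrg r' = E" "mon1_cell A ?L"
    "csrc ?L = csrc r" "ctrg ?L = csrc r'" "\<tau> \<in> cells2 A" "Dom A \<tau> = und (body r') \<cdot> und (body ?L)"
    "Cod A \<tau> = und (body r)" "src2 A \<tau> = car (csrc r)" "trg2 A \<tau> = XX"
    using \<tau> M by simp_all
  have g': "g = transposed1 r r' ?L \<tau>"
    unfolding transposed1_def[OF facts] using r(3) r'(3) app M by (intro cell.expand) simp
  have "mon2_cell A (Cell (mon_comp1 A r' ?L) r \<tau>)"
    using act1_cell_transposed1_iff[OF facts] g g' by simp
  then have f: "slice1_cell (Mon_l A) E f"
    unfolding slice1_cell_Mon_l f_def by simp
  moreover have "transpose1 A X XX cur1 f = g"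
    unfolding transpose1_eq[OF f] by (subst g') (simp add: f_def)
  ultimately show ?thesis by (rule that)
qed

section \<open>Transposition of 2-cells\<close>

text \<open>For the same reason the triangle in \<open>Mon_l\<close> amounts to an equation between underlying 2-cells.\<close>

lemma slice2_cell_Mon_l:
  "slice2_cell (Mon_l A) E t \<longleftrightarrow>
    slice1_cell (Mon_l A) E (csrc t) \<and> slice1_cell (Mon_l A) E (ctrg t) \<and>
    csrc (csrc t) = csrc (ctrg t) \<and> ctrg (csrc t) = ctrg (ctrg t) \<and>
    mon2_cell A (body t) \<and> csrc (body t) = fst (body (csrc t)) \<and> ctrg (body t) = fst (body (ctrg t)) \<and>
    body (snd (body (ctrg t))) \<bullet> (und (body (ctrg (csrc t))) \<rhd> body (body t)) = body (snd (body (csrc t)))"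
    (is "_ \<longleftrightarrow> ?s \<and> ?s' \<and> ?c \<and> ?c' \<and> ?m \<and> ?d \<and> ?d' \<and> ?e")
proof -
  have "snd (body (ctrg t)) \<bullet>\<^bsub>Mon_l A\<^esub> (ctrg (csrc t) \<rhd>\<^bsub>Mon_l A\<^esub> body t) = snd (body (csrc t)) \<longleftrightarrow> ?e"
    if s: ?s ?s' and c: ?c ?c' and d: ?d
  proof -
    have e: "snd (body (ctrg t)) \<bullet>\<^bsub>Mon_l A\<^esub> (ctrg (csrc t) \<rhd>\<^bsub>Mon_l A\<^esub> body t) =
      Cell (mon_comp1 A (ctrg (csrc t)) (fst (body (csrc t)))) (csrc (csrc t))
        (body (snd (body (ctrg t))) \<bullet> (und (body (ctrg (csrc t))) \<rhd> body (body t)))"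
      using s(2) c d unfolding slice1_cell_Mon_l by (simp add: whisker_left_def)
    show ?thesis
      unfolding e by (subst slice1_collapse[OF s(1)]) simp
  qed
  moreover have "slice2_cell (Mon_l A) E t \<longleftrightarrow> ?s \<and> ?s' \<and> ?c \<and> ?c' \<and> ?m \<and> ?d \<and> ?d' \<and>
      snd (body (ctrg t)) \<bullet>\<^bsub>Mon_l A\<^esub> (ctrg (csrc t) \<rhd>\<^bsub>Mon_l A\<^esub> body t) = snd (body (csrc t))"
    unfolding slice2_cell_def Let_def split_def hom2_def by simp
  ultimately show ?thesis by blast
qed

text \<open>The triangle of a 2-cell of actions is the evaluation of the triangle in the slice.\<close>

lemma act2_cell_transpose_iff:
  assumes f: "slice1_cell (Mon_l A) E f" and g: "slice1_cell (Mon_l A) E g"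
  shows "act2_cell A X (Cell (transpose1 A X XX cur1 f) (transpose1 A X XX cur1 g) t) \<longleftrightarrow>
    slice2_cell (Mon_l A) E (Cell f g t)" (is "?act \<longleftrightarrow> ?slice")
proof -
  let ?r = "csrc f" and ?r' = "ctrg f" and ?L = "fst (body f)" and ?\<tau> = "body (snd (body f))"
    and ?\<tau>' = "body (snd (body g))"
  let ?C = "car (csrc ?r)"
  let ?p = "pr1 A ?C X" and ?x = "pr2 A ?C X"
  note F = slice1_facts[OF f] and G = slice1_facts[OF g]
  have c: "transpose0 A X XX cur1 (csrc f) = transpose0 A X XX cur1 (csrc g) \<longleftrightarrow> csrc f = csrc g"
    "transpose0 A X XX cur1 (ctrg f) = transpose0 A X XX cur1 (ctrg g) \<longleftrightarrow> ctrg f = ctrg g"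
    using transpose0_inject[OF F(1,2) G(1,2)] transpose0_inject[OF F(3,4) G(3,4)] by auto
  have eq: "(ev \<rhd> \<llangle>?\<tau>' \<lhd> ?p, id2 ?x\<rrangle>) \<bullet> ap2 A (act (transpose0 A X XX cur1 ?r')) (body t \<lhd> ?p) (id2 ?x) =
        ev \<rhd> \<llangle>?\<tau> \<lhd> ?p, id2 ?x\<rrangle> \<longleftrightarrow> ?\<tau>' \<bullet> (und (body ?r') \<rhd> body t) = ?\<tau>"
    if c: "csrc f = csrc g" "ctrg f = ctrg g" and t: "mon2_cell A t" "csrc t = ?L" "ctrg t = fst (body g)"
  proof -
    note [simp] = F G[folded c] t
    have "(ev \<rhd> \<llangle>?\<tau>' \<lhd> ?p, id2 ?x\<rrangle>) \<bullet> ap2 A (act (transpose0 A X XX cur1 ?r')) (body t \<lhd> ?p) (id2 ?x) =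
        ev \<rhd> \<llangle>(?\<tau>' \<bullet> (und (body ?r') \<rhd> body t)) \<lhd> ?p, id2 ?x\<rrangle>"
      by (simp add: ap2_def)
    moreover have "?\<tau>' \<bullet> (und (body ?r') \<rhd> body t) = ?\<tau>"
      if "ev \<rhd> \<llangle>(?\<tau>' \<bullet> (und (body ?r') \<rhd> body t)) \<lhd> ?p, id2 ?x\<rrangle> = ev \<rhd> \<llangle>?\<tau> \<lhd> ?p, id2 ?x\<rrangle>"
      by (rule app2_inject[OF _ _ _ _ _ _ that]) simp_all
    ultimately show ?thesis by metis
  qed
  have "?act \<longleftrightarrow> csrc f = csrc g \<and> ctrg f = ctrg g \<and> mon2_cell A t \<and> csrc t = ?L \<and> ctrg t = fst (body g) \<and>
      (ev \<rhd> \<llangle>?\<tau>' \<lhd> ?p, id2 ?x\<rrangle>) \<bullet> ap2 A (act (transpose0 A X XX cur1 ?r')) (body t \<lhd> ?p) (id2 ?x) =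
        ev \<rhd> \<llangle>?\<tau> \<lhd> ?p, id2 ?x\<rrangle>"
    using act1_cell_transpose1[OF f] act1_cell_transpose1[OF g]
    unfolding act2_cell_def Let_def cell.sel transpose1_sel[OF f] transpose1_sel[OF g] prod.case vars2_def
      c transpose0_simps(1)[OF F(1,2)]
    by auto
  also have "\<dots> \<longleftrightarrow> ?slice"
    unfolding slice2_cell_Mon_l cell.sel using f g eq by blast
  finally show ?thesis .
qed

section \<open>The isomorphism\<close>

lemma ActMon_l_sel [simp]:
  "cells0 (ActMon_l A X) = {P. action_object A X P}" "cells1 (ActMon_l A X) = {f. act1_cell A X f}"
  "cells2 (ActMon_l A X) = {t. act2_cell A X t}" "src (ActMon_l A X) = csrc"
  "trg (ActMon_l A X) = ctrg" "Dom (ActMon_l A X) = csrc" "Cod (ActMon_l A X) = ctrg"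
  "idn1 (ActMon_l A X) P = Cell P P (mon_id1 A (amon P), id2 (act P))"
  "idn2 (ActMon_l A X) f = Cell f f (id2\<^bsub>Mon_l A\<^esub> (fst (body f)))"
  "comp1 (ActMon_l A X) = act_comp1 A X"
  "vcomp (ActMon_l A X) t s = Cell (csrc s) (ctrg t) (body t \<bullet>\<^bsub>Mon_l A\<^esub> body s)"
  "hcomp (ActMon_l A X) t s = Cell (act_comp1 A X (csrc t) (csrc s)) (act_comp1 A X (ctrg t) (ctrg s))
     (body t \<ast>\<^bsub>Mon_l A\<^esub> body s)"
  by (simp_all add: ActMon_l_def)

lemma bij_transpose0:
  "bij_betw (transpose0 A X XX cur1) {r. slice0_cell (Mon_l A) E r} {P. action_object A X P}"
  unfolding bij_betw_def
proof
  show "inj_on (transpose0 A X XX cur1) {r. slice0_cell (Mon_l A) E r}"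
    by (rule inj_onI) (simp add: slice0_cell_Mon_l transpose0_inject)
  show "transpose0 A X XX cur1 ` {r. slice0_cell (Mon_l A) E r} = {P. action_object A X P}"
  proof (intro equalityI subsetI)
    fix P assume "P \<in> {P. action_object A X P}"
    then obtain r where "mon1_cell A r" "ctrg r = E" "transpose0 A X XX cur1 r = P"
      using transpose0_surj[of P] by blast
    then show "P \<in> transpose0 A X XX cur1 ` {r. slice0_cell (Mon_l A) E r}"
      by (intro image_eqI[of _ _ r]) (simp_all add: slice0_cell_Mon_l)
  qed (auto simp: slice0_cell_Mon_l action_object_transpose0)
qed

lemma bij_transpose1:
  "bij_betw (transpose1 A X XX cur1) {f. slice1_cell (Mon_l A) E f} {f. act1_cell A X f}"
  unfolding bij_betw_def
proof
  show "inj_on (transpose1 A X XX cur1) {f. slice1_cell (Mon_l A) E f}"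
    by (rule inj_onI) (simp add: transpose1_inject)
  show "transpose1 A X XX cur1 ` {f. slice1_cell (Mon_l A) E f} = {f. act1_cell A X f}"
  proof (intro equalityI subsetI)
    fix g assume "g \<in> {f. act1_cell A X f}"
    then obtain f where "slice1_cell (Mon_l A) E f" "transpose1 A X XX cur1 f = g"
      using transpose1_surj[of g] by blast
    then show "g \<in> transpose1 A X XX cur1 ` {f. slice1_cell (Mon_l A) E f}"
      by (intro image_eqI[of _ _ f]) simp_all
  qed (auto simp: act1_cell_transpose1)
qed

lemma bij_transpose2:
  "bij_betw (transpose2 A X XX cur1) {t. slice2_cell (Mon_l A) E t} {t. act2_cell A X t}"
  unfolding bij_betw_def
proof
  have ends: "slice1_cell (Mon_l A) E (csrc t)" "slice1_cell (Mon_l A) E (ctrg t)"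
    if "slice2_cell (Mon_l A) E t" for t
    using that unfolding slice2_cell_Mon_l by blast+
  show "inj_on (transpose2 A X XX cur1) {t. slice2_cell (Mon_l A) E t}"
  proof (rule inj_onI)
    fix s t assume "s \<in> {t. slice2_cell (Mon_l A) E t}" "t \<in> {t. slice2_cell (Mon_l A) E t}"
      and eq: "transpose2 A X XX cur1 s = transpose2 A X XX cur1 t"
    then have st: "slice2_cell (Mon_l A) E s" "slice2_cell (Mon_l A) E t" by simp_all
    have "csrc s = csrc t"
      by (rule transpose1_inject[OF ends(1)[OF st(1)] ends(1)[OF st(2)]]) (use eq in \<open>simp add: transpose2_def\<close>)
    moreover have "ctrg s = ctrg t"
      by (rule transpose1_inject[OF ends(2)[OF st(1)] ends(2)[OF st(2)]]) (use eq in \<open>simp add: transpose2_def\<close>)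
    ultimately show "s = t"
      using eq by (intro cell.expand) (simp add: transpose2_def)
  qed
  show "transpose2 A X XX cur1 ` {t. slice2_cell (Mon_l A) E t} = {t. act2_cell A X t}"
  proof (intro equalityI subsetI)
    fix t assume "t \<in> transpose2 A X XX cur1 ` {t. slice2_cell (Mon_l A) E t}"
    then obtain s where s: "slice2_cell (Mon_l A) E s" "t = transpose2 A X XX cur1 s" by blast
    then show "t \<in> {t. act2_cell A X t}"
      using act2_cell_transpose_iff[OF ends[OF s(1)], of "body s"] by (simp add: transpose2_def)
  next
    fix t assume "t \<in> {t. act2_cell A X t}"
    then have t: "act2_cell A X t" by simp
    then have "act1_cell A X (csrc t)" "act1_cell A X (ctrg t)"
      unfolding act2_cell_def Let_def split_def vars2_def by blast+
    then obtain f g where fg: "slice1_cell (Mon_l A) E f" "transpose1 A X XX cur1 f = csrc t"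
      "slice1_cell (Mon_l A) E g" "transpose1 A X XX cur1 g = ctrg t"
      using transpose1_surj by metis
    then have "slice2_cell (Mon_l A) E (Cell f g (body t))"
      using act2_cell_transpose_iff[OF fg(1,3), of "body t"] t by simp
    moreover have "t = transpose2 A X XX cur1 (Cell f g (body t))"
      using fg by (simp add: transpose2_def)
    ultimately show "t \<in> transpose2 A X XX cur1 ` {t. slice2_cell (Mon_l A) E t}" by blast
  qed
qed

lemma transpose1_comp1:
  assumes f: "slice1_cell (Mon_l A) E f" and g: "slice1_cell (Mon_l A) E g" and gf: "csrc g = ctrg f"
  shows "act_comp1 A X (transpose1 A X XX cur1 g) (transpose1 A X XX cur1 f) =
    transpose1 A X XX cur1 (slice_comp1 (Mon_l A) g f)"
proof -
  interpret Mon: two_category "Mon_l A" by (rule two_category_Mon_l)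
  let ?C = "car (csrc (csrc f))" and ?F = "und (body (fst (body f)))"
  let ?\<tau> = "body (snd (body f))" and ?\<kappa> = "body (snd (body g))"
  note F = slice1_facts[OF f] and G = slice1_facts[OF g, unfolded gf]
  have sl: "slice1_cell (Mon_l A) E (slice_comp1 (Mon_l A) g f)"
    by (rule Mon.slice_comp1_cell[OF f g gf])
  note [simp] = F G
  have k: "body (snd (body g) \<lhd>\<^bsub>Mon_l A\<^esub> fst (body f)) = ?\<kappa> \<lhd> ?F"
    by (simp add: whisker_right_def)
  have "(ev \<rhd> \<llangle>?\<tau> \<lhd> pr1 A ?C X, id2 (pr2 A ?C X)\<rrangle>) \<bullet>
      ((ev \<rhd> \<llangle>?\<kappa> \<lhd> pr1 A (car (csrc (ctrg f))) X, id2 (pr2 A (car (csrc (ctrg f))) X)\<rrangle>) \<lhd> \<langle>?F \<cdot> pr1 A ?C X, pr2 A ?C X\<rangle>) =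
      ev \<rhd> \<llangle>(?\<tau> \<bullet> (?\<kappa> \<lhd> ?F)) \<lhd> pr1 A ?C X, id2 (pr2 A ?C X)\<rrangle>"
    by simp
  then show ?thesis
    unfolding act_comp1_def transpose1_sel[OF f] transpose1_sel[OF g] prod.case vars2_def Let_def at2_def
    by (intro cell.expand)
      (simp add: transpose1_sel[OF sl] k gf del: whisker_right_vcomp pair2_vcomp_id2 whisker_left_vcomp)
qed

theorem transposition_isomorphism:
  "two_category_isomorphism (lax_slice (Mon_l A) E) (ActMon_l A X) (transposition A X XX cur1)"
proof -
  interpret Mon: two_category "Mon_l A" by (rule two_category_Mon_l)
  have m [simp]: "map0 (transposition A X XX cur1) = transpose0 A X XX cur1"
    "map1 (transposition A X XX cur1) = transpose1 A X XX cur1"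
    "map2 (transposition A X XX cur1) = transpose2 A X XX cur1"
    by (simp_all add: transposition_def)
  have ends: "slice1_cell (Mon_l A) E (csrc t)" "slice1_cell (Mon_l A) E (ctrg t)"
    if "slice2_cell (Mon_l A) E t" for t
    using that unfolding slice2_cell_Mon_l by blast+
  show ?thesis
  proof (rule two_category_isomorphismI)
    show "two_category (lax_slice (Mon_l A) E)" by (rule Mon.two_category_lax_slice)
    fix r assume "r \<in> cells0 (lax_slice (Mon_l A) E)"
    then have r [simp]: "mon1_cell A r" "ctrg r = E" by (simp_all add: slice0_cell_Mon_l)
    show "idn1 (ActMon_l A X) (map0 (transposition A X XX cur1) r) =
        map1 (transposition A X XX cur1) (idn1 (lax_slice (Mon_l A) E) r)"
      by (simp add: transpose1_def vars2_def ap2_def)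
  next
    fix f assume "f \<in> cells1 (lax_slice (Mon_l A) E)"
    then have f: "slice1_cell (Mon_l A) E f" by simp
    show "idn2 (ActMon_l A X) (map1 (transposition A X XX cur1) f) =
        map2 (transposition A X XX cur1) (idn2 (lax_slice (Mon_l A) E) f)"
      by (simp add: transpose2_def transpose1_sel[OF f])
  next
    fix s t assume "s \<in> cells2 (lax_slice (Mon_l A) E)" "t \<in> cells2 (lax_slice (Mon_l A) E)"
      "src (lax_slice (Mon_l A) E) (Dom (lax_slice (Mon_l A) E) t) =
        trg (lax_slice (Mon_l A) E) (Dom (lax_slice (Mon_l A) E) s)"
    then have s: "slice2_cell (Mon_l A) E s" and t: "slice2_cell (Mon_l A) E t"
      and ts: "csrc (csrc t) = ctrg (csrc s)" by simp_all
    have ts': "csrc (ctrg t) = ctrg (ctrg s)"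
      using s t ts unfolding slice2_cell_Mon_l by simp
    show "hcomp (ActMon_l A X) (map2 (transposition A X XX cur1) t) (map2 (transposition A X XX cur1) s) =
        map2 (transposition A X XX cur1) (hcomp (lax_slice (Mon_l A) E) t s)"
      using transpose1_comp1[OF ends(1)[OF s] ends(1)[OF t] ts]
        transpose1_comp1[OF ends(2)[OF s] ends(2)[OF t] ts']
      by (simp add: transpose2_def)
  qed (simp_all add: bij_transpose0 bij_transpose1 bij_transpose2 transpose1_sel transpose1_comp1 transpose2_def)
qed

lemma strong_action_transpose0:
  assumes r: "strong_monoidal A r" "ctrg r = E"
  shows "strong_action A X (transpose0 A X XX cur1 r)"
proof -
  have [simp]: "mon1_cell A r" "ctrg r = E" and inv: "invertible2 A (mlt (body r))" "invertible2 A (ult (body r))"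
    using r by (simp_all add: strong_monoidal_def)
  let ?C = "car (csrc r)"
  have "amlt (transpose0 A X XX cur1 r) = ev \<rhd> \<llangle>mlt (body r) \<lhd>
      \<langle>pr1 A ?C (?C \<^bold>\<times> X), pr1 A ?C X \<cdot> pr2 A ?C (?C \<^bold>\<times> X)\<rangle>, id2 (pr2 A ?C X \<cdot> pr2 A ?C (?C \<^bold>\<times> X))\<rrangle>"
    by (simp add: transpose0_def Let_def vars2_def vars3_def ap2_def at2_def)
  then have "invertible2 A (amlt (transpose0 A X XX cur1 r))"
    by (simp add: inv invertible2_whisker_left invertible2_pair2 invertible2_whisker_right invertible2_id2)
  moreover have "invertible2 A (ault (transpose0 A X XX cur1 r))"
    by (simp add: inv invertible2_whisker_left invertible2_pair2 invertible2_whisker_right invertible2_id2)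
  ultimately show ?thesis
    by (simp add: strong_action_def action_object_transpose0)
qed

end

theorem proposition3p3:
  fixes A :: "('o, 'a, 'c) fp_two_cat"
    and X XX :: 'o
    and cur1 :: "'o \<Rightarrow> 'a \<Rightarrow> 'a"
    and cur2 :: "'o \<Rightarrow> 'c \<Rightarrow> 'c"
  assumes "fp_two_category A"
    and "X \<in> cells0 A"
    and "exponential A X X XX cur1 cur2"
  shows "let E = endo_mon A X XX cur1; \<Phi> = transposition A X XX cur1 in
    two_category (Mon_l A) \<and> E \<in> cells0 (Mon_l A) \<and>
    two_category_isomorphism (lax_slice (Mon_l A) E) (ActMon_l A X) \<Phi> \<and>
    commutes_over (lax_slice (Mon_l A) E) \<Phi> (slice_forget (Mon_l A)) act_forget \<and>
    (\<forall>r \<in> cells0 (lax_slice (Mon_l A) E). strong_monoidal A r \<longrightarrow> strong_action A X (map0 \<Phi> r))"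
proof -
  interpret self_exponential A X XX cur1 cur2
    using assms by (simp add: self_exponential_def self_exponential_axioms_def)
  interpret Mon: two_category "Mon_l A" by (rule two_category_Mon_l)
  have "commutes_over (lax_slice (Mon_l A) E) (transposition A X XX cur1) (slice_forget (Mon_l A)) act_forget"
    by (simp add: commutes_over_def transposition_def slice_forget_def act_forget_def slice0_cell_Mon_l
        transpose1_sel transpose2_def)
  moreover have "\<forall>r \<in> cells0 (lax_slice (Mon_l A) E). strong_monoidal A r \<longrightarrow>
      strong_action A X (map0 (transposition A X XX cur1) r)"
    by (simp add: slice0_cell_Mon_l strong_action_transpose0 transposition_def)
  ultimately show ?thesis
    using two_category_Mon_l transposition_isomorphism by (simp add: Let_def)
qed

end
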